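(* Assume $0\in\mathcal{A}$. Then there exist $\delta>0$ and constants $\tilde R_\alpha\in[0,\infty)$, $\alpha\in\mathbb{N}$, such that for every solution $u(\cdot)$ of the NSE lying in $\mathcal{A}$, the function $A^{\alpha/2}u(\zeta)$ is $H_{\mathbb{C}}$-valued analytic in the strip $\mathcal{S}(\delta)$ and satisfies $|A^{\alpha/2}u(\zeta)|\le \tilde R_\alpha\,\nu\kappa_0^{\alpha}$ for all $\zeta\in\mathcal{S}(\delta)$ and all $\alpha\in\mathbb{N}$. Here $u(\zeta)$ denotes the analytic extension of $u$, which satisfies the NSE with complexified time $\frac{du(\zeta)}{d\zeta}+\nu Au(\zeta)+B(u(\zeta),u(\zeta))=g$.
   Context: Setting: 2D incompressible Navier–Stokes equations on $\Omega=[0,L]^2$ with periodic boundary conditions, viscosity $\nu>0$, $\kappa_0=2\pi/L$. $H$ is the closure in $L^2(\Omega)^2$ of the $\mathbb{R}^2$-valued trigonometric polynomials $v$ with $\nabla\cdot v=0$ and $\int_\Omega v\,dx=0$, with the $L^2$ inner product $(\cdot,\cdot)$ and norm $|\cdot|$. $A=-\Delta$ is the Stokes operator on $H$ (positive, self-adjoint, compact inverse, eigenvalues $\kappa_0^2\le\lambda_1\le\lambda_2\le\dots$), $A^\sigma$ are its powers defined spectrally, $\mathcal{D}(A^\sigma)$ their domains. $B(u,v)=\mathcal{P}((u\cdot\nabla)v)$ with $\mathcal{P}$ the Leray projection, and $g\in H$ is a fixed time-independent force. The NSE is $\frac{du}{dt}+\nu Au+B(u,u)=g$ in $H$. The global attractor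 $\mathcal{A}$ is the set of all $u_0\in H$ for which there exists a solution $u(t)$ of the NSE defined for all $t\in\mathbb{R}$ with $u(0)=u_0$ and $\sup_{t\in\mathbb{R}}|u(t)|<\infty$; "a solution in $\mathcal{A}$" means such a solution $u(t)$, $t\in\mathbb{R}$. Complexification: $H_{\mathbb{C}}=H+iH$ with the induced complex Hilbert structure, $D_{\mathbb{C}}=D+iD$ for subspaces $D\subset H$, and $A$, $B$ are extended complex-linearly / complex-bilinearly. For $\delta>0$, $\mathcal{S}(\delta)=\{\zeta\in\mathbb{C}:|\Im\zeta|<\delta\}$. *)

theory Defs
  imports "HOL-Analysis.Analysis"
begin

text \<open>Fourier representation. A (complex) vector field on the torus [0,L]^2 is
  represented by its Fourier coefficients: u(x) = sum over k in Z^2 of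
  uhat(k) exp(i kappa0 k.x), with uhat(k) in C^2 (modelled as complex * complex).\<close>

type_synonym vf = "int \<times> int \<Rightarrow> complex \<times> complex"

definition kap :: "real \<Rightarrow> real" where
  "kap L = 2 * pi / L"

definition knorm :: "int \<times> int \<Rightarrow> real" where
  "knorm k = sqrt (real_of_int (fst k) ^ 2 + real_of_int (snd k) ^ 2)"

definition kvec :: "int \<times> int \<Rightarrow> complex \<times> complex" where
  "kvec k = (of_int (fst k), of_int (snd k))"

definition csc :: "complex \<Rightarrow> complex \<times> complex \<Rightarrow> complex \<times> complex" where
  "csc c v = (c * fst v, c * snd v)"

definition dotc :: "complex \<times> complex \<Rightarrow> complex \<times> complex \<Rightarrow> complex" where
  "dotc v w = fst v * fst w + snd v * snd w"

definition conjv :: "complex \<times> complex \<Rightarrow> complex \<times> complex" where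
  "conjv v = (cnj (fst v), cnj (snd v))"

text \<open>H_C = H + iH: square-summable, divergence-free, mean-zero coefficient sequences.\<close>
definition HC :: "vf set" where
  "HC = {u. u (0,0) = 0 \<and> (\<forall>k. dotc (kvec k) (u k) = 0)
            \<and> (\<lambda>k. norm (u k) ^ 2) summable_on UNIV}"

text \<open>H: the real-valued elements (uhat(-k) = conj (uhat k)).\<close>
definition H :: "vf set" where
  "H = {u \<in> HC. \<forall>k. u (- fst k, - snd k) = conjv (u k)}"

text \<open>L^2(Omega) norm: |u|^2 = L^2 * sum_k |uhat(k)|^2.\<close>
definition hnorm :: "real \<Rightarrow> vf \<Rightarrow> real" where
  "hnorm L u = sqrt (L ^ 2 * (\<Sum>\<^sub>\<infinity>k. norm (u k) ^ 2))"

text \<open>A^(alpha/2), alpha natural: Fourier multiplier (kappa0 |k|)^alpha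
  (A = -Laplacian has symbol kappa0^2 |k|^2).\<close>
definition Ahalf :: "real \<Rightarrow> nat \<Rightarrow> vf \<Rightarrow> vf" where
  "Ahalf L \<alpha> u = (\<lambda>k. csc (complex_of_real ((kap L * knorm k) ^ \<alpha>)) (u k))"

definition Aop :: "real \<Rightarrow> vf \<Rightarrow> vf" where
  "Aop L u = Ahalf L 2 u"

definition leray :: "vf \<Rightarrow> vf" where
  "leray w = (\<lambda>k. if k = (0,0) then 0
      else w k - csc (dotc (kvec k) (w k) / complex_of_real (knorm k ^ 2)) (kvec k))"

text \<open>B(u,v) = P((u . nabla) v), complex bilinear.\<close>
definition Bop :: "real \<Rightarrow> vf \<Rightarrow> vf \<Rightarrow> vf" where
  "Bop L u v = leray (\<lambda>k. \<Sum>\<^sub>\<infinity>p.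
      csc (dotc (u p) (csc (\<i> * complex_of_real (kap L)) (kvec (fst k - fst p, snd k - snd p))))
          (v (fst k - fst p, snd k - snd p)))"

definition has_tderiv :: "real \<Rightarrow> (real \<Rightarrow> vf) \<Rightarrow> vf \<Rightarrow> real \<Rightarrow> bool" where
  "has_tderiv L u u' t \<longleftrightarrow> u' \<in> HC \<and>
     ((\<lambda>h. hnorm L (\<lambda>k. scaleR (1 / h) (u (t + h) k - u t k) - u' k)) \<longlongrightarrow> 0) (at 0)"

definition has_cderiv :: "real \<Rightarrow> (complex \<Rightarrow> vf) \<Rightarrow> vf \<Rightarrow> complex \<Rightarrow> bool" where
  "has_cderiv L U U' z \<longleftrightarrow> U' \<in> HC \<and>
     ((\<lambda>h. hnorm L (\<lambda>k. csc (1 / h) (U (z + h) k - U z k) - U' k)) \<longlongrightarrow> 0) (at 0)"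

definition HC_analytic_on :: "real \<Rightarrow> (complex \<Rightarrow> vf) \<Rightarrow> complex set \<Rightarrow> bool" where
  "HC_analytic_on L F S \<longleftrightarrow> (\<forall>z\<in>S. F z \<in> HC \<and> (\<exists>F'. has_cderiv L F F' z))"

definition nse_solution :: "real \<Rightarrow> real \<Rightarrow> vf \<Rightarrow> (real \<Rightarrow> vf) \<Rightarrow> bool" where
  "nse_solution L \<nu> g u \<longleftrightarrow> (\<forall>t. u t \<in> H \<and> Aop L (u t) \<in> HC \<and>
     (\<exists>u'. has_tderiv L u u' t \<and>
        (\<forall>k. u' k + scaleR \<nu> (Aop L (u t) k) + Bop L (u t) (u t) k = g k)))"

definition solution_in_attractor :: "real \<Rightarrow> real \<Rightarrow> vf \<Rightarrow> (real \<Rightarrow> vf) \<Rightarrow> bool" where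
  "solution_in_attractor L \<nu> g u \<longleftrightarrow> nse_solution L \<nu> g u \<and> (\<exists>M. \<forall>t. hnorm L (u t) \<le> M)"

definition attractor :: "real \<Rightarrow> real \<Rightarrow> vf \<Rightarrow> vf set" where
  "attractor L \<nu> g = {u0. \<exists>u. solution_in_attractor L \<nu> g u \<and> u 0 = u0}"

definition strip :: "real \<Rightarrow> complex set" where
  "strip \<delta> = {z. \<bar>Im z\<bar> < \<delta>}"

end

theory Submission
  imports Defs "HOL-Complex_Analysis.Complex_Analysis"
begin

text \<open>
  A divergence-free field in two dimensions is scalar on the Fourier side, \<open>u\<^sub>k = a\<^sub>k k\<^sup>\<bottom> / |k|\<close>, so the
  equation becomes a quadratic system for scalar coefficients.

  Energy and enstrophy bounds are uniform over all solutions in the attractor. A solution is not known to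
  be differentiable in time with values in the enstrophy space, so the enstrophy is truncated to
  \<open>\<Sum> min(|k|, N)\<^sup>2 |a\<^sub>k|\<^sup>2\<close>; subadditivity of \<open>min(|k|, N)\<close> gives a commutator estimate that is uniform in \<open>N\<close>.
  The Duhamel formula on each mode then yields \<open>|a\<^sub>k| \<le> K w\<^sub>k\<close> with a summable weight \<open>w\<close> depending only on the
  force. In this weighted space the system is solved by Picard iteration along complex rays in a sector of fixed
  size starting at any real time, which extends every solution in the attractor analytically to a common strip.

  On the strip, Cauchy's estimate bounds the time derivative of \<open>u\<close> by \<open>u\<close> itself on a slightly larger strip. The
  solution through \<open>0\<close> has \<open>u'(0) = g\<close>, so the force is as smooth as the solutions are, and reading the equation
  as an elliptic one for \<open>A u\<close> gains one derivative. Iterating over shrinking strips of width at least half the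
  original gives all derivatives.
\<close>

section \<open>The Fourier lattice\<close>

text \<open>The force is only square-summable, so any decay of its coefficients beyond that must be
  extracted from the solution through 0.

  The enstrophy inequality has growth rate proportional to 1 + |grad u|^2, a priori bounded only on
  time average. The energy balance bounds this rate by a constant minus a multiple of the derivative
  of the energy, so the energy itself enters the integrating factor and no time integral appears.

  Contraction in the weight \<open>w\<close> is the delicate point: the nonlinear term decays like
  |k|^-1, while \<open>w\<close> is only known to be at least |k|^(-5/2). Parabolic smoothing must
  supply 3/2 of its 2 available powers; the spare 1/2 becomes smallness for short times, uniformly
  in \<open>k\<close>. All constants depend on the viscosity, the period and the force alone, which
  is why one strip serves all solutions.

  Each use of Cauchy's estimate costs strip width. The widths exceed half the original, and the
  final strip is a quarter of it, so that discs remain for norm differentiability.\<close>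

type_synonym idx = "int \<times> int"

definition crs :: "idx \<Rightarrow> idx \<Rightarrow> real" where
  "crs p q = real_of_int (fst p * snd q - snd p * fst q)"

definition dt :: "idx \<Rightarrow> idx \<Rightarrow> real" where
  "dt p q = real_of_int (fst p * fst q + snd p * snd q)"

lemma knorm_zero [simp]: "knorm 0 = 0" "knorm (0,0) = 0"
  by (auto simp: knorm_def)

lemma knorm_nonneg [simp]: "knorm k \<ge> 0"
  by (simp add: knorm_def)

lemma knorm_minus [simp]: "knorm (- k) = knorm k"
  by (simp add: knorm_def)

lemma knorm_minus_diff [simp]: "knorm (- p - q) = knorm (p + q)"
  by (metis knorm_minus minus_add_distrib uminus_add_conv_diff add.commute)

lemma knorm_sq: "knorm k ^ 2 = real_of_int (fst k) ^ 2 + real_of_int (snd k) ^ 2"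
  by (simp add: knorm_def)

lemma knorm_ge_1: "k \<noteq> 0 \<Longrightarrow> knorm k \<ge> 1"
proof -
  assume k: "k \<noteq> 0"
  have "(fst k)\<^sup>2 + (snd k)\<^sup>2 > 0"
    using k by (metis prod.collapse sum_power2_gt_zero_iff zero_prod_def)
  hence "(fst k)\<^sup>2 + (snd k)\<^sup>2 \<ge> 1" by linarith
  hence "real_of_int ((fst k)\<^sup>2 + (snd k)\<^sup>2) \<ge> 1" by linarith
  thus ?thesis by (simp add: knorm_def)
qed

lemma knorm_pos: "k \<noteq> 0 \<Longrightarrow> knorm k > 0"
  using knorm_ge_1 by fastforce

lemma knorm_eq_0_iff [simp]: "knorm k = 0 \<longleftrightarrow> k = 0"
  using knorm_pos by fastforce

lemma crs_dt_sq: "(crs p q)\<^sup>2 + (dt p q)\<^sup>2 = (knorm p * knorm q)\<^sup>2"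
  unfolding power_mult_distrib knorm_sq crs_def dt_def by (simp add: algebra_simps power2_eq_square)

lemma abs_crs_le: "\<bar>crs p q\<bar> \<le> knorm p * knorm q"
  by (rule power2_le_imp_le) (simp_all flip: crs_dt_sq)

lemma abs_dt_le: "\<bar>dt p q\<bar> \<le> knorm p * knorm q"
  by (rule power2_le_imp_le) (simp_all flip: crs_dt_sq)

lemma knorm_triangle: "knorm (p + q) \<le> knorm p + knorm q"
proof (rule power2_le_imp_le)
  have "knorm (p + q) ^ 2 = knorm p ^ 2 + knorm q ^ 2 + 2 * dt p q"
    unfolding knorm_sq dt_def by (simp add: power2_eq_square algebra_simps)
  also have "\<dots> \<le> (knorm p + knorm q) ^ 2"
    using abs_dt_le[of p q] by (simp add: power2_sum)
  finally show "knorm (p + q) ^ 2 \<le> (knorm p + knorm q) ^ 2" .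
qed simp

lemma knorm_triangle_diff: "knorm k \<le> knorm p + knorm (k - p)"
  using knorm_triangle[of p "k - p"] by simp

lemma crs_diff_self [simp]: "crs p (k - p) = crs p k"
  by (simp add: crs_def algebra_simps)

text \<open>For \<open>u_p = a_p p-perp / |p|\<close>, the factor with \<open>crs\<close> is the
  symbol of \<open>u . grad\<close> acting on mode \<open>k - p\<close>; the last factor is the
  cosine between the directions of \<open>k - p\<close> and \<open>k\<close>, which is the Leray
  projection. Division by zero makes the kernel vanish when \<open>p\<close>, \<open>k - p\<close>
  or \<open>k\<close> is 0.\<close>

definition bker :: "real \<Rightarrow> idx \<Rightarrow> idx \<Rightarrow> complex" where
  "bker \<kappa> p k = \<i> * complex_of_real (\<kappa> * crs p (k - p) / knorm p * (dt (k - p) k / (knorm (k - p) * knorm k)))"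

lemma abs_crs_div_le: "\<bar>crs p q / knorm p\<bar> \<le> knorm q"
proof (cases "p = 0")
  case False
  then show ?thesis using abs_crs_le[of p q] knorm_pos[of p]
    by (simp add: abs_divide pos_divide_le_eq mult.commute)
qed simp

lemma abs_dt_div_le: "\<bar>dt p q / (knorm p * knorm q)\<bar> \<le> 1"
proof (cases "p = 0 \<or> q = 0")
  case False
  then have "knorm p * knorm q > 0" by (simp add: knorm_pos)
  then show ?thesis using abs_dt_le[of p q]
    by (simp add: abs_divide divide_le_eq_1 abs_mult)
qed auto

lemma norm_bker_le_aux:
  assumes "\<kappa> \<ge> 0"
  shows "norm (bker \<kappa> p k) \<le> \<kappa> * \<bar>crs p (k - p) / knorm p\<bar>"
proof -
  have "norm (bker \<kappa> p k) = \<kappa> * \<bar>crs p (k - p) / knorm p\<bar> * \<bar>dt (k - p) k / (knorm (k - p) * knorm k)\<bar>"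
    using assms unfolding bker_def norm_mult norm_of_real by (simp add: abs_mult)
  also have "\<dots> \<le> \<kappa> * \<bar>crs p (k - p) / knorm p\<bar> * 1"
    using assms abs_dt_div_le by (intro mult_left_mono) auto
  finally show ?thesis by simp
qed

text \<open>Because \<open>crs p (k - p) = crs p k\<close>, the one derivative in the nonlinearity
  can be charged to the output mode \<open>k\<close> or to the differentiated mode
  \<open>k - p\<close>. The second form pairs with finite enstrophy, the first with weights that
  reproduce themselves under convolution.\<close>

lemma norm_bker_le:
  assumes "\<kappa> \<ge> 0"
  shows "norm (bker \<kappa> p k) \<le> \<kappa> * knorm k" "norm (bker \<kappa> p k) \<le> \<kappa> * knorm (k - p)"
proof -
  have "\<kappa> * \<bar>crs p (k - p) / knorm p\<bar> \<le> \<kappa> * knorm (k - p)"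
    by (rule mult_left_mono[OF abs_crs_div_le assms])
  thus "norm (bker \<kappa> p k) \<le> \<kappa> * knorm (k - p)"
    using norm_bker_le_aux[OF assms, of p k] by linarith
  have "\<kappa> * \<bar>crs p k / knorm p\<bar> \<le> \<kappa> * knorm k"
    by (rule mult_left_mono[OF abs_crs_div_le assms])
  thus "norm (bker \<kappa> p k) \<le> \<kappa> * knorm k"
    using norm_bker_le_aux[OF assms, of p k] by simp
qed

section \<open>Summation over the lattice\<close>

lemma summable_on_le:
  fixes f g :: "'a \<Rightarrow> real"
  assumes "g summable_on A" "\<And>x. x \<in> A \<Longrightarrow> 0 \<le> f x" "\<And>x. x \<in> A \<Longrightarrow> f x \<le> g x"
  shows "f summable_on A"
  by (rule summable_on_comparison_test[OF assms(1)]) (use assms in auto)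

lemma norm_summable_on_le:
  fixes f :: "'a \<Rightarrow> 'b::banach"
  assumes "g summable_on A" "\<And>x. x \<in> A \<Longrightarrow> norm (f x) \<le> g x"
  shows "f summable_on A" "(\<lambda>x. norm (f x)) summable_on A"
    "norm (infsum f A) \<le> infsum g A"
proof -
  show n: "(\<lambda>x. norm (f x)) summable_on A"
    by (rule summable_on_le[OF assms(1)]) (use assms in auto)
  then show "f summable_on A" by (rule abs_summable_summable)
  have "norm (infsum f A) \<le> (\<Sum>\<^sub>\<infinity>x\<in>A. norm (f x))"
    by (rule norm_infsum_bound[OF n])
  also have "\<dots> \<le> infsum g A"
    by (rule infsum_mono[OF n assms(1)]) (use assms in auto)
  finally show "norm (infsum f A) \<le> infsum g A" .
qed

lemma le_infsum:
  fixes f :: "'a \<Rightarrow> real"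
  assumes "f summable_on UNIV" "\<And>x. 0 \<le> f x"
  shows "f x \<le> infsum f UNIV"
  using finite_sum_le_infsum[OF assms(1), of "{x}"] assms(2) by auto

lemma bij_diff_left: "bij (\<lambda>p. k - p :: 'a::ab_group_add)"
  by (rule bij_betw_byWitness[of _ "\<lambda>p. k - p"]) auto

lemma summable_on_diff_left_iff:
  fixes f :: "'a::ab_group_add \<Rightarrow> 'b::{comm_monoid_add,topological_space}"
  shows "(\<lambda>p. f (k - p)) summable_on UNIV \<longleftrightarrow> f summable_on UNIV"
  using summable_on_reindex_bij_betw[OF bij_diff_left[of k], of f] by simp

lemma infsum_diff_left:
  fixes f :: "'a::ab_group_add \<Rightarrow> 'b::{comm_monoid_add,t2_space}"
  shows "(\<Sum>\<^sub>\<infinity>p. f (k - p)) = infsum f UNIV"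
  using infsum_reindex_bij_betw[OF bij_diff_left[of k], of f] by simp

lemma summable_on_mult_prod:
  fixes f :: "'a \<Rightarrow> real" and h :: "'b \<Rightarrow> real"
  assumes "f summable_on UNIV" "h summable_on UNIV" "\<And>x. 0 \<le> f x" "\<And>x. 0 \<le> h x"
  shows "(\<lambda>(p,q). f p * h q) summable_on UNIV"
    "(\<Sum>\<^sub>\<infinity>(p,q). f p * h q) = infsum f UNIV * infsum h UNIV"
proof -
  have s: "(\<lambda>(p,q). f p * h q) summable_on UNIV \<times> UNIV"
  proof (rule summable_on_SigmaI)
    show "((\<lambda>q. case (p, q) of (p, q) \<Rightarrow> f p * h q) has_sum f p * infsum h UNIV) UNIV" for p
      using has_sum_cmult_right[OF has_sum_infsum[OF assms(2)], of "f p"] by simp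
    show "(\<lambda>p. f p * infsum h UNIV) summable_on UNIV"
      by (rule summable_on_cmult_left[OF assms(1)])
  qed (use assms in auto)
  thus "(\<lambda>(p,q). f p * h q) summable_on UNIV" by simp
  have "(\<Sum>\<^sub>\<infinity>(p,q)\<in>UNIV \<times> UNIV. f p * h q) = (\<Sum>\<^sub>\<infinity>p. \<Sum>\<^sub>\<infinity>q. f p * h q)"
    using infsum_Sigma'_banach[of "\<lambda>p q. f p * h q" UNIV "\<lambda>_. UNIV"] s by simp
  also have "\<dots> = infsum f UNIV * infsum h UNIV"
    by (simp add: infsum_cmult_right' infsum_cmult_left')
  finally show "(\<Sum>\<^sub>\<infinity>(p,q). f p * h q) = infsum f UNIV * infsum h UNIV" by simp
qed

text \<open>Changes of variables for sums over triads of modes adding up to 0; the third map keeps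
  \<open>p\<close> and exchanges the other two modes \<open>q\<close> and
  \<open>- p - q\<close>.\<close>

lemma bij_shear:
  "bij (\<lambda>(p,q). (p, p + q :: 'a::ab_group_add))"
  "bij (\<lambda>(p,q). (q, p + q :: 'a::ab_group_add))"
  "bij (\<lambda>(p,q). (p, - p - q :: 'a::ab_group_add))"
  subgoal by (rule bij_betw_byWitness[of _ "\<lambda>(p,q). (p, q - p)"]) auto
  subgoal by (rule bij_betw_byWitness[of _ "\<lambda>(p,q). (q - p, p)"]) auto
  subgoal by (rule bij_betw_byWitness[of _ "\<lambda>(p,q). (p, - p - q)"]) auto
  done

lemma summable_on_shear1:
  fixes f h :: "'a::ab_group_add \<Rightarrow> real"
  assumes "f summable_on UNIV" "h summable_on UNIV" "\<And>x. 0 \<le> f x" "\<And>x. 0 \<le> h x"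
  shows "(\<lambda>(p,q). f p * h (p + q)) summable_on UNIV"
    "(\<Sum>\<^sub>\<infinity>(p,q). f p * h (p + q)) = infsum f UNIV * infsum h UNIV"
  using summable_on_reindex_bij_betw[OF bij_shear(1), of "\<lambda>(p,q). f p * h q"]
    infsum_reindex_bij_betw[OF bij_shear(1), of "\<lambda>(p,q). f p * h q"]
    summable_on_mult_prod[OF assms]
  by (simp_all add: case_prod_beta')

lemma summable_on_shear2:
  fixes f h :: "'a::ab_group_add \<Rightarrow> real"
  assumes "f summable_on UNIV" "h summable_on UNIV" "\<And>x. 0 \<le> f x" "\<And>x. 0 \<le> h x"
  shows "(\<lambda>(p,q). f q * h (p + q)) summable_on UNIV"
    "(\<Sum>\<^sub>\<infinity>(p,q). f q * h (p + q)) = infsum f UNIV * infsum h UNIV"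
  using summable_on_reindex_bij_betw[OF bij_shear(2), of "\<lambda>(p,q). f p * h q"]
    infsum_reindex_bij_betw[OF bij_shear(2), of "\<lambda>(p,q). f p * h q"]
    summable_on_mult_prod[OF assms]
  by (simp_all add: case_prod_beta')

lemma mult_le_half_squares: "x * y \<le> (x\<^sup>2 + y\<^sup>2) / (2::real)"
  using zero_le_power2[of "x - y"] by (simp add: power2_diff)

lemma l2_mult_summable:
  fixes f h :: "'a \<Rightarrow> real"
  assumes "(\<lambda>x. (f x)\<^sup>2) summable_on A" "(\<lambda>x. (h x)\<^sup>2) summable_on A"
  shows "(\<lambda>x. \<bar>f x * h x\<bar>) summable_on A"
proof (rule summable_on_le)
  show "(\<lambda>x. ((f x)\<^sup>2 + (h x)\<^sup>2) / 2) summable_on A"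
    using summable_on_cmult_left[OF summable_on_add[OF assms], of "1/2"] by simp
  show "\<bar>f x * h x\<bar> \<le> ((f x)\<^sup>2 + (h x)\<^sup>2) / 2" for x
    using mult_le_half_squares[of "\<bar>f x\<bar>" "\<bar>h x\<bar>"] by (simp add: abs_mult)
qed simp

lemma l2_Cauchy_Schwarz:
  fixes f h :: "'a \<Rightarrow> real"
  assumes "(\<lambda>x. (f x)\<^sup>2) summable_on A" "(\<lambda>x. (h x)\<^sup>2) summable_on A"
  shows "(\<Sum>\<^sub>\<infinity>x\<in>A. \<bar>f x * h x\<bar>) \<le> sqrt (\<Sum>\<^sub>\<infinity>x\<in>A. (f x)\<^sup>2) * sqrt (\<Sum>\<^sub>\<infinity>x\<in>A. (h x)\<^sup>2)"
proof (rule infsum_le_finite_sums[OF l2_mult_summable[OF assms]])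
  fix F assume F: "finite F" "F \<subseteq> A"
  have "(\<Sum>x\<in>F. \<bar>f x * h x\<bar>) \<le> L2_set f F * L2_set h F"
    using L2_set_mult_ineq[of f h F] by (simp add: abs_mult)
  also have "\<dots> \<le> sqrt (\<Sum>\<^sub>\<infinity>x\<in>A. (f x)\<^sup>2) * sqrt (\<Sum>\<^sub>\<infinity>x\<in>A. (h x)\<^sup>2)"
    unfolding L2_set_def
    by (intro mult_mono real_sqrt_le_mono finite_sum_le_infsum assms F) (auto intro!: infsum_nonneg sum_nonneg)
  finally show "(\<Sum>x\<in>F. \<bar>f x * h x\<bar>) \<le> \<dots>" .
qed

lemma l2_add_summable:
  fixes f h :: "'a \<Rightarrow> 'b::real_normed_vector"
  assumes "(\<lambda>x. (norm (f x))\<^sup>2) summable_on A" "(\<lambda>x. (norm (h x))\<^sup>2) summable_on A"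
  shows "(\<lambda>x. (norm (f x + h x))\<^sup>2) summable_on A"
    "(\<Sum>\<^sub>\<infinity>x\<in>A. (norm (f x + h x))\<^sup>2) \<le> 2 * (\<Sum>\<^sub>\<infinity>x\<in>A. (norm (f x))\<^sup>2) + 2 * (\<Sum>\<^sub>\<infinity>x\<in>A. (norm (h x))\<^sup>2)"
proof -
  have le: "(norm (f x + h x))\<^sup>2 \<le> 2 * (norm (f x))\<^sup>2 + 2 * (norm (h x))\<^sup>2" for x
  proof -
    have "(norm (f x + h x))\<^sup>2 \<le> (norm (f x) + norm (h x))\<^sup>2"
      by (intro power_mono norm_triangle_ineq) auto
    also have "\<dots> \<le> 2 * (norm (f x))\<^sup>2 + 2 * (norm (h x))\<^sup>2"
      using mult_le_half_squares[of "norm (f x)" "norm (h x)"] by (simp add: power2_sum)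
    finally show ?thesis .
  qed
  have s: "(\<lambda>x. 2 * (norm (f x))\<^sup>2) summable_on A" "(\<lambda>x. 2 * (norm (h x))\<^sup>2) summable_on A"
    using assms by (auto intro: summable_on_cmult_right)
  show *: "(\<lambda>x. (norm (f x + h x))\<^sup>2) summable_on A"
    by (rule summable_on_le[OF summable_on_add[OF s] _ le]) auto
  have "(\<Sum>\<^sub>\<infinity>x\<in>A. (norm (f x + h x))\<^sup>2) \<le> (\<Sum>\<^sub>\<infinity>x\<in>A. 2 * (norm (f x))\<^sup>2 + 2 * (norm (h x))\<^sup>2)"
    by (rule infsum_mono[OF * summable_on_add[OF s] le])
  also have "\<dots> = 2 * (\<Sum>\<^sub>\<infinity>x\<in>A. (norm (f x))\<^sup>2) + 2 * (\<Sum>\<^sub>\<infinity>x\<in>A. (norm (h x))\<^sup>2)"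
    by (simp add: infsum_add[OF s] infsum_cmult_right')
  finally show "(\<Sum>\<^sub>\<infinity>x\<in>A. (norm (f x + h x))\<^sup>2) \<le> \<dots>" .
qed

section \<open>Lattice sums by comparison with one-dimensional series\<close>

lemma summable_on_int_even:
  fixes f :: "nat \<Rightarrow> real"
  assumes "summable f" "\<And>n. f n \<ge> 0"
  shows "(\<lambda>n::int. f (nat \<bar>n\<bar>)) summable_on UNIV"
    "(\<Sum>\<^sub>\<infinity>n::int. f (nat \<bar>n\<bar>)) \<le> 2 * suminf f"
proof -
  have b: "(\<Sum>n\<in>F. f (nat \<bar>n\<bar>)) \<le> 2 * suminf f" if "finite F" for F :: "int set"
  proof -
    have "(\<Sum>n\<in>F. f (nat \<bar>n\<bar>)) = (\<Sum>n\<in>{n\<in>F. n \<ge> 0}. f (nat \<bar>n\<bar>)) + (\<Sum>n\<in>{n\<in>F. n < 0}. f (nat \<bar>n\<bar>))"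
      using that by (subst sum.union_disjoint[symmetric]) (auto intro!: sum.cong)
    also have "(\<Sum>n\<in>{n\<in>F. n \<ge> 0}. f (nat \<bar>n\<bar>)) = sum f (nat ` {n\<in>F. n \<ge> 0})"
      by (subst sum.reindex) (auto simp: inj_on_def)
    also have "\<dots> \<le> suminf f"
      using that assms by (intro sum_le_suminf) auto
    also have "(\<Sum>n\<in>{n\<in>F. n < 0}. f (nat \<bar>n\<bar>)) = sum f ((\<lambda>n. nat (-n)) ` {n\<in>F. n < 0})"
      by (subst sum.reindex) (auto simp: inj_on_def)
    also have "\<dots> \<le> suminf f"
      using that assms by (intro sum_le_suminf) auto
    finally show ?thesis by simp
  qed
  show s: "(\<lambda>n::int. f (nat \<bar>n\<bar>)) summable_on UNIV"
    by (rule nonneg_bounded_partial_sums_imp_summable_on[where C = "2 * suminf f"])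
       (use assms b in \<open>auto intro!: eventually_finite_subsets_at_top_weakI\<close>)
  show "(\<Sum>\<^sub>\<infinity>n::int. f (nat \<bar>n\<bar>)) \<le> 2 * suminf f"
    by (rule infsum_le_finite_sums[OF s]) (use b in auto)
qed

lemma summable_on_prod_bound:
  fixes f :: "int \<times> int \<Rightarrow> real" and \<phi> :: "int \<Rightarrow> real"
  assumes "\<phi> summable_on UNIV" "\<And>n. 0 \<le> \<phi> n"
    and "\<And>k. 0 \<le> f k" "\<And>k. f k \<le> \<phi> (fst k) * \<phi> (snd k)"
  shows "f summable_on UNIV" "infsum f UNIV \<le> (infsum \<phi> UNIV)\<^sup>2"
proof -
  note P = summable_on_mult_prod[OF assms(1,1,2,2)]
  show f: "f summable_on UNIV"
    by (rule summable_on_le[OF P(1)]) (use assms in \<open>auto simp: case_prod_beta\<close>)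
  have "infsum f UNIV \<le> (\<Sum>\<^sub>\<infinity>(p,q). \<phi> p * \<phi> q)"
    by (rule infsum_mono[OF f P(1)]) (use assms in \<open>auto simp: case_prod_beta\<close>)
  then show "infsum f UNIV \<le> (infsum \<phi> UNIV)\<^sup>2"
    by (simp add: P(2) power2_eq_square)
qed

text \<open>The exponent 5/2 exceeds the dimension 2. As \<open>knorm k\<close> dominates both
  coordinates, the power splits into two one-dimensional factors of exponent 5/4 > 1. Averaging a
  coordinate with 1 keeps these factors finite on the axes, and is allowed since
  \<open>knorm k \<ge> 1\<close>.\<close>

lemma summable_knorm_powr: "(\<lambda>k. knorm k powr (-5/2)) summable_on UNIV"
proof (rule summable_on_prod_bound(1))
  let ?f = "\<lambda>n. ((1 + real n) / 2) powr (-5/4)"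
  have "summable (\<lambda>n. real (Suc n) powr (-5/4))"
    by (subst summable_Suc_iff) (simp add: summable_real_powr_iff)
  hence "summable (\<lambda>n. (1/2) powr (-5/4) * real (Suc n) powr (-5/4))"
    by (rule summable_mult)
  moreover have eq: "(1/2) powr (-5/4) * real (Suc n) powr (-5/4) = ?f n" for n
    by (subst powr_mult[symmetric]) auto
  ultimately have "summable ?f" unfolding eq by blast
  thus "(\<lambda>n. ?f (nat \<bar>n\<bar>)) summable_on UNIV"
    by (rule summable_on_int_even) simp
  fix k :: idx
  show "knorm k powr (-5/2) \<le> ?f (nat \<bar>fst k\<bar>) * ?f (nat \<bar>snd k\<bar>)"
  proof (cases "k = 0")
    case False
    have 1: "\<bar>real_of_int (fst k)\<bar> \<le> knorm k" "\<bar>real_of_int (snd k)\<bar> \<le> knorm k"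
      unfolding knorm_def by (auto intro!: real_le_rsqrt)
    have "knorm k powr (-5/2) = knorm k powr (-5/4) * knorm k powr (-5/4)"
      by (simp flip: powr_add)
    also have "\<dots> \<le> ?f (nat \<bar>fst k\<bar>) * ?f (nat \<bar>snd k\<bar>)"
      using 1 knorm_ge_1[OF False] by (intro mult_mono powr_mono2') auto
    finally show ?thesis .
  qed simp
qed auto

lemma knorm_inverse_powr_le:
  assumes "s \<ge> (5/2::real)"
  shows "knorm k powr (-s) \<le> knorm k powr (-5/2)"
proof (cases "k = 0")
  case False
  then show ?thesis using assms knorm_ge_1[OF False] by (intro powr_mono) auto
qed simp

lemma summable_knorm_powr':
  assumes "s \<ge> (5/2::real)"
  shows "(\<lambda>k. knorm k powr (-s)) summable_on UNIV"
  by (rule summable_on_le[OF summable_knorm_powr]) (use knorm_inverse_powr_le[OF assms] in auto)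

lemma summable_knorm_powr_sq: "(\<lambda>k. (knorm k powr -2)\<^sup>2) summable_on UNIV"
proof -
  have "(knorm p powr -2)\<^sup>2 = knorm p powr (-4)" for p
    by (simp add: power2_eq_square flip: powr_add)
  then show ?thesis using summable_knorm_powr'[of 4] by simp
qed

text \<open>The sum is a Riemann sum for a scale-invariant integral over the plane, hence bounded in
  \<open>R\<close>. With \<open>x\<close>, \<open>y\<close> the squared coordinates,
  \<open>(R^2 + x) (R^2 + y) \<le> (R^2 + x + y)^2\<close> reduces it to the square of a
  one-dimensional sum.\<close>

lemma lattice_kernel_sum:
  fixes R :: real
  assumes "R \<ge> 1"
  shows "(\<lambda>p. R\<^sup>2 / (R\<^sup>2 + (knorm p)\<^sup>2)\<^sup>2) summable_on UNIV"
    "(\<Sum>\<^sub>\<infinity>p. R\<^sup>2 / (R\<^sup>2 + (knorm p)\<^sup>2)\<^sup>2) \<le> 64"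
proof -
  define f where "f n = 2 * R / (R + real n)\<^sup>2" for n
  \<comment> \<open>Telescoping majorant: after multiplication by \<open>2 * R\<close> it sums to at
    most \<open>2 * R / (R - 1/2) \<le> 4\<close>, by \<open>R \<ge> 1\<close>. The two signs of an
    integer give 8, and the square gives 64.\<close>
  have step: "1 / (R + real n)\<^sup>2 \<le> 1 / (R + real n - 1/2) - 1 / (R + real n + 1/2)" for n
  proof -
    define x where "x = R + real n"
    have x: "x \<ge> 1" using assms by (simp add: x_def)
    hence "x\<^sup>2 \<ge> 1" by simp
    hence "0 < x\<^sup>2" "0 < x\<^sup>2 - 1/4" by linarith+
    hence "1 / x\<^sup>2 \<le> 1 / (x\<^sup>2 - 1/4)" by (intro divide_left_mono mult_pos_pos) auto
    also have "\<dots> = 1 / (x - 1/2) - 1 / (x + 1/2)"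
      using x by (simp add: field_simps power2_eq_square)
    finally show ?thesis by (simp add: x_def)
  qed
  have tel: "(\<Sum>n<N. 1 / (R + real n)\<^sup>2) \<le> 1 / (R - 1/2) - 1 / (R + real N - 1/2)" for N
  proof (induction N)
    case (Suc N)
    have *: "R + real (Suc N) - 1/2 = R + real N + 1/2" by simp
    show ?case unfolding * sum.lessThan_Suc using Suc step[of N] by linarith
  qed simp
  have part: "(\<Sum>n<N. f n) \<le> 4" for N
  proof -
    have "(\<Sum>n<N. f n) = 2 * R * (\<Sum>n<N. 1 / (R + real n)\<^sup>2)"
      by (simp add: f_def sum_distrib_left)
    also have "\<dots> \<le> 2 * R * (1 / (R - 1/2))"
    proof (rule mult_left_mono)
      have "1 / (R + real N - 1/2) \<ge> 0" using assms by simp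
      thus "(\<Sum>n<N. 1 / (R + real n)\<^sup>2) \<le> 1 / (R - 1/2)" using tel[of N] by linarith
    qed (use assms in auto)
    also have "\<dots> \<le> 4" using assms by (simp add: field_simps)
    finally show ?thesis .
  qed
  have f0: "f n \<ge> 0" for n using assms by (simp add: f_def)
  have sf: "summable f" by (rule summableI_nonneg_bounded[OF f0 part])
  have lf: "suminf f \<le> 4" by (rule suminf_le_const[OF sf part])
  note I = summable_on_int_even[OF sf f0]
  have le1: "R / (R\<^sup>2 + (real_of_int n)\<^sup>2) \<le> f (nat \<bar>n\<bar>)" for n :: int
  proof -
    have "(R + \<bar>real_of_int n\<bar>)\<^sup>2 \<le> 2 * (R\<^sup>2 + (real_of_int n)\<^sup>2)"
      using mult_le_half_squares[of R "\<bar>real_of_int n\<bar>"] by (simp add: power2_sum)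
    moreover have "(R + \<bar>real_of_int n\<bar>)\<^sup>2 > 0" using assms by (simp add: add_pos_nonneg)
    ultimately have "2 * R / (2 * (R\<^sup>2 + (real_of_int n)\<^sup>2)) \<le> 2 * R / (R + \<bar>real_of_int n\<bar>)\<^sup>2"
      using assms by (intro divide_left_mono) (auto intro!: mult_pos_pos simp: add_pos_nonneg)
    moreover have "2 * R / (2 * (R\<^sup>2 + (real_of_int n)\<^sup>2)) = R / (R\<^sup>2 + (real_of_int n)\<^sup>2)"
      by (rule mult_divide_mult_cancel_left) simp
    ultimately show ?thesis by (simp add: f_def)
  qed
  have le: "R\<^sup>2 / (R\<^sup>2 + (knorm p)\<^sup>2)\<^sup>2 \<le> f (nat \<bar>fst p\<bar>) * f (nat \<bar>snd p\<bar>)" for p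
  proof -
    define x y where "x = (real_of_int (fst p))\<^sup>2" and "y = (real_of_int (snd p))\<^sup>2"
    have xy: "x \<ge> 0" "y \<ge> 0" "R\<^sup>2 > 0" using assms by (auto simp: x_def y_def)
    have "(R\<^sup>2 + x) * (R\<^sup>2 + y) \<le> (R\<^sup>2 + (x + y)) * (R\<^sup>2 + (x + y))"
      using xy by (intro mult_mono) auto
    hence "R\<^sup>2 / (R\<^sup>2 + (x + y))\<^sup>2 \<le> R\<^sup>2 / ((R\<^sup>2 + x) * (R\<^sup>2 + y))"
      using xy by (intro divide_left_mono) (auto simp: power2_eq_square add_pos_nonneg)
    also have "\<dots> = (R / (R\<^sup>2 + x)) * (R / (R\<^sup>2 + y))"
      by (simp add: power2_eq_square)
    also have "\<dots> \<le> f (nat \<bar>fst p\<bar>) * f (nat \<bar>snd p\<bar>)"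
      unfolding x_def y_def using assms f0 by (intro mult_mono le1) auto
    finally show ?thesis by (simp add: knorm_sq x_def y_def)
  qed
  note P = summable_on_prod_bound[OF I(1) f0 _ le]
  show "(\<lambda>p. R\<^sup>2 / (R\<^sup>2 + (knorm p)\<^sup>2)\<^sup>2) summable_on UNIV" by (rule P(1)) auto
  have "(\<Sum>\<^sub>\<infinity>p. R\<^sup>2 / (R\<^sup>2 + (knorm p)\<^sup>2)\<^sup>2) \<le> (\<Sum>\<^sub>\<infinity>n::int. f (nat \<bar>n\<bar>))\<^sup>2"
    by (rule P(2)) auto
  also have "\<dots> \<le> 8\<^sup>2"
    using I(2) lf by (intro power_mono infsum_nonneg f0) auto
  finally show "(\<Sum>\<^sub>\<infinity>p. R\<^sup>2 / (R\<^sup>2 + (knorm p)\<^sup>2)\<^sup>2) \<le> 64" by simp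
qed

section \<open>Square-summable coefficients\<close>

definition l2 :: "(idx \<Rightarrow> complex) \<Rightarrow> bool" where
  "l2 a \<longleftrightarrow> (\<lambda>k. (norm (a k))\<^sup>2) summable_on UNIV"

definition l2sq :: "(idx \<Rightarrow> complex) \<Rightarrow> real" where
  "l2sq a = (\<Sum>\<^sub>\<infinity>k. (norm (a k))\<^sup>2)"

lemma l2sq_nonneg [simp]: "l2sq a \<ge> 0"
  by (simp add: l2sq_def infsum_nonneg)

lemma l2_add: "l2 a \<Longrightarrow> l2 b \<Longrightarrow> l2 (\<lambda>k. a k + b k)"
  and l2sq_add_le: "l2 a \<Longrightarrow> l2 b \<Longrightarrow> l2sq (\<lambda>k. a k + b k) \<le> 2 * l2sq a + 2 * l2sq b"
  unfolding l2_def l2sq_def by (rule l2_add_summable; assumption)+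

lemma l2_scale: "l2 a \<Longrightarrow> l2 (\<lambda>k. c * a k)"
  unfolding l2_def using summable_on_cmult_right[of "\<lambda>k. (norm (a k))\<^sup>2" UNIV "(norm c)\<^sup>2"]
  by (simp add: norm_mult power_mult_distrib)

lemma l2_minus: "l2 a \<Longrightarrow> l2 (\<lambda>k. - a k)"
  by (simp add: l2_def)

lemma l2_diff: "l2 a \<Longrightarrow> l2 b \<Longrightarrow> l2 (\<lambda>k. a k - b k)"
  using l2_add[OF _ l2_minus] by fastforce

lemma norm_le_l2sq: "l2 a \<Longrightarrow> (norm (a k))\<^sup>2 \<le> l2sq a"
  unfolding l2_def l2sq_def using le_infsum[of "\<lambda>k. (norm (a k))\<^sup>2" k] by simp

lemma weighted_inner_summable:
  assumes "l2 a" "l2 b" "\<And>k. 0 \<le> m k" "\<And>k. m k \<le> C"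
  shows "(\<lambda>k. m k * Re (cnj (a k) * b k)) summable_on UNIV"
    "\<bar>\<Sum>\<^sub>\<infinity>k. m k * Re (cnj (a k) * b k)\<bar> \<le> C * (sqrt (l2sq a) * sqrt (l2sq b))"
proof -
  have s: "(\<lambda>k. (norm (a k))\<^sup>2) summable_on UNIV" "(\<lambda>k. (norm (b k))\<^sup>2) summable_on UNIV"
    using assms by (auto simp: l2_def)
  have le: "norm (m k * Re (cnj (a k) * b k)) \<le> C * \<bar>norm (a k) * norm (b k)\<bar>" for k
  proof -
    have "\<bar>Re (cnj (a k) * b k)\<bar> \<le> norm (a k) * norm (b k)"
      using abs_Re_le_cmod[of "cnj (a k) * b k"] by (simp add: norm_mult)
    then show ?thesis
      using assms(3,4)[of k] unfolding real_norm_def abs_mult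
      by (intro mult_mono) (auto intro: order_trans)
  qed
  have s2: "(\<lambda>k. C * \<bar>norm (a k) * norm (b k)\<bar>) summable_on UNIV"
    by (intro summable_on_cmult_right l2_mult_summable s)
  note N = norm_summable_on_le[OF s2 le]
  show "(\<lambda>k. m k * Re (cnj (a k) * b k)) summable_on UNIV" by (rule N(1))
  have "C \<ge> 0" using assms(3,4) order_trans by blast
  have "\<bar>\<Sum>\<^sub>\<infinity>k. m k * Re (cnj (a k) * b k)\<bar> \<le> (\<Sum>\<^sub>\<infinity>k. C * \<bar>norm (a k) * norm (b k)\<bar>)"
    using N(3) by simp
  also have "\<dots> = C * (\<Sum>\<^sub>\<infinity>k. \<bar>norm (a k) * norm (b k)\<bar>)" by (rule infsum_cmult_right')
  also have "\<dots> \<le> C * (sqrt (l2sq a) * sqrt (l2sq b))"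
    unfolding l2sq_def using l2_Cauchy_Schwarz[OF s] \<open>C \<ge> 0\<close> by (intro mult_left_mono)
  finally show "\<bar>\<Sum>\<^sub>\<infinity>k. m k * Re (cnj (a k) * b k)\<bar> \<le> C * (sqrt (l2sq a) * sqrt (l2sq b))" .
qed

lemma weighted_square_summable:
  assumes "l2 a" "\<And>k. 0 \<le> m k" "\<And>k. m k \<le> C"
  shows "(\<lambda>k. m k * (norm (a k))\<^sup>2) summable_on UNIV"
    "(\<Sum>\<^sub>\<infinity>k. m k * (norm (a k))\<^sup>2) \<le> C * l2sq a"
    "0 \<le> (\<Sum>\<^sub>\<infinity>k. m k * (norm (a k))\<^sup>2)"
proof -
  have *: "m k * Re (cnj (a k) * a k) = m k * (norm (a k))\<^sup>2" for k
    unfolding cmod_power2 by (simp add: power2_eq_square)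
  show "(\<lambda>k. m k * (norm (a k))\<^sup>2) summable_on UNIV"
    using weighted_inner_summable(1)[where m = m, OF assms(1,1,2,3)] unfolding * .
  show "(\<Sum>\<^sub>\<infinity>k. m k * (norm (a k))\<^sup>2) \<le> C * l2sq a"
    using weighted_inner_summable(2)[where m = m, OF assms(1,1,2,3)] unfolding * by simp
  show "0 \<le> (\<Sum>\<^sub>\<infinity>k. m k * (norm (a k))\<^sup>2)"
    using assms by (intro infsum_nonneg) auto
qed

section \<open>Time derivatives of square-summable coefficients\<close>

lemma norm_add_scaled_square:
  fixes x y :: complex and h :: real
  shows "(norm (x + of_real h * y))\<^sup>2 = (norm x)\<^sup>2 + 2 * h * Re (cnj x * y) + h\<^sup>2 * (norm y)\<^sup>2"
  unfolding cmod_power2 by (simp add: power2_eq_square algebra_simps)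

text \<open>Convergence of the difference quotients in l2 suffices because the weight
  \<open>m\<close> is bounded; the weight \<open>(knorm k)^2\<close> would call for convergence in
  the enstrophy norm.\<close>

lemma weighted_square_has_derivative:
  fixes a :: "real \<Rightarrow> idx \<Rightarrow> complex"
  assumes a: "\<And>t. l2 (a t)" and b: "l2 b"
    and m: "\<And>k. 0 \<le> m k" "\<And>k. m k \<le> C"
    and lim: "((\<lambda>h. l2sq (\<lambda>k. (a (t + h) k - a t k) / of_real h - b k)) \<longlongrightarrow> 0) (at 0)"
  shows "((\<lambda>t. \<Sum>\<^sub>\<infinity>k. m k * (norm (a t k))\<^sup>2) has_real_derivative
      2 * (\<Sum>\<^sub>\<infinity>k. m k * Re (cnj (a t k) * b k))) (at t)"
proof -
  define d where "d = (\<lambda>h k. (a (t + h) k - a t k) / of_real h - b k)"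
  define F where "F t = (\<Sum>\<^sub>\<infinity>k. m k * (norm (a t k))\<^sup>2)" for t
  define X where "X = (\<Sum>\<^sub>\<infinity>k. m k * Re (cnj (a t k) * b k))"
  have C: "C \<ge> 0" using m order_trans by blast
  have d: "l2 (d h)" for h
    unfolding d_def divide_inverse mult.commute[of _ "inverse _"] by (intro l2_diff l2_scale a b)
  let ?B = "\<lambda>h. 2 * C * (sqrt (l2sq (a t)) * sqrt (l2sq (d h))) + \<bar>h\<bar> * (C * (2 * l2sq b + 2 * l2sq (d h)))"
  have bound: "norm ((F (t + h) - F t) / h - 2 * X) \<le> ?B h"
    if h: "h \<noteq> 0" for h
  proof -
    define Y where "Y = (\<Sum>\<^sub>\<infinity>k. m k * Re (cnj (a t k) * d h k))"
    define Z where "Z = (\<Sum>\<^sub>\<infinity>k. m k * (norm (b k + d h k))\<^sup>2)"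
    note bd = l2_add[OF b d[of h]]
    \<comment> \<open>Writing the increment as \<open>h (b + d h)\<close>, with \<open>d h\<close>
      the error of the difference quotient, turns the quotient of \<open>F\<close> into
      \<open>2 X + 2 Y + h Z\<close>. Cauchy-Schwarz makes \<open>Y\<close> small with
      \<open>d h\<close>, and \<open>Z\<close> stays bounded.\<close>
    have pt: "m k * (norm (a (t + h) k))\<^sup>2 = m k * (norm (a t k))\<^sup>2 + ((2 * h) * (m k * Re (cnj (a t k) * b k))
        + ((2 * h) * (m k * Re (cnj (a t k) * d h k)) + h\<^sup>2 * (m k * (norm (b k + d h k))\<^sup>2)))" for k
    proof -
      have "a (t + h) k = a t k + of_real h * (b k + d h k)"
        using h by (simp add: d_def field_simps)
      then have "(norm (a (t + h) k))\<^sup>2 = (norm (a t k))\<^sup>2 + 2 * h * Re (cnj (a t k) * (b k + d h k)) + h\<^sup>2 * (norm (b k + d h k))\<^sup>2"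
        by (simp only: norm_add_scaled_square)
      then show ?thesis by (simp add: algebra_simps)
    qed
    note S1 = weighted_square_summable(1)[where m = m, OF a[of t] m]
    note S2 = summable_on_cmult_right[OF weighted_inner_summable(1)[where m = m, OF a[of t] b m], of "2 * h"]
    note S3 = summable_on_cmult_right[OF weighted_inner_summable(1)[where m = m, OF a[of t] d[of h] m], of "2 * h"]
    note S4 = summable_on_cmult_right[OF weighted_square_summable(1)[where m = m, OF bd m], of "h\<^sup>2"]
    have "F (t + h) = F t + (2 * h * X + (2 * h * Y + h\<^sup>2 * Z))"
      unfolding F_def pt X_def Y_def Z_def
      by (subst infsum_add infsum_cmult_right'; (intro S1 S2 S3 S4 summable_on_add)?)+ simp
    hence "(F (t + h) - F t) / h - 2 * X = 2 * Y + h * Z"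
      using h by (simp add: field_simps power2_eq_square)
    hence "norm ((F (t + h) - F t) / h - 2 * X) \<le> 2 * \<bar>Y\<bar> + \<bar>h\<bar> * \<bar>Z\<bar>"
      using abs_triangle_ineq[of "2 * Y" "h * Z"] by (simp add: abs_mult)
    also have "\<dots> \<le> 2 * (C * (sqrt (l2sq (a t)) * sqrt (l2sq (d h)))) + \<bar>h\<bar> * (C * (2 * l2sq b + 2 * l2sq (d h)))"
    proof (intro add_mono mult_left_mono)
      show "\<bar>Y\<bar> \<le> C * (sqrt (l2sq (a t)) * sqrt (l2sq (d h)))"
        unfolding Y_def by (rule weighted_inner_summable(2)[where m = m, OF a d m])
      have "\<bar>Z\<bar> = Z" unfolding Z_def using weighted_square_summable(3)[where m = m, OF bd m] by simp
      also have "Z \<le> C * l2sq (\<lambda>k. b k + d h k)"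
        unfolding Z_def by (rule weighted_square_summable(2)[where m = m, OF bd m])
      also have "\<dots> \<le> C * (2 * l2sq b + 2 * l2sq (d h))"
        using C l2sq_add_le[OF b d[of h]] by (intro mult_left_mono)
      finally show "\<bar>Z\<bar> \<le> C * (2 * l2sq b + 2 * l2sq (d h))" .
    qed auto
    finally show ?thesis by simp
  qed
  have d0: "((\<lambda>h. l2sq (d h)) \<longlongrightarrow> 0) (at 0)" using lim by (simp add: d_def)
  have "((\<lambda>h. (F (t + h) - F t) / h - 2 * X) \<longlongrightarrow> 0) (at 0)"
  proof (rule Lim_null_comparison)
    show "\<forall>\<^sub>F h in at 0. norm ((F (t + h) - F t) / h - 2 * X) \<le> ?B h"
      using bound by (auto simp: eventually_at_filter)
    have "(?B \<longlongrightarrow> 2 * C * (sqrt (l2sq (a t)) * sqrt 0) + \<bar>0\<bar> * (C * (2 * l2sq b + 2 * 0))) (at 0)"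
      by (intro tendsto_intros d0)
    thus "(?B \<longlongrightarrow> 0) (at 0)" by simp
  qed
  hence "((\<lambda>h. (F (t + h) - F t) / h) \<longlongrightarrow> 2 * X) (at 0)"
    by (simp add: LIM_zero_iff)
  thus ?thesis by (simp add: DERIV_def F_def X_def)
qed

lemma coefficient_has_vector_derivative:
  fixes a :: "real \<Rightarrow> idx \<Rightarrow> complex"
  assumes a: "\<And>t. l2 (a t)" and b: "l2 b"
    and lim: "((\<lambda>h. l2sq (\<lambda>k. (a (t + h) k - a t k) / of_real h - b k)) \<longlongrightarrow> 0) (at 0)"
  shows "((\<lambda>t. a t k) has_vector_derivative b k) (at t)"
proof -
  define d where "d = (\<lambda>h k. (a (t + h) k - a t k) / of_real h - b k)"
  have d: "l2 (d h)" for h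
    unfolding d_def divide_inverse mult.commute[of _ "inverse _"] by (intro l2_diff l2_scale a b)
  have 1: "((\<lambda>h. (a (t + h) k - a t k) / of_real h - b k) \<longlongrightarrow> 0) (at 0)"
  proof (rule Lim_null_comparison)
    show "\<forall>\<^sub>F h in at 0. norm ((a (t + h) k - a t k) / of_real h - b k) \<le> sqrt (l2sq (d h))"
      using norm_le_l2sq[OF d, where k = k] by (intro always_eventually allI real_le_rsqrt) (simp add: d_def)
    show "((\<lambda>h. sqrt (l2sq (d h))) \<longlongrightarrow> 0) (at 0)"
      using tendsto_real_sqrt[OF lim] by (simp add: d_def)
  qed
  have 2: "(a (t + h) k - a t k) / of_real h - b k = (a (t + h) k - a t k - h *\<^sub>R b k) /\<^sub>R h" if "h \<noteq> 0" for h
    using that by (simp add: scaleR_conv_of_real field_simps)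
  have "((\<lambda>h. (a (t + h) k - a t k - h *\<^sub>R b k) /\<^sub>R h) \<longlongrightarrow> 0) (at 0)"
    by (rule Lim_transform_eventually[OF 1]) (use 2 in \<open>auto simp: eventually_at_filter\<close>)
  hence "((\<lambda>h. norm (a (t + h) k - a t k - h *\<^sub>R b k) / norm h) \<longlongrightarrow> 0) (at 0)"
    using tendsto_norm_zero[of "\<lambda>h. (a (t + h) k - a t k - h *\<^sub>R b k) /\<^sub>R h"]
    by (simp add: divide_inverse mult.commute)
  thus ?thesis
    unfolding has_vector_derivative_def has_derivative_at
    by (simp add: bounded_linear_scaleR_left)
qed

section \<open>The trilinear form\<close>

definition bil :: "real \<Rightarrow> (idx \<Rightarrow> complex) \<Rightarrow> (idx \<Rightarrow> complex) \<Rightarrow> idx \<Rightarrow> complex" where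
  "bil \<kappa> a c k = (\<Sum>\<^sub>\<infinity>p. bker \<kappa> p k * a p * c (k - p))"

text \<open>A Fourier-side substitute for Ladyzhenskaya's inequality; the weight
  \<open>(R\<^sup>2 + |p|\<^sup>2) / R\<close> makes the lattice sum bounded uniformly in \<open>R\<close>.\<close>

lemma trilinear_sum_le:
  fixes \<alpha> \<beta> :: "idx \<Rightarrow> real" and R e :: real
  assumes nn: "\<And>k. 0 \<le> \<alpha> k" "\<And>k. 0 \<le> \<beta> k"
    and s: "(\<lambda>k. (\<alpha> k)\<^sup>2) summable_on UNIV" "(\<lambda>k. (knorm k * \<alpha> k)\<^sup>2) summable_on UNIV"
      "(\<lambda>k. (\<beta> k)\<^sup>2) summable_on UNIV"
    and R: "R \<ge> 1" and e: "e > 0"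
  shows "(\<lambda>(p,q). \<alpha> p * \<alpha> (p + q) * \<beta> q) summable_on UNIV"
    "(\<Sum>\<^sub>\<infinity>(p,q). \<alpha> p * \<alpha> (p + q) * \<beta> q) \<le>
      32 * e * (\<Sum>\<^sub>\<infinity>k. (\<beta> k)\<^sup>2) + (R * (\<Sum>\<^sub>\<infinity>k. (\<alpha> k)\<^sup>2) + (\<Sum>\<^sub>\<infinity>k. (knorm k * \<alpha> k)\<^sup>2) / R)\<^sup>2 / (2 * e)"
proof -
  define \<rho> where "\<rho> p = (R\<^sup>2 + (knorm p)\<^sup>2) / R" for p
  define \<sigma> where "\<sigma> p = R\<^sup>2 / (R\<^sup>2 + (knorm p)\<^sup>2)\<^sup>2" for p
  define A where "A p = R * (\<alpha> p)\<^sup>2 + (1 / R) * (knorm p * \<alpha> p)\<^sup>2" for p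
  define b where "b p = (\<beta> p)\<^sup>2" for p
  have \<rho>: "\<rho> p > 0" for p using R by (auto simp: \<rho>_def intro!: divide_pos_pos add_pos_nonneg)
  have \<sigma>: "\<sigma> p = 1 / (\<rho> p)\<^sup>2" for p using R by (simp add: \<rho>_def \<sigma>_def power_divide)
  have A: "A p = \<rho> p * (\<alpha> p)\<^sup>2" for p using R by (simp add: A_def \<rho>_def field_simps power2_eq_square)
  note S1 = summable_on_cmult_right[OF s(1), of R] and S2 = summable_on_cmult_right[OF s(2), of "1 / R"]
  have sA: "A summable_on UNIV" unfolding A_def by (intro summable_on_add S1 S2)
  have iA: "infsum A UNIV = R * (\<Sum>\<^sub>\<infinity>k. (\<alpha> k)\<^sup>2) + (\<Sum>\<^sub>\<infinity>k. (knorm k * \<alpha> k)\<^sup>2) / R"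
    unfolding A_def by (simp add: infsum_add[OF S1 S2] infsum_cmult_right' del: times_divide_eq_left) simp
  have sb: "b summable_on UNIV" using s(3) by (simp add: b_def[abs_def])
  have s\<sigma>: "\<sigma> summable_on UNIV" "infsum \<sigma> UNIV \<le> 64"
    using lattice_kernel_sum[OF R] by (auto simp: \<sigma>_def[abs_def])
  have nn': "A p \<ge> 0" "b p \<ge> 0" "\<sigma> p \<ge> 0" for p
    using R by (auto simp: A_def b_def \<sigma>_def)
  \<comment> \<open>Two uses of Young's inequality: one separates \<open>\<beta>\<close> from the
    two factors \<open>\<alpha>\<close> with weight \<open>\<rho> p * \<rho> (p + q) / e\<close>,
    the other separates \<open>\<rho> p\<close> from \<open>\<rho> (p + q)\<close>. Each of the
    three double sums then factorises after a shear, and the kernel that appears is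
    \<open>1 / \<rho>^2 = \<sigma>\<close>.\<close>
  have pt: "\<alpha> p * \<alpha> (p + q) * \<beta> q \<le> (e/4) * (\<sigma> p * b q) + ((e/4) * (b q * \<sigma> (p + q)) + (1 / (2 * e)) * (A p * A (p + q)))" for p q
  proof -
    define r t where "r = \<rho> p" and "t = \<rho> (p + q)"
    have rt: "r > 0" "t > 0" using \<rho> by (auto simp: r_def t_def)
    define x y z where "x = \<alpha> p" and "y = \<alpha> (p + q)" and "z = \<beta> q"
    have "x * y * z = (sqrt (e / (r * t)) * z) * (sqrt (r * t / e) * (x * y))"
    proof -
      have "sqrt (e / (r * t)) * sqrt (r * t / e) = 1"
        using rt e by (simp flip: real_sqrt_mult)
      thus ?thesis by (simp add: mult.assoc mult.left_commute mult.commute) 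
    qed
    also have "\<dots> \<le> ((sqrt (e / (r * t)) * z)\<^sup>2 + (sqrt (r * t / e) * (x * y))\<^sup>2) / 2"
      by (rule mult_le_half_squares)
    also have "\<dots> = e / 2 * ((z / r) * (z / t)) + (r * x\<^sup>2) * (t * y\<^sup>2) / (2 * e)"
      using rt e by (simp add: power_mult_distrib field_simps power2_eq_square)
    also have "\<dots> \<le> e / 2 * (((z / r)\<^sup>2 + (z / t)\<^sup>2) / 2) + (r * x\<^sup>2) * (t * y\<^sup>2) / (2 * e)"
      using e by (intro add_right_mono mult_left_mono mult_le_half_squares) auto
    also have "\<dots> = (e/4) * (\<sigma> p * b q) + ((e/4) * (b q * \<sigma> (p + q)) + (1 / (2 * e)) * (A p * A (p + q)))"
      by (simp add: \<sigma> A b_def x_def y_def z_def r_def t_def power_divide algebra_simps)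
    finally show ?thesis by (simp add: x_def y_def z_def)
  qed
  note P1 = summable_on_mult_prod[OF s\<sigma>(1) sb nn'(3) nn'(2)]
  note P2 = summable_on_shear2[OF sb s\<sigma>(1) nn'(2) nn'(3)]
  note P3 = summable_on_shear1[OF sA sA nn'(1) nn'(1)]
  let ?g = "\<lambda>x. (e/4) * (case x of (p,q) \<Rightarrow> \<sigma> p * b q) + ((e/4) * (case x of (p,q) \<Rightarrow> b q * \<sigma> (p + q))
      + (1 / (2 * e)) * (case x of (p,q) \<Rightarrow> A p * A (p + q)))"
  note Q1 = summable_on_cmult_right[OF P1(1), of "e/4"]
  note Q2 = summable_on_cmult_right[OF P2(1), of "e/4"]
  note Q3 = summable_on_cmult_right[OF P3(1), of "1 / (2 * e)"]
  have sg: "?g summable_on UNIV" by (intro summable_on_add Q1 Q2 Q3)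
  show sf: "(\<lambda>(p,q). \<alpha> p * \<alpha> (p + q) * \<beta> q) summable_on UNIV"
    by (rule summable_on_le[OF sg]) (use pt nn in auto)
  have "(\<Sum>\<^sub>\<infinity>(p,q). \<alpha> p * \<alpha> (p + q) * \<beta> q) \<le> infsum ?g UNIV"
    by (rule infsum_mono[OF sf sg]) (use pt in auto)
  also have "\<dots> = (e/4) * (infsum \<sigma> UNIV * infsum b UNIV) + ((e/4) * (infsum b UNIV * infsum \<sigma> UNIV)
      + (1 / (2 * e)) * (infsum A UNIV * infsum A UNIV))"
    unfolding infsum_add[OF Q1 summable_on_add[OF Q2 Q3]] infsum_add[OF Q2 Q3] infsum_cmult_right' P1(2) P2(2) P3(2) ..
  also have "\<dots> = e / 2 * infsum b UNIV * infsum \<sigma> UNIV + (infsum A UNIV)\<^sup>2 / (2 * e)"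
    by (simp add: power2_eq_square)
  also have "\<dots> \<le> e / 2 * infsum b UNIV * 64 + (infsum A UNIV)\<^sup>2 / (2 * e)"
    using s\<sigma>(2) e infsum_nonneg[of UNIV b] nn'(2) by (intro add_right_mono mult_left_mono) auto
  finally show "(\<Sum>\<^sub>\<infinity>(p,q). \<alpha> p * \<alpha> (p + q) * \<beta> q) \<le>
      32 * e * (\<Sum>\<^sub>\<infinity>k. (\<beta> k)\<^sup>2) + (R * (\<Sum>\<^sub>\<infinity>k. (\<alpha> k)\<^sup>2) + (\<Sum>\<^sub>\<infinity>k. (knorm k * \<alpha> k)\<^sup>2) / R)\<^sup>2 / (2 * e)"
    by (simp add: iA b_def[abs_def])
qed

text \<open>Exchanging \<open>q\<close> and \<open>- p - q\<close> at fixed \<open>p\<close> is the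
  Fourier form of \<open>(B(u,v),w) = - (B(u,w),v)\<close>.\<close>

lemma bker_antisym: "bker \<kappa> p (- q) = - bker \<kappa> p (p + q)"
proof -
  have 1: "crs p (- q - p) = - crs p q" "dt (- q - p) (- q) = dt q (p + q)"
    by (auto simp: dt_def crs_def algebra_simps)
  have 2: "knorm (- q - p) = knorm (p + q)" by (simp add: add.commute)
  have 3: "p + q - p = q" by simp
  show ?thesis unfolding bker_def 1 2 3 by (simp add: mult.commute)
qed

text \<open>The sign in \<open>a_real\<close> differs from the usual reality condition because the
  basis vector \<open>k-perp / |k|\<close> is odd in \<open>k\<close>. The last assumption is finite
  enstrophy.\<close>

locale real_field =
  fixes \<kappa> :: real and a :: "idx \<Rightarrow> complex"
  assumes kap: "\<kappa> > 0"
    and a_real: "\<And>k. a (- k) = - cnj (a k)"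
    and a_l2: "l2 a"
    and a_h1: "(\<lambda>k. (knorm k * norm (a k))\<^sup>2) summable_on UNIV"
begin

text \<open>Here \<open>a (- p - q)\<close> stands for \<open>- cnj (a (p + q))\<close>. In this
  form the coefficients of a triad enter symmetrically, and exchanging two modes acts on the kernel
  alone.\<close>

definition tri :: "idx \<times> idx \<Rightarrow> complex" where
  "tri = (\<lambda>(p,q). bker \<kappa> p (p + q) * a p * a q * a (- p - q))"

lemma norm_a_minus [simp]: "norm (a (- k)) = norm (a k)"
  by (simp add: a_real)

lemma norm_a_minus_diff [simp]: "norm (a (- p - q)) = norm (a (p + q))"
  using norm_a_minus[of "p + q"] by (metis minus_add_distrib uminus_add_conv_diff add.commute)

lemmas a2 = a_l2[unfolded l2_def]

lemma tri_summable:
  assumes m: "\<And>x. \<bar>m x\<bar> \<le> C"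
  shows "(\<lambda>x. of_real (m x) * tri x) summable_on UNIV"
proof -
  have s: "(\<lambda>(p,q). norm (a p) * norm (a (p + q)) * (knorm q * norm (a q))) summable_on UNIV"
    by (rule trilinear_sum_le(1)[where R = 1 and e = 1]) (use a2 a_h1 in auto)
  show ?thesis
  proof (rule norm_summable_on_le(1)[OF summable_on_cmult_right[OF s, of "C * \<kappa>"]])
    fix x :: "idx \<times> idx"
    obtain p q where x: "x = (p,q)" by (cases x)
    have "norm (bker \<kappa> p (p + q)) \<le> \<kappa> * knorm q"
      using norm_bker_le(2)[of \<kappa> p "p + q"] kap by simp
    then have "norm (tri x) \<le> (\<kappa> * knorm q) * norm (a p) * norm (a q) * norm (a (p + q))"
      by (auto simp: tri_def x norm_mult intro!: mult_right_mono)
    then have "norm (of_real (m x) * tri x) \<le> C * ((\<kappa> * knorm q) * norm (a p) * norm (a q) * norm (a (p + q)))"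
      unfolding norm_mult norm_of_real using m order_trans[OF abs_ge_zero m] by (intro mult_mono) auto
    then show "norm (of_real (m x) * tri x) \<le> C * \<kappa> * (case x of (p,q) \<Rightarrow> norm (a p) * norm (a (p + q)) * (knorm q * norm (a q)))"
      by (simp add: x mult_ac)
  qed
qed

text \<open>Exchanging \<open>q\<close> and \<open>- p - q\<close> reverses the sign of
  \<open>tri\<close> and turns \<open>m (p + q)\<close> into \<open>m q\<close>. Averaging both
  forms of the sum leaves a difference of weights, a commutator that vanishes for constant
  \<open>m\<close>.\<close>

lemma trilinear_form_eq:
  assumes m: "\<And>k. \<bar>m k\<bar> \<le> C" and me: "\<And>k. m (- k) = m k"
  shows "(\<lambda>k. of_real (m k) * (cnj (a k) * bil \<kappa> a a k)) summable_on UNIV" (is ?th1)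
    "2 * (\<Sum>\<^sub>\<infinity>k. of_real (m k) * (cnj (a k) * bil \<kappa> a a k)) = - (\<Sum>\<^sub>\<infinity>(p,q). of_real (m (p + q) - m q) * tri (p,q))" (is ?th2)
proof -
  have sG: "(\<lambda>x. of_real (m (fst x + snd x)) * tri x) summable_on UNIV"
    "(\<lambda>x. of_real (m (snd x)) * tri x) summable_on UNIV"
    by (rule tri_summable[where C = C], rule m)+
  define H where "H k p = of_real (m k) * (cnj (a k) * (bker \<kappa> p k * a p * a (k - p)))" for k p
  have bij: "bij (\<lambda>(p,q). (p + q, p :: idx))"
    by (rule bij_betw_byWitness[of _ "\<lambda>(k,p). (p, k - p)"]) auto
  have Hs: "(\<lambda>(k,p). H k p) (case x of (p,q) \<Rightarrow> (p + q, p)) = - (of_real (m (fst x + snd x)) * tri x)" for x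
  proof -
    obtain p q where x: "x = (p,q)" by (cases x)
    have "a (- p - q) = - cnj (a (p + q))"
      using a_real[of "p + q"] by (metis minus_add_distrib uminus_add_conv_diff add.commute)
    then show ?thesis by (simp add: x H_def tri_def)
  qed
  have sH: "(\<lambda>(k,p). H k p) summable_on UNIV \<times> UNIV"
    using summable_on_reindex_bij_betw[OF bij, of "\<lambda>(k,p). H k p"] summable_on_uminus[of "\<lambda>x. of_real (m (fst x + snd x)) * tri x" UNIV] sG(1)
    unfolding Hs by simp
  have iH: "(\<Sum>\<^sub>\<infinity>(k,p). H k p) = - (\<Sum>\<^sub>\<infinity>x. of_real (m (fst x + snd x)) * tri x)"
    using infsum_reindex_bij_betw[OF bij, of "\<lambda>(k,p). H k p"] unfolding Hs infsum_uminus by simp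
  have inner: "infsum (H k) UNIV = of_real (m k) * (cnj (a k) * bil \<kappa> a a k)" for k
    unfolding H_def infsum_cmult_right' bil_def ..
  show ?th1
    using summable_on_Sigma_banach[OF sH] unfolding inner .
  have sum1: "(\<Sum>\<^sub>\<infinity>k. of_real (m k) * (cnj (a k) * bil \<kappa> a a k)) = - (\<Sum>\<^sub>\<infinity>x. of_real (m (fst x + snd x)) * tri x)"
    using infsum_Sigma'_banach[OF sH] iH unfolding inner by simp
  have "(\<Sum>\<^sub>\<infinity>x. of_real (m (fst x + snd x)) * tri x) =
      (\<Sum>\<^sub>\<infinity>x. (\<lambda>x. of_real (m (fst x + snd x)) * tri x) (case x of (p,q) \<Rightarrow> (p, - p - q)))"
    by (rule infsum_reindex_bij_betw[OF bij_shear(3), symmetric])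
  also have "\<dots> = (\<Sum>\<^sub>\<infinity>x. - (of_real (m (snd x)) * tri x))"
  proof (rule infsum_cong)
    fix x :: "idx \<times> idx"
    obtain p q where x: "x = (p,q)" by (cases x)
    have "tri (p, - p - q) = - tri (p, q)"
      by (simp add: tri_def bker_antisym)
    then show "of_real (m (fst (case x of (p,q) \<Rightarrow> (p, - p - q)) + snd (case x of (p,q) \<Rightarrow> (p, - p - q)))) *
        tri (case x of (p,q) \<Rightarrow> (p, - p - q)) = - (of_real (m (snd x)) * tri x)"
      using me[of q] by (simp add: x)
  qed
  also have "\<dots> = - (\<Sum>\<^sub>\<infinity>x. of_real (m (snd x)) * tri x)" by (rule infsum_uminus)
  finally have sum2: "(\<Sum>\<^sub>\<infinity>x. of_real (m (fst x + snd x)) * tri x) = - (\<Sum>\<^sub>\<infinity>x. of_real (m (snd x)) * tri x)" .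
  have "(\<Sum>\<^sub>\<infinity>(p,q). of_real (m (p + q) - m q) * tri (p,q)) =
      (\<Sum>\<^sub>\<infinity>x. of_real (m (fst x + snd x)) * tri x + - (of_real (m (snd x)) * tri x))"
    by (rule infsum_cong) (auto simp: algebra_simps)
  also have "\<dots> = (\<Sum>\<^sub>\<infinity>x. of_real (m (fst x + snd x)) * tri x) - (\<Sum>\<^sub>\<infinity>x. of_real (m (snd x)) * tri x)"
    using sG by (subst infsum_add) (auto simp: infsum_uminus intro!: summable_on_uminus[THEN iffD2])
  finally show ?th2 unfolding sum1 using sum2 by simp
qed

lemma energy_cancellation: "(\<Sum>\<^sub>\<infinity>k. cnj (a k) * bil \<kappa> a a k) = 0"
  "(\<lambda>k. cnj (a k) * bil \<kappa> a a k) summable_on UNIV"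
  using trilinear_form_eq[of "\<lambda>_. 1" 1] by (auto simp: case_prod_beta')

text \<open>A subadditive even \<open>M\<close> satisfies
  \<open>|M (p + q) - M q| \<le> M p\<close>, so the commutator weight is at most
  \<open>M p * (M (p + q) + M q)\<close>: two coefficients carry \<open>M\<close> and the third
  carries the derivative. \<open>C\<close> ensures convergence; its absence from the bound makes the
  estimate uniform in the truncation.\<close>

lemma trilinear_form_le:
  fixes M :: "idx \<Rightarrow> real" and R e :: real
  assumes M: "\<And>k. 0 \<le> M k" "\<And>k. M k \<le> C" "\<And>k. M (- k) = M k" "\<And>p q. M (p + q) \<le> M p + M q"
    and R: "R \<ge> 1" "e > 0"
  shows "norm (\<Sum>\<^sub>\<infinity>k. of_real ((M k)\<^sup>2) * (cnj (a k) * bil \<kappa> a a k)) \<le>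
    \<kappa> * (32 * e * (\<Sum>\<^sub>\<infinity>k. (knorm k * norm (a k))\<^sup>2) +
      (R * (\<Sum>\<^sub>\<infinity>k. (M k * norm (a k))\<^sup>2) + (\<Sum>\<^sub>\<infinity>k. (knorm k * (M k * norm (a k)))\<^sup>2) / R)\<^sup>2 / (2 * e))"
    (is "norm ?S \<le> \<kappa> * ?B")
proof -
  define \<alpha> where "\<alpha> k = M k * norm (a k)" for k
  define \<beta> where "\<beta> k = knorm k * norm (a k)" for k
  have C: "C \<ge> 0" using M(1,2) order_trans by blast
  have M2: "\<bar>(M k)\<^sup>2\<bar> \<le> C\<^sup>2" for k using M(1,2)[of k] by simp
  have s1: "(\<lambda>k. (\<alpha> k)\<^sup>2) summable_on UNIV"
    by (rule summable_on_le[OF summable_on_cmult_right[OF a2, of "C\<^sup>2"]])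
       (use M2 in \<open>auto simp: \<alpha>_def power_mult_distrib intro!: mult_right_mono\<close>)
  have s2: "(\<lambda>k. (knorm k * \<alpha> k)\<^sup>2) summable_on UNIV"
  proof (rule summable_on_le[OF summable_on_cmult_right[OF a_h1, of "C\<^sup>2"]])
    show "(knorm k * \<alpha> k)\<^sup>2 \<le> C\<^sup>2 * (knorm k * norm (a k))\<^sup>2" for k
    proof -
      have "(knorm k * \<alpha> k)\<^sup>2 = (M k)\<^sup>2 * (knorm k * norm (a k))\<^sup>2"
        by (simp add: \<alpha>_def power_mult_distrib)
      also have "\<dots> \<le> C\<^sup>2 * (knorm k * norm (a k))\<^sup>2"
        using M2[of k] by (intro mult_right_mono) auto
      finally show ?thesis .
    qed
  qed simp
  have s3: "(\<lambda>k. (\<beta> k)\<^sup>2) summable_on UNIV" using a_h1 by (simp add: \<beta>_def)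
  have nn: "\<alpha> k \<ge> 0" "\<beta> k \<ge> 0" for k using M by (auto simp: \<alpha>_def \<beta>_def)
  have even: "\<alpha> (- k) = \<alpha> k" "\<beta> (- k) = \<beta> k" for k using M by (auto simp: \<alpha>_def \<beta>_def)
  note T = trilinear_sum_le[where \<alpha> = \<alpha> and \<beta> = \<beta>, OF nn s1 s2 s3 R]
  let ?f = "\<lambda>(p,q). \<alpha> p * \<alpha> (p + q) * \<beta> q"
  let ?h = "\<lambda>(p,q). \<alpha> p * \<alpha> q * \<beta> (p + q)"
  \<comment> \<open>The term with the derivative on \<open>p + q\<close> becomes the term with the
    derivative on \<open>q\<close> when these two modes are exchanged, so a single trilinear sum
    covers both.\<close>
  have fh: "?f (case x of (p,q) \<Rightarrow> (p, - p - q)) = ?h x" for x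
  proof -
    obtain p q where x: "x = (p,q)" by (cases x)
    have "\<beta> (- p - q) = \<beta> (p + q)"
      using even(2)[of "p + q"] by (metis minus_add_distrib uminus_add_conv_diff add.commute)
    then show ?thesis by (simp add: x even)
  qed
  have sh: "?h summable_on UNIV"
    using summable_on_reindex_bij_betw[OF bij_shear(3), of ?f] T(1) unfolding fh by simp
  have ih: "infsum ?h UNIV = infsum ?f UNIV"
    using infsum_reindex_bij_betw[OF bij_shear(3), of ?f] unfolding fh by simp
  have "2 * norm ?S = norm (2 * ?S)" by (simp only: norm_mult norm_numeral)
  also have "\<dots> = norm (\<Sum>\<^sub>\<infinity>(p,q). of_real ((M (p + q))\<^sup>2 - (M q)\<^sup>2) * tri (p,q))"
    by (subst trilinear_form_eq(2)[of "\<lambda>k. (M k)\<^sup>2" "C\<^sup>2", OF M2]) (simp_all add: M(3))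
  also have "\<dots> \<le> (\<Sum>\<^sub>\<infinity>x. \<kappa> * (?f x + ?h x))"
  proof (rule norm_summable_on_le(3))
    show "(\<lambda>x. \<kappa> * (?f x + ?h x)) summable_on UNIV"
      by (intro summable_on_cmult_right summable_on_add T(1) sh)
    fix x :: "idx \<times> idx"
    obtain p q where x: "x = (p,q)" by (cases x)
    define c where "c = \<bar>crs p q / knorm p\<bar>"
    define P where "P = norm (a p) * norm (a q) * norm (a (p + q))"
    \<comment> \<open>The derivative may be charged to \<open>q\<close> or to \<open>p + q\<close>;
      in each of the two terms below it goes to the mode that does not carry
      \<open>M\<close>.\<close>
    have c: "0 \<le> c" "c \<le> knorm q" "c \<le> knorm (p + q)"
      using abs_crs_div_le[of p q] abs_crs_div_le[of p "p + q"]
      by (auto simp: c_def crs_def algebra_simps)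
    have P: "P \<ge> 0" by (simp add: P_def)
    have "M q \<le> M p + M (p + q)"
      using M(4)[of "- p" "p + q"] M(3)[of p] by simp
    hence d: "\<bar>M (p + q) - M q\<bar> \<le> M p" using M(4)[of p q] by linarith
    have "\<bar>(M (p + q))\<^sup>2 - (M q)\<^sup>2\<bar> = \<bar>M (p + q) - M q\<bar> * (M (p + q) + M q)"
      using M(1)[of "p + q"] M(1)[of q] by (simp add: power2_eq_square square_diff_square_factored abs_mult)
    also have "\<dots> \<le> M p * (M (p + q) + M q)"
      using d M(1)[of "p + q"] M(1)[of q] by (intro mult_right_mono) auto
    finally have dd: "\<bar>(M (p + q))\<^sup>2 - (M q)\<^sup>2\<bar> \<le> M p * (M (p + q) + M q)" .
    have "norm (bker \<kappa> p (p + q)) \<le> \<kappa> * c"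
      using norm_bker_le_aux[of \<kappa> p "p + q"] kap by (simp add: c_def)
    moreover have "norm (tri (p,q)) = norm (bker \<kappa> p (p + q)) * P"
      by (simp add: tri_def norm_mult P_def mult.assoc)
    ultimately have "norm (tri (p,q)) \<le> \<kappa> * c * P"
      using P by (simp add: mult_right_mono)
    hence "norm (of_real ((M (p + q))\<^sup>2 - (M q)\<^sup>2) * tri (p,q)) \<le> (M p * (M (p + q) + M q)) * (\<kappa> * c * P)"
      unfolding norm_mult norm_of_real using dd M(1) by (intro mult_mono) (auto simp: add_nonneg_nonneg)
    also have "\<dots> = \<kappa> * (M p * M (p + q) * P * c + M p * M q * P * c)"
      by (simp add: algebra_simps)
    also have "\<dots> \<le> \<kappa> * (M p * M (p + q) * P * knorm q + M p * M q * P * knorm (p + q))"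
      using kap c P M(1) by (intro mult_left_mono add_mono) auto
    also have "\<dots> = \<kappa> * (?f x + ?h x)"
      by (simp add: x \<alpha>_def \<beta>_def P_def mult_ac)
    finally show "norm (case x of (p,q) \<Rightarrow> of_real ((M (p + q))\<^sup>2 - (M q)\<^sup>2) * tri (p,q)) \<le> \<kappa> * (?f x + ?h x)"
      by (simp add: x)
  qed
  also have "\<dots> = 2 * (\<kappa> * infsum ?f UNIV)"
    unfolding infsum_cmult_right' infsum_add[OF T(1) sh] ih by simp
  also have "\<dots> \<le> 2 * (\<kappa> * ?B)"
    using T(2) kap by (simp add: \<alpha>_def \<beta>_def)
  finally show ?thesis by simp
qed

text \<open>The choice \<open>e = A / (8 * (1 + b))\<close>, with \<open>A\<close> the last bracket
  and \<open>b\<close> the root of the enstrophy sum, balances the two terms; \<open>1 + b\<close>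
  keeps it finite at \<open>b = 0\<close>. When the bracket is 0 the choice is void, and letting
  \<open>e\<close> tend to 0 gives the bound 0.\<close>

lemma trilinear_form_le':
  fixes M :: "idx \<Rightarrow> real" and R :: real
  assumes M: "\<And>k. 0 \<le> M k" "\<And>k. M k \<le> C" "\<And>k. M (- k) = M k" "\<And>p q. M (p + q) \<le> M p + M q"
    and R: "R \<ge> 1"
  shows "norm (\<Sum>\<^sub>\<infinity>k. of_real ((M k)\<^sup>2) * (cnj (a k) * bil \<kappa> a a k)) \<le>
    8 * \<kappa> * (1 + sqrt (\<Sum>\<^sub>\<infinity>k. (knorm k * norm (a k))\<^sup>2)) *
      (R * (\<Sum>\<^sub>\<infinity>k. (M k * norm (a k))\<^sup>2) + (\<Sum>\<^sub>\<infinity>k. (knorm k * (M k * norm (a k)))\<^sup>2) / R)"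
    (is "?S \<le> 8 * \<kappa> * (1 + sqrt ?b2) * ?A")
proof -
  note T = trilinear_form_le[OF M R]
  define b where "b = sqrt ?b2"
  have b2: "?b2 = b\<^sup>2" "b \<ge> 0" by (simp_all add: b_def infsum_nonneg)
  have A: "?A \<ge> 0" using R by (intro add_nonneg_nonneg mult_nonneg_nonneg divide_nonneg_nonneg infsum_nonneg) auto
  show ?thesis
  proof (cases "?A = 0")
    case True
    have "?S \<le> x" if "x > 0" for x
    proof -
      define e where "e = x / (32 * \<kappa> * (1 + b\<^sup>2))"
      have e: "e > 0" using that kap by (auto simp: e_def add_pos_nonneg)
      have "?S \<le> \<kappa> * (32 * e * b\<^sup>2)" using T[OF e] unfolding True b2(1) by simp
      also have "\<dots> \<le> \<kappa> * (32 * e * (1 + b\<^sup>2))" using kap e by simp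
      also have "\<dots> = x" using kap by (simp add: e_def add_pos_nonneg)
         (simp add: field_simps add_pos_nonneg add_nonneg_eq_0_iff)
      finally show ?thesis .
    qed
    hence "?S \<le> 0" by (rule field_le_epsilon[of _ 0, simplified])
    then show ?thesis unfolding True by simp
  next
    case False
    with A have A: "?A > 0" by simp
    define A where "A = ?A"
    define e where "e = A / (8 * (1 + b))"
    have e: "e > 0" using A b2 by (auto simp: e_def A_def)
    have A0: "A > 0" using A by (simp add: A_def)
    have "?S \<le> \<kappa> * (32 * e * b\<^sup>2 + A\<^sup>2 / (2 * e))"
      using T[OF e] unfolding b2(1) A_def by simp
    also have "A\<^sup>2 / (2 * e) = 4 * A * (1 + b)"
      using A0 b2(2) by (simp add: e_def power2_eq_square)
    also have "32 * e * b\<^sup>2 \<le> 4 * A * (1 + b)"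
    proof -
      have "32 * e * b\<^sup>2 = 4 * A * (b\<^sup>2 / (1 + b))"
        using b2(2) by (simp add: e_def field_simps)
      also have "\<dots> \<le> 4 * A * (1 + b)"
        using A0 b2(2) by (intro mult_left_mono) (auto simp: divide_le_eq power2_eq_square algebra_simps)
      finally show ?thesis .
    qed
    finally have "?S \<le> \<kappa> * (4 * A * (1 + b) + 4 * A * (1 + b))"
      using kap by simp
    also have "\<dots> = 8 * \<kappa> * (1 + b) * A" by (simp add: algebra_simps)
    finally show ?thesis unfolding A_def b_def .
  qed
qed

end

section \<open>Energy and enstrophy bounds\<close>

text \<open>The product \<open>(y t - d / c) * exp (c * t)\<close> is nonincreasing. An upper bound
  on the whole line lets the starting time tend to minus infinity, which removes the initial
  value.\<close>

lemma bounded_ancient_le: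
  fixes y y' :: "real \<Rightarrow> real"
  assumes der: "\<And>t. (y has_real_derivative y' t) (at t)"
    and le: "\<And>t. y' t \<le> d - c * y t" and c: "c > 0" and bd: "\<And>t. y t \<le> M"
  shows "y t \<le> d / c"
proof -
  define z where "z t = (y t - d / c) * exp (c * t)" for t
  have z': "(z has_real_derivative (y' t + c * (y t - d / c)) * exp (c * t)) (at t)" for t
    unfolding z_def by (auto intro!: derivative_eq_intros der simp: algebra_simps)
  have mono: "z t \<le> z s" if "s \<le> t" for s
  proof (rule DERIV_nonpos_imp_nonincreasing[OF that])
    fix x
    have "y' x + c * (y x - d / c) \<le> 0" using le[of x] c by (simp add: algebra_simps)
    then show "\<exists>D. (z has_real_derivative D) (at x) \<and> D \<le> 0"
      using z'[of x] by (auto intro!: exI mult_nonpos_nonneg)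
  qed
  have "z t \<le> 0"
  proof (rule tendsto_lowerbound)
    show "((\<lambda>s. (M - d / c) * exp (c * s)) \<longlongrightarrow> 0) at_bot"
    proof -
      have "filterlim (\<lambda>s. c * s) at_bot at_bot"
        using c by (simp add: filterlim_tendsto_pos_mult_at_bot[OF tendsto_const c filterlim_ident])
      hence "((\<lambda>s. exp (c * s)) \<longlongrightarrow> 0) at_bot"
        by (rule filterlim_compose[OF exp_at_bot])
      from tendsto_mult_right_zero[OF this] show ?thesis .
    qed
    show "\<forall>\<^sub>F s in at_bot. z t \<le> (M - d / c) * exp (c * s)"
      unfolding eventually_at_bot_linorder
    proof (intro exI allI impI)
      fix s assume "s \<le> t"
      have "z s \<le> (M - d / c) * exp (c * s)"
        unfolding z_def using bd[of s] by (intro mult_right_mono) auto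
      then show "z t \<le> (M - d / c) * exp (c * s)" using mono[OF \<open>s \<le> t\<close>] by linarith
    qed
  qed simp
  then show ?thesis by (simp add: z_def mult_le_0_iff)
qed

locale nse =
  fixes \<kappa> \<nu> :: real and \<gamma> :: "idx \<Rightarrow> complex"
  assumes kap: "\<kappa> > 0" and nu: "\<nu> > 0" and gam: "l2 \<gamma>"
begin

abbreviation nl :: "(idx \<Rightarrow> complex) \<Rightarrow> idx \<Rightarrow> complex" where
  "nl a k \<equiv> bil \<kappa> a a k"

definition \<mu> :: real where "\<mu> = \<nu> * \<kappa>\<^sup>2"

lemma mu: "\<mu> > 0" using kap nu by (simp add: \<mu>_def)

definition lam :: "idx \<Rightarrow> real" where
  "lam k = \<mu> * (knorm k)\<^sup>2"

definition rhs :: "(idx \<Rightarrow> complex) \<Rightarrow> idx \<Rightarrow> complex" where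
  "rhs a k = \<gamma> k - of_real (lam k) * a k - nl a k"

text \<open>Scalar form of a bounded complete trajectory. Membership in the domain of
  \<open>A\<close> is required at each time, without a bound uniform in time, and the equation holds
  through difference quotients in l2.\<close>

definition sol :: "(real \<Rightarrow> idx \<Rightarrow> complex) \<Rightarrow> bool" where
  "sol a \<longleftrightarrow> (\<forall>t. a t 0 = 0 \<and> (\<forall>k. a t (- k) = - cnj (a t k)) \<and>
      (\<lambda>k. ((knorm k)\<^sup>2 * norm (a t k))\<^sup>2) summable_on UNIV \<and> l2 (rhs (a t)) \<and>
      ((\<lambda>h. l2sq (\<lambda>k. (a (t + h) k - a t k) / of_real h - rhs (a t) k)) \<longlongrightarrow> 0) (at 0)) \<and>
    (\<exists>M. \<forall>t. l2sq (a t) \<le> M)"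

text \<open>Squared gradient norm, up to powers of \<open>\<kappa>\<close> and
  \<open>L\<close>.\<close>

definition b2 :: "(idx \<Rightarrow> complex) \<Rightarrow> real" where
  "b2 a = (\<Sum>\<^sub>\<infinity>k. (knorm k * norm (a k))\<^sup>2)"

lemma sol_h2:
  assumes "sol a"
  shows "a t 0 = 0" "a t (- k) = - cnj (a t k)" "(\<lambda>k. ((knorm k)\<^sup>2 * norm (a t k))\<^sup>2) summable_on UNIV"
    "l2 (rhs (a t))" "((\<lambda>h. l2sq (\<lambda>k. (a (t + h) k - a t k) / of_real h - rhs (a t) k)) \<longlongrightarrow> 0) (at 0)"
  using assms unfolding sol_def by blast+

lemma sol_h1:
  assumes "sol a"
  shows "(\<lambda>k. (knorm k * norm (a t k))\<^sup>2) summable_on UNIV"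
proof (rule summable_on_le[OF sol_h2(3)[OF assms]])
  show "(knorm k * norm (a t k))\<^sup>2 \<le> ((knorm k)\<^sup>2 * norm (a t k))\<^sup>2" for k
  proof (cases "k = 0")
    case False
    then have "knorm k * 1 \<le> knorm k * knorm k" using knorm_ge_1 by (intro mult_left_mono) auto
    then show ?thesis by (intro power_mono mult_right_mono) (auto simp: power2_eq_square)
  qed simp
qed simp

lemma sol_norm_le:
  assumes "sol a"
  shows "(norm (a t k))\<^sup>2 \<le> (knorm k * norm (a t k))\<^sup>2"
proof (cases "k = 0")
  case True
  then show ?thesis using sol_h2(1)[OF assms] by (simp add: zero_prod_def)
next
  case False
  then have "1 * norm (a t k) \<le> knorm k * norm (a t k)" using knorm_ge_1 by (intro mult_right_mono) auto
  then show ?thesis by (intro power_mono) auto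
qed

lemma sol_l2:
  assumes "sol a"
  shows "l2 (a t)" "l2sq (a t) \<le> b2 (a t)"
proof -
  show "l2 (a t)" unfolding l2_def
    by (rule summable_on_le[OF sol_h1[OF assms] _ sol_norm_le[OF assms]]) simp
  then show "l2sq (a t) \<le> b2 (a t)" unfolding l2sq_def b2_def l2_def
    by (intro infsum_mono sol_h1 assms sol_norm_le)
qed

lemma sol_real_field: "sol a \<Longrightarrow> real_field \<kappa> (a t)"
  by unfold_locales (use kap sol_h2 sol_l2 sol_h1 in auto)

text \<open>What results from testing the equation with \<open>M^2 a\<close>: forcing, dissipation
  and nonlinear transfer, doubled.\<close>

definition rate :: "(idx \<Rightarrow> real) \<Rightarrow> (idx \<Rightarrow> complex) \<Rightarrow> real" where
  "rate M a = 2 * ((\<Sum>\<^sub>\<infinity>k. (M k)\<^sup>2 * Re (cnj (a k) * \<gamma> k)) - \<mu> * (\<Sum>\<^sub>\<infinity>k. (knorm k * (M k * norm (a k)))\<^sup>2)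
       - Re (\<Sum>\<^sub>\<infinity>k. of_real ((M k)\<^sup>2) * (cnj (a k) * nl a k)))"

lemma weighted_balance:
  assumes a: "sol a" and M: "\<And>k. 0 \<le> M k" "\<And>k. M k \<le> C" "\<And>k. M (- k) = M k"
  shows "((\<lambda>t. \<Sum>\<^sub>\<infinity>k. (M k * norm (a t k))\<^sup>2) has_real_derivative rate M (a t)) (at t)"
    "(\<lambda>k. (knorm k * (M k * norm (a t k)))\<^sup>2) summable_on UNIV"
    "(\<lambda>k. (M k * norm (a t k))\<^sup>2) summable_on UNIV"
proof -
  interpret real_field \<kappa> "a t" by (rule sol_real_field[OF a])
  have C: "C \<ge> 0" using M(1,2) order_trans by blast
  have M2: "0 \<le> (M k)\<^sup>2" "(M k)\<^sup>2 \<le> C\<^sup>2" "\<bar>(M k)\<^sup>2\<bar> \<le> C\<^sup>2" for k using M(1,2)[of k] by simp_all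
  have S1: "(\<lambda>k. (M k)\<^sup>2 * Re (cnj (a t k) * \<gamma> k)) summable_on UNIV"
    by (rule weighted_inner_summable(1)[where m = "\<lambda>k. (M k)\<^sup>2" and C = "C\<^sup>2", OF sol_l2(1)[OF a] gam]) (rule M2)+
  show S2: "(\<lambda>k. (knorm k * (M k * norm (a t k)))\<^sup>2) summable_on UNIV"
  proof (rule summable_on_le[OF summable_on_cmult_right[OF sol_h1[OF a, of t], of "C\<^sup>2"]])
    fix k
    have "(knorm k * (M k * norm (a t k)))\<^sup>2 = (M k)\<^sup>2 * (knorm k * norm (a t k))\<^sup>2"
      by (simp add: power_mult_distrib)
    also have "\<dots> \<le> C\<^sup>2 * (knorm k * norm (a t k))\<^sup>2"
      by (intro mult_right_mono M2) auto
    finally show "(knorm k * (M k * norm (a t k)))\<^sup>2 \<le> C\<^sup>2 * (knorm k * norm (a t k))\<^sup>2" .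
  qed simp
  show "(\<lambda>k. (M k * norm (a t k))\<^sup>2) summable_on UNIV"
    using weighted_square_summable(1)[where m = "\<lambda>k. (M k)\<^sup>2", OF sol_l2(1)[OF a] M2(1,2)]
    by (simp add: power_mult_distrib)
  have S3: "(\<lambda>k. of_real ((M k)\<^sup>2) * (cnj (a t k) * nl (a t) k)) summable_on UNIV"
    by (rule trilinear_form_eq(1)[of "\<lambda>k. (M k)\<^sup>2", OF M2(3)]) (simp add: M(3))
  note S3' = summable_on_Re[OF S3]
  have pt: "(M k)\<^sup>2 * Re (cnj (a t k) * rhs (a t) k) = (M k)\<^sup>2 * Re (cnj (a t k) * \<gamma> k) +
     ((- \<mu>) * (knorm k * (M k * norm (a t k)))\<^sup>2 + (- Re (of_real ((M k)\<^sup>2) * (cnj (a t k) * nl (a t) k))))" for k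
  proof -
    have 1: "cnj (a t k) * (of_real (lam k) * a t k) = of_real (lam k * (norm (a t k))\<^sup>2)"
      by (simp only: of_real_mult complex_norm_square mult_ac)
    have "Re (cnj (a t k) * rhs (a t) k) = Re (cnj (a t k) * \<gamma> k) - lam k * (norm (a t k))\<^sup>2 - Re (cnj (a t k) * nl (a t) k)"
      unfolding rhs_def right_diff_distrib minus_complex.simps 1 Re_complex_of_real ..
    moreover have "Re (of_real ((M k)\<^sup>2) * (cnj (a t k) * nl (a t) k)) = (M k)\<^sup>2 * Re (cnj (a t k) * nl (a t) k)"
      by (metis scaleR_complex.simps(1) scaleR_conv_of_real)
    ultimately show ?thesis unfolding lam_def power_mult_distrib by algebra
  qed
  have S2': "(\<lambda>k. (- \<mu>) * (knorm k * (M k * norm (a t k)))\<^sup>2) summable_on UNIV"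
    by (rule summable_on_cmult_right[OF S2])
  have S3'': "(\<lambda>k. - Re (of_real ((M k)\<^sup>2) * (cnj (a t k) * nl (a t) k))) summable_on UNIV"
    using S3' by (simp add: summable_on_uminus)
  have "(\<Sum>\<^sub>\<infinity>k. (M k)\<^sup>2 * Re (cnj (a t k) * rhs (a t) k)) =
    (\<Sum>\<^sub>\<infinity>k. (M k)\<^sup>2 * Re (cnj (a t k) * \<gamma> k)) - \<mu> * (\<Sum>\<^sub>\<infinity>k. (knorm k * (M k * norm (a t k)))\<^sup>2)
       - Re (\<Sum>\<^sub>\<infinity>k. of_real ((M k)\<^sup>2) * (cnj (a t k) * nl (a t) k))"
    unfolding pt infsum_add[OF S1 summable_on_add[OF S2' S3'']] infsum_add[OF S2' S3'']
      infsum_cmult_right' infsum_uminus infsum_Re[OF S3, symmetric] by simp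
  moreover have "((\<lambda>t. \<Sum>\<^sub>\<infinity>k. (M k)\<^sup>2 * (norm (a t k))\<^sup>2) has_real_derivative
      2 * (\<Sum>\<^sub>\<infinity>k. (M k)\<^sup>2 * Re (cnj (a t k) * rhs (a t) k))) (at t)"
    by (rule weighted_square_has_derivative[where m = "\<lambda>k. (M k)\<^sup>2" and C = "C\<^sup>2", OF sol_l2(1)[OF a] sol_h2(4)[OF a] M2(1,2) sol_h2(5)[OF a]])
  ultimately show "((\<lambda>t. \<Sum>\<^sub>\<infinity>k. (M k * norm (a t k))\<^sup>2) has_real_derivative rate M (a t)) (at t)"
    by (simp add: power_mult_distrib rate_def)
qed

section \<open>Uniform energy bound\<close>

definition forcing_power :: "(idx \<Rightarrow> complex) \<Rightarrow> real" where
  "forcing_power a = (\<Sum>\<^sub>\<infinity>k. Re (cnj (a k) * \<gamma> k))"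

lemma energy_balance:
  assumes a: "sol a"
  shows "((\<lambda>t. l2sq (a t)) has_real_derivative 2 * forcing_power (a t) - 2 * \<mu> * b2 (a t)) (at t)"
proof -
  interpret real_field \<kappa> "a t" by (rule sol_real_field[OF a])
  show ?thesis
    using weighted_balance(1)[OF a, of "\<lambda>_. 1" 1 t] energy_cancellation(1)
    by (simp add: l2sq_def b2_def forcing_power_def rate_def algebra_simps)
qed

lemma forcing_power_le:
  assumes a: "sol a"
  shows "2 * forcing_power (a t) \<le> \<mu> * l2sq (a t) + l2sq \<gamma> / \<mu>"
proof -
  have "forcing_power (a t) \<le> sqrt (l2sq (a t)) * sqrt (l2sq \<gamma>)"
    using weighted_inner_summable(2)[OF sol_l2(1)[OF a] gam, of "\<lambda>_. 1" 1 t]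
    by (simp add: forcing_power_def)
  also have "\<dots> = (sqrt \<mu> * sqrt (l2sq (a t))) * (sqrt (l2sq \<gamma>) / sqrt \<mu>)" using mu by simp
  also have "\<dots> \<le> ((sqrt \<mu> * sqrt (l2sq (a t)))\<^sup>2 + (sqrt (l2sq \<gamma>) / sqrt \<mu>)\<^sup>2) / 2"
    by (rule mult_le_half_squares)
  also have "\<dots> = (\<mu> * l2sq (a t) + l2sq \<gamma> / \<mu>) / 2"
    using mu by (simp add: power_mult_distrib power_divide)
  finally show ?thesis by simp
qed

text \<open>The equilibrium of the energy inequality
  \<open>y' \<le> l2sq \<gamma> / \<mu> - \<mu> * y\<close>.\<close>

definition M0 :: real where "M0 = l2sq \<gamma> / \<mu>\<^sup>2"

lemma energy_bound:
  assumes a: "sol a"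
  shows "l2sq (a t) \<le> M0"
proof -
  obtain M where M: "\<And>t. l2sq (a t) \<le> M" using a by (auto simp: sol_def)
  have "l2sq (a t) \<le> (l2sq \<gamma> / \<mu>) / \<mu>"
  proof (rule bounded_ancient_le[OF energy_balance[OF a] _ mu M])
    fix t
    have "\<mu> * l2sq (a t) \<le> \<mu> * b2 (a t)" using sol_l2(2)[OF a] mu by (intro mult_left_mono) auto
    then show "2 * forcing_power (a t) - 2 * \<mu> * b2 (a t) \<le> l2sq \<gamma> / \<mu> - \<mu> * l2sq (a t)"
      using forcing_power_le[OF a, of t] by linarith
  qed
  then show ?thesis by (simp add: M0_def power2_eq_square)
qed

lemma M0_nonneg: "M0 \<ge> 0" by (simp add: M0_def)

definition Q :: real where "Q = \<mu> * M0 + l2sq \<gamma> / \<mu>"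

text \<open>The energy balance read backwards: the right side contains minus the time derivative of
  the energy. This replaces a bound on the time integral of the enstrophy.\<close>

lemma b2_le:
  assumes a: "sol a"
  shows "2 * \<mu> * b2 (a t) \<le> Q - (2 * forcing_power (a t) - 2 * \<mu> * b2 (a t))"
proof -
  have "\<mu> * l2sq (a t) \<le> \<mu> * M0" using energy_bound[OF a] mu by (intro mult_left_mono) auto
  then show ?thesis using forcing_power_le[OF a, of t] unfolding Q_def by linarith
qed

text \<open>The summand \<open>16 / (\<nu> * \<kappa>)\<close> makes
  \<open>8 * \<kappa> / D0 \<le> \<mu> / 2\<close>; the summand 1 secures the condition
  \<open>R \<ge> 1\<close> of the trilinear estimate.\<close>

definition D0 :: real where "D0 = 1 + 16 / (\<nu> * \<kappa>)"
definition C1 :: real where "C1 = 32 * \<kappa> * D0"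
definition F1 :: real where "F1 = l2sq \<gamma> / \<mu>"

text \<open>The whole dissipation is spent: one half absorbs part of the nonlinear term, the other
  half the force. What is left is linear in the truncated enstrophy, with constants free of
  \<open>N\<close>.\<close>

lemma weighted_enstrophy_le:
  fixes N :: real
  assumes a: "sol a" and N: "N \<ge> 0"
  defines "M \<equiv> \<lambda>k. min (knorm k) N"
  shows "rate M (a t) \<le>
    C1 * (1 + b2 (a t)) * (\<Sum>\<^sub>\<infinity>k. (M k * norm (a t k))\<^sup>2) + F1"
proof -
  interpret real_field \<kappa> "a t" by (rule sol_real_field[OF a])
  have M: "\<And>k. 0 \<le> M k" "\<And>k. M k \<le> N" "\<And>k. M (- k) = M k"
    using N by (auto simp: M_def)
  have Ms: "M (p + q) \<le> M p + M q" for p q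
    using knorm_triangle[of p q] N knorm_nonneg[of p] knorm_nonneg[of q] unfolding M_def
    by (auto simp: min_def simp del: knorm_nonneg)
  define y where "y = (\<Sum>\<^sub>\<infinity>k. (M k * norm (a t k))\<^sup>2)"
  define Z where "Z = (\<Sum>\<^sub>\<infinity>k. (knorm k * (M k * norm (a t k)))\<^sup>2)"
  define S where "S = (\<Sum>\<^sub>\<infinity>k. of_real ((M k)\<^sup>2) * (cnj (a t k) * nl (a t) k))"
  define b where "b = sqrt (b2 (a t))"
  have b: "b \<ge> 0" "b\<^sup>2 = b2 (a t)" by (simp_all add: b_def b2_def infsum_nonneg)
  have yZ: "y \<ge> 0" "Z \<ge> 0" by (simp_all add: y_def Z_def infsum_nonneg)
  have sZ: "(\<lambda>k. (knorm k * (M k * norm (a t k)))\<^sup>2) summable_on UNIV"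
    by (rule weighted_balance(2)[where M = M, OF a M])
  have D0: "D0 \<ge> 1" using kap nu by (simp add: D0_def)
  \<comment> \<open>\<open>R\<close> grows with \<open>b\<close> so that the coefficient
    \<open>8 * \<kappa> * (1 + b) / R\<close> of the dissipation does not. The price is a factor
    \<open>(1 + b)^2\<close> in front of \<open>y\<close>, which is linear in
    \<open>b2\<close>.\<close>
  define R where "R = D0 * (1 + b)"
  have R: "R \<ge> 1"
  proof -
    have "1 * 1 \<le> D0 * (1 + b)" using D0 b by (intro mult_mono) auto
    then show ?thesis by (simp add: R_def)
  qed
  have "norm S \<le> 8 * \<kappa> * (1 + b) * (R * y + Z / R)"
    using trilinear_form_le'[where M = M, OF M Ms R] by (simp add: S_def y_def Z_def b_def b2_def)
  also have "\<dots> = 8 * \<kappa> * D0 * (1 + b)\<^sup>2 * y + (8 * \<kappa> / D0) * Z"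
  proof -
    define c where "c = 1 + b"
    have "c > 0" using b by (simp add: c_def)
    then show ?thesis unfolding R_def c_def[symmetric] using D0
      by (simp add: field_simps power2_eq_square)
  qed
  also have "\<dots> \<le> 8 * \<kappa> * D0 * (2 * (1 + b2 (a t))) * y + (\<mu> / 2) * Z"
  proof (intro add_mono mult_right_mono mult_left_mono)
    show "(1 + b)\<^sup>2 \<le> 2 * (1 + b2 (a t))"
      using mult_le_half_squares[of 1 b] b by (simp add: power2_sum)
    have "16 / (\<nu> * \<kappa>) \<le> D0" by (simp add: D0_def)
    then show "8 * \<kappa> / D0 \<le> \<mu> / 2"
      using kap nu D0 by (simp add: \<mu>_def field_simps power2_eq_square)
  qed (use yZ kap D0 in auto)
  finally have S: "norm S \<le> 8 * \<kappa> * D0 * (2 * (1 + b2 (a t))) * y + (\<mu> / 2) * Z" .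
  have G: "(\<Sum>\<^sub>\<infinity>k. (M k)\<^sup>2 * Re (cnj (a t k) * \<gamma> k)) \<le> \<mu> / 2 * Z + l2sq \<gamma> / (2 * \<mu>)"
  proof -
    have s1: "(\<lambda>k. (M k)\<^sup>2 * Re (cnj (a t k) * \<gamma> k)) summable_on UNIV"
      by (rule weighted_inner_summable(1)[where m = "\<lambda>k. (M k)\<^sup>2" and C = "N\<^sup>2", OF sol_l2(1)[OF a] gam])
         (use M in \<open>auto intro!: power_mono\<close>)
    have s2: "(\<lambda>k. \<mu> / 2 * (knorm k * (M k * norm (a t k)))\<^sup>2) summable_on UNIV"
      by (rule summable_on_cmult_right[OF sZ])
    have s3: "(\<lambda>k. 1 / (2 * \<mu>) * (norm (\<gamma> k))\<^sup>2) summable_on UNIV"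
      using gam unfolding l2_def by (rule summable_on_cmult_right)
    have "(\<Sum>\<^sub>\<infinity>k. (M k)\<^sup>2 * Re (cnj (a t k) * \<gamma> k)) \<le>
        (\<Sum>\<^sub>\<infinity>k. \<mu> / 2 * (knorm k * (M k * norm (a t k)))\<^sup>2 + 1 / (2 * \<mu>) * (norm (\<gamma> k))\<^sup>2)"
    proof (rule infsum_mono[OF s1 summable_on_add[OF s2 s3]])
      fix k
      define x where "x = knorm k * (M k * norm (a t k))"
      have "Re (cnj (a t k) * \<gamma> k) \<le> norm (a t k) * norm (\<gamma> k)"
        using complex_Re_le_cmod[of "cnj (a t k) * \<gamma> k"] by (simp add: norm_mult)
      then have "(M k)\<^sup>2 * Re (cnj (a t k) * \<gamma> k) \<le> (M k)\<^sup>2 * (norm (a t k) * norm (\<gamma> k))"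
        by (intro mult_left_mono) auto
      also have "\<dots> \<le> (knorm k * M k) * (norm (a t k) * norm (\<gamma> k))"
        using M(1)[of k] by (intro mult_right_mono) (auto simp: power2_eq_square M_def intro!: mult_right_mono)
      also have "\<dots> = (sqrt \<mu> * x) * (norm (\<gamma> k) / sqrt \<mu>)" using mu by (simp add: x_def)
      also have "\<dots> \<le> ((sqrt \<mu> * x)\<^sup>2 + (norm (\<gamma> k) / sqrt \<mu>)\<^sup>2) / 2"
        by (rule mult_le_half_squares)
      also have "\<dots> = \<mu> / 2 * x\<^sup>2 + 1 / (2 * \<mu>) * (norm (\<gamma> k))\<^sup>2"
        using mu by (simp add: power_mult_distrib power_divide add_divide_distrib)
      finally show "(M k)\<^sup>2 * Re (cnj (a t k) * \<gamma> k) \<le> \<mu> / 2 * (knorm k * (M k * norm (a t k)))\<^sup>2 + 1 / (2 * \<mu>) * (norm (\<gamma> k))\<^sup>2"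
        by (simp add: x_def)
    qed
    also have "\<dots> = \<mu> / 2 * Z + 1 / (2 * \<mu>) * l2sq \<gamma>"
      unfolding infsum_add[OF s2 s3] infsum_cmult_right' Z_def l2sq_def ..
    finally show ?thesis by simp
  qed
  have "- Re S \<le> norm S" using abs_Re_le_cmod[of S] by linarith
  then have "2 * ((\<Sum>\<^sub>\<infinity>k. (M k)\<^sup>2 * Re (cnj (a t k) * \<gamma> k)) - \<mu> * Z - Re S) \<le>
     2 * (8 * \<kappa> * D0 * (2 * (1 + b2 (a t))) * y) + 2 * (l2sq \<gamma> / (2 * \<mu>))"
    using S G by argo
  also have "\<dots> = C1 * (1 + b2 (a t)) * y + F1" by (simp add: C1_def F1_def)
  finally show ?thesis unfolding y_def Z_def S_def rate_def .
qed

text \<open>The exponentials bound the inverse of the integrating factor of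
  \<open>enstrophy_bound\<close> and the factor itself; the bracket is the initial enstrophy plus
  the force accumulated over unit time.\<close>

definition K1 :: real where
  "K1 = exp (C1 / (2 * \<mu>) * (Q + 2 * \<mu>)) * exp (C1 / (2 * \<mu>) * M0) * ((Q + M0) / (2 * \<mu>) + F1)"

text \<open>A uniform Gronwall argument without time integrals: by \<open>b2_le\<close> the growth
  rate is at most \<open>c * (Q' - E' t)\<close>, so \<open>exp (c * (E x - Q' * (x - s)))\<close>
  is an integrating factor. It is bounded above and below because the energy is.\<close>

lemma enstrophy_bound:
  assumes a: "sol a"
  shows "b2 (a t) \<le> K1"
proof -
  define c where "c = C1 / (2 * \<mu>)"
  define Q' where "Q' = Q + 2 * \<mu>"
  define E where "E t = l2sq (a t)" for t
  define E' where "E' t = 2 * forcing_power (a t) - 2 * \<mu> * b2 (a t)" for t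
  have dE: "(E has_real_derivative E' t) (at t)" for t
    unfolding E_def E'_def by (rule energy_balance[OF a])
  have E: "0 \<le> E t" "E t \<le> M0" for t using energy_bound[OF a] by (auto simp: E_def)
  have "C1 \<ge> 0" using kap nu by (simp add: C1_def D0_def)
  then have c: "c \<ge> 0" using mu by (simp add: c_def)
  have F1: "F1 \<ge> 0" using mu by (simp add: F1_def)
  have Q: "Q \<ge> 0" using mu M0_nonneg by (simp add: Q_def)
  have b2E: "C1 * (1 + b2 (a t)) \<le> c * (Q' - E' t)" for t
  proof -
    have "2 * \<mu> * (1 + b2 (a t)) \<le> Q' - E' t"
      using b2_le[OF a, of t] by (simp add: Q'_def E'_def algebra_simps)
    then have "c * (2 * \<mu> * (1 + b2 (a t))) \<le> c * (Q' - E' t)" using c by (intro mult_left_mono)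
    moreover have "c * (2 * \<mu> * (1 + b2 (a t))) = C1 * (1 + b2 (a t))" using mu kap nu by (simp add: c_def)
    ultimately show ?thesis by simp
  qed
  \<comment> \<open>The mean value theorem for the energy on a unit interval yields a time at which
    its derivative, and with it the enstrophy, is bounded. Growth is estimated from there.\<close>
  obtain s where s: "t - 1 < s" "s < t" "E t - E (t - 1) = E' s"
    using MVT2[of "t - 1" t E E'] dE by auto
  have b2s: "b2 (a s) \<le> (Q + M0) / (2 * \<mu>)"
  proof -
    have "2 * \<mu> * b2 (a s) \<le> Q - E' s" using b2_le[OF a, of s] by (simp add: E'_def)
    also have "\<dots> \<le> Q + M0" using s(3) E(1)[of t] E(2)[of "t - 1"] by linarith
    finally show ?thesis using mu by (simp add: pos_le_divide_eq mult.commute)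
  qed
  have trunc: "(\<Sum>\<^sub>\<infinity>k. (min (knorm k) N * norm (a t k))\<^sup>2) \<le> K1" if N: "N \<ge> 0" for N
  proof -
    define M where "M k = min (knorm k) N" for k
    have M: "\<And>k. 0 \<le> M k" "\<And>k. M k \<le> N" "\<And>k. M (- k) = M k" using N by (auto simp: M_def)
    define y where "y t = (\<Sum>\<^sub>\<infinity>k. (M k * norm (a t k))\<^sup>2)" for t
    have y0: "y t \<ge> 0" for t by (simp add: y_def infsum_nonneg)
    have dy: "\<exists>y'. (y has_real_derivative y') (at t) \<and> y' \<le> c * (Q' - E' t) * y t + F1" for t
    proof -
      have "(y has_real_derivative rate M (a t)) (at t)"
        unfolding y_def by (rule weighted_balance(1)[where M = M, OF a M])
      moreover have "rate M (a t) \<le> C1 * (1 + b2 (a t)) * y t + F1"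
        using weighted_enstrophy_le[OF a N, of t] by (simp add: M_def[abs_def] y_def)
      moreover have "C1 * (1 + b2 (a t)) * y t \<le> c * (Q' - E' t) * y t"
        by (rule mult_right_mono[OF b2E y0])
      ultimately show ?thesis by (intro exI[of _ "rate M (a t)"] conjI) linarith+
    qed
    \<comment> \<open>The subtracted linear term absorbs the force, since the integrating factor
      never exceeds \<open>exp (c * M0)\<close> after time \<open>s\<close>.\<close>
    define z where "z x = y x * exp (c * (E x - Q' * (x - s))) - F1 * exp (c * M0) * x" for x
    have "z t \<le> z s"
    proof (rule DERIV_nonpos_imp_nonincreasing[of s t z])
      fix x assume x: "s \<le> x" "x \<le> t"
      obtain y' where y': "(y has_real_derivative y') (at x)" "y' \<le> c * (Q' - E' x) * y x + F1"
        using dy by blast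
      let ?e = "exp (c * (E x - Q' * (x - s)))"
      let ?D = "(y' - c * (Q' - E' x) * y x) * ?e - F1 * exp (c * M0)"
      have "(z has_real_derivative ?D) (at x)"
        unfolding z_def by (auto intro!: derivative_eq_intros y' dE simp: algebra_simps)
      moreover have "?D \<le> 0"
      proof -
        have "Q' * (x - s) \<ge> 0" using x Q mu by (simp add: Q'_def)
        then have "?e \<le> exp (c * M0)" using c E(2)[of x] by (auto intro!: mult_left_mono)
        have "(y' - c * (Q' - E' x) * y x) * ?e \<le> F1 * ?e"
          using y'(2) by (intro mult_right_mono) auto
        also have "\<dots> \<le> F1 * exp (c * M0)" using \<open>?e \<le> _\<close> F1 by (intro mult_left_mono)
        finally show ?thesis by simp
      qed
      ultimately show "\<exists>D. (z has_real_derivative D) (at x) \<and> D \<le> 0" by blast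
    qed (use s in simp)
    then have "y t * exp (c * (E t - Q' * (t - s))) \<le> y s * exp (c * E s) + F1 * exp (c * M0) * (t - s)"
      by (simp add: z_def algebra_simps)
    also have "\<dots> \<le> (Q + M0) / (2 * \<mu>) * exp (c * M0) + F1 * exp (c * M0) * 1"
    proof (intro add_mono mult_mono)
      have "y s \<le> b2 (a s)"
        unfolding y_def b2_def
      proof (rule infsum_mono[OF weighted_balance(3)[where M = M, OF a M] sol_h1[OF a]])
        show "(M k * norm (a s k))\<^sup>2 \<le> (knorm k * norm (a s k))\<^sup>2" for k
          using M(1)[of k] by (intro power_mono mult_right_mono) (auto simp: M_def)
      qed
      then show "y s \<le> (Q + M0) / (2 * \<mu>)" using b2s by linarith
    qed (use c E[of s] F1 y0 s Q mu M0_nonneg in \<open>auto intro!: mult_left_mono\<close>)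
    finally have 1: "y t * exp (c * (E t - Q' * (t - s))) \<le> exp (c * M0) * ((Q + M0) / (2 * \<mu>) + F1)"
      by (simp add: algebra_simps)
    have "y t = (y t * exp (c * (E t - Q' * (t - s)))) * exp (- (c * (E t - Q' * (t - s))))"
      by (simp add: exp_minus)
    also have "\<dots> \<le> (exp (c * M0) * ((Q + M0) / (2 * \<mu>) + F1)) * exp (c * Q')"
    proof (rule mult_mono[OF 1])
      have "Q' * (t - s) \<le> Q' * 1" using s Q mu by (intro mult_left_mono) (auto simp: Q'_def)
      then have "- (E t - Q' * (t - s)) \<le> Q'" using E(1)[of t] by linarith
      then have "c * (- (E t - Q' * (t - s))) \<le> c * Q'" using c by (rule mult_left_mono)
      then show "exp (- (c * (E t - Q' * (t - s)))) \<le> exp (c * Q')"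
        by (simp only: mult_minus_right exp_le_cancel_iff)
    qed (use Q M0_nonneg mu F1 in auto)
    also have "\<dots> = K1" by (simp add: K1_def c_def Q'_def)
    finally show ?thesis by (simp add: y_def M_def)
  qed
  show ?thesis unfolding b2_def
  proof (rule infsum_le_finite_sums[OF sol_h1[OF a]])
    fix F :: "idx set" assume F: "finite F"
    \<comment> \<open>On the finite set \<open>F\<close> the truncation at this \<open>N\<close> is
      inactive, so the bound uniform in \<open>N\<close> passes to the full enstrophy.\<close>
    define N where "N = (\<Sum>k\<in>F. knorm k)"
    have N: "N \<ge> 0" by (simp add: N_def sum_nonneg)
    have "(\<Sum>k\<in>F. (knorm k * norm (a t k))\<^sup>2) = (\<Sum>k\<in>F. (min (knorm k) N * norm (a t k))\<^sup>2)"
    proof (rule sum.cong)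
      fix k assume "k \<in> F"
      then have "knorm k \<le> N" unfolding N_def using F by (intro member_le_sum) auto
      then show "(knorm k * norm (a t k))\<^sup>2 = (min (knorm k) N * norm (a t k))\<^sup>2" by simp
    qed simp
    also have "\<dots> \<le> (\<Sum>\<^sub>\<infinity>k. (min (knorm k) N * norm (a t k))\<^sup>2)"
      by (intro finite_sum_le_infsum weighted_balance(3)[OF a, where C = N]) (use F N in auto)
    also have "\<dots> \<le> K1" by (rule trunc[OF N])
    finally show "(\<Sum>k\<in>F. (knorm k * norm (a t k))\<^sup>2) \<le> K1" .
  qed
qed

end

section \<open>Pointwise bounds on the coefficients\<close>

text \<open>Duhamel's formula along the ray from 0 to \<open>z\<close>, with integrating factor
  \<open>exp (s * l * z)\<close>. Its modulus depends on \<open>l * Re z\<close> alone, so the decay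
  survives in complex time.\<close>

lemma duhamel_bound:
  fixes f h :: "real \<Rightarrow> complex" and z :: complex and l F :: real
  assumes der: "\<And>s. s \<in> {0..1} \<Longrightarrow> (f has_vector_derivative z * (h s - of_real l * f s)) (at s within {0..1})"
    and h: "\<And>s. s \<in> {0..1} \<Longrightarrow> norm (h s) \<le> F"
    and x: "l * Re z > 0"
  shows "norm (f 1) \<le> exp (- (l * Re z)) * norm (f 0) + norm z * F * ((1 - exp (- (l * Re z))) / (l * Re z))"
proof -
  define x where "x = l * Re z"
  have x0: "x > 0" using x by (simp add: x_def)
  define w where "w = of_real l * z"
  have Rew: "Re w = x" by (simp add: w_def x_def)
  define G where "G s = exp (of_real s * w) * f s" for s
  define \<phi> where "\<phi> s = norm z * F / x * exp (s * x)" for s :: real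
  have dE: "((\<lambda>s. exp (of_real s * w)) has_vector_derivative w * exp (of_real s * w)) (at s within {0..1})" for s :: real
  proof -
    have "((\<lambda>z. exp (z * w)) has_field_derivative w * exp (of_real s * w)) (at (of_real s))"
      by (auto intro!: derivative_eq_intros)
    then show ?thesis by (rule has_vector_derivative_real_field)
  qed
  have dG: "(G has_vector_derivative exp (of_real s * w) * z * h s) (at s within {0..1})" if "s \<in> {0..1}" for s
  proof -
    have "(G has_vector_derivative exp (of_real s * w) * (z * (h s - of_real l * f s)) + (w * exp (of_real s * w)) * f s) (at s within {0..1})"
      unfolding G_def by (rule has_vector_derivative_mult[OF dE der[OF that]])
    then show ?thesis by (simp add: w_def algebra_simps)
  qed
  have "norm (G 1 - G 0) \<le> \<phi> 1 - \<phi> 0"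
  proof (rule differentiable_bound_general[where f' = "\<lambda>s. exp (of_real s * w) * z * h s" and \<phi>' = "\<lambda>s. norm z * F * exp (s * x)"])
    show "continuous_on {0..1} G"
      using dG by (meson continuous_on_eq_continuous_within has_vector_derivative_continuous)
    show "continuous_on {0..1} \<phi>" unfolding \<phi>_def by (intro continuous_intros)
    fix s :: real assume t: "0 < s" "s < 1"
    then have "at s within {0..1} = at s" by (intro at_within_interior) auto
    then show "(G has_vector_derivative exp (of_real s * w) * z * h s) (at s)"
      using dG[of s] t by auto
    show "(\<phi> has_vector_derivative norm z * F * exp (s * x)) (at s)"
      unfolding \<phi>_def has_real_derivative_iff_has_vector_derivative[symmetric]
      using x0 by (auto intro!: derivative_eq_intros)
    have "norm (exp (of_real s * w) * z * h s) = exp (s * x) * norm z * norm (h s)"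
      by (simp add: norm_mult Rew)
    also have "\<dots> \<le> exp (s * x) * norm z * F"
      using h[of s] t by (intro mult_left_mono) auto
    finally show "norm (exp (of_real s * w) * z * h s) \<le> norm z * F * exp (s * x)" by (simp add: mult_ac)
  qed simp
  then have "norm (G 1) \<le> norm (G 0) + (\<phi> 1 - \<phi> 0)"
    using norm_triangle_ineq2[of "G 1" "G 0"] by linarith
  then have "exp x * norm (f 1) \<le> norm (f 0) + norm z * F / x * (exp x - 1)"
    by (simp add: G_def \<phi>_def norm_mult Rew algebra_simps diff_divide_distrib)
  then have "exp (-x) * (exp x * norm (f 1)) \<le> exp (-x) * (norm (f 0) + norm z * F / x * (exp x - 1))"
    by (intro mult_left_mono) auto
  also have "\<dots> = exp (-x) * norm (f 0) + norm z * F * ((exp (-x) * exp x - exp (-x)) / x)"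
    by (simp add: algebra_simps diff_divide_distrib)
  also have "exp (-x) * exp x = 1" by (simp flip: exp_add)
  also have "exp (-x) * (exp x * norm (f 1)) = norm (f 1)" by (simp flip: exp_add mult.assoc)
  finally show ?thesis by (simp add: x_def)
qed

text \<open>The quotient \<open>(1 - exp (- x)) / x\<close> is at most 1 and at most
  \<open>1 / x\<close>. With \<open>norm z \<le> 2 * Re z\<close> these give the two entries of the
  minimum: smallness in time for low modes, a gain of \<open>1 / l\<close> for high ones.\<close>

lemma duhamel_bound_min:
  fixes f h :: "real \<Rightarrow> complex" and z :: complex and l F :: real
  assumes der: "\<And>s. s \<in> {0..1} \<Longrightarrow> (f has_vector_derivative z * (h s - of_real l * f s)) (at s within {0..1})"
    and h: "\<And>s. s \<in> {0..1} \<Longrightarrow> norm (h s) \<le> F"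
    and l: "l > 0" and z: "norm z \<le> 2 * Re z" "z \<noteq> 0"
  shows "norm (f 1) \<le> norm (f 0) + min (norm z) (2 / l) * F"
proof -
  have R: "Re z > 0" using z zero_less_norm_iff[of z] by linarith
  define x where "x = l * Re z"
  have x: "x > 0" using l R by (simp add: x_def)
  have F: "F \<ge> 0" using h[of 0] norm_ge_zero[of "h 0"] by (simp del: norm_ge_zero)
  define q where "q = (1 - exp (- x)) / x"
  have q0: "q \<ge> 0" using x by (simp add: q_def)
  have q1: "q \<le> 1" using x exp_ge_add_one_self[of "-x"] by (simp add: q_def)
  have q2: "q \<le> 1 / x" using x by (simp add: q_def divide_right_mono)
  have "norm z * q \<le> norm z * 1" using q1 by (intro mult_left_mono) auto
  moreover have "norm z * q \<le> 2 / l"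
  proof -
    have "norm z * q \<le> (2 * Re z) * (1 / x)" using z q2 q0 R by (intro mult_mono) auto
    also have "\<dots> = 2 / l" using R l by (simp add: x_def)
    finally show ?thesis .
  qed
  ultimately have "norm z * q \<le> min (norm z) (2 / l)" by simp
  then have 1: "norm z * q * F \<le> min (norm z) (2 / l) * F" using F by (rule mult_right_mono)
  have 2: "exp (- x) * norm (f 0) \<le> 1 * norm (f 0)" using x by (intro mult_right_mono) auto
  have "norm (f 1) \<le> exp (- x) * norm (f 0) + norm z * F * q"
    using duhamel_bound[OF der h] x by (simp add: x_def q_def)
  then show ?thesis using 1 2 by (simp add: mult_ac)
qed

text \<open>Duhamel on \<open>{t - T..t}\<close> as \<open>T\<close> tends to infinity; boundedness
  in the past removes the initial value.\<close>

lemma bounded_solution_le: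
  fixes f h :: "real \<Rightarrow> complex"
  assumes der: "\<And>t. (f has_vector_derivative (h t - of_real l * f t)) (at t)"
    and h: "\<And>t. norm (h t) \<le> F" and M: "\<And>t. norm (f t) \<le> M" and l: "l > 0"
  shows "norm (f t) \<le> F / l"
proof -
  have F: "F \<ge> 0" using h[of 0] norm_ge_zero[of "h 0"] by (simp del: norm_ge_zero)
  have M0: "M \<ge> 0" using M[of 0] norm_ge_zero[of "f 0"] by (simp del: norm_ge_zero)
  have ev: "norm (f t) \<le> exp (- (l * T)) * M + F / l" if T: "T > 0" for T
  proof -
    define g where "g s = f (t - T + T * s)" for s
    have dg: "(g has_vector_derivative of_real T * (h (t - T + T * s) - of_real l * g s)) (at s within {0..1})" for s
    proof -
      have "((\<lambda>s. t - T + T * s) has_vector_derivative T) (at s within {0..1})"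
        unfolding has_real_derivative_iff_has_vector_derivative[symmetric] by (auto intro!: derivative_eq_intros)
      from vector_diff_chain_within[OF this has_vector_derivative_at_within[OF der]]
      show ?thesis by (simp add: g_def[abs_def] o_def scaleR_conv_of_real)
    qed
    have "norm (g 1) \<le> exp (- (l * Re (of_real T))) * norm (g 0) + norm (of_real T :: complex) * F * ((1 - exp (- (l * Re (of_real T)))) / (l * Re (of_real T)))"
      by (rule duhamel_bound[where h = "\<lambda>s. h (t - T + T * s)", OF dg h]) (use T l in simp)
    also have "\<dots> = exp (- (l * T)) * norm (g 0) + F * (1 - exp (- (l * T))) / l"
      using T by simp
    also have "\<dots> \<le> exp (- (l * T)) * M + F / l"
      using M F l by (intro add_mono mult_left_mono divide_right_mono) (auto simp: g_def mult_left_le)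
    finally show ?thesis by (simp add: g_def)
  qed
  have "((\<lambda>T. exp (- (l * T)) * M + F / l) \<longlongrightarrow> 0 * M + F / l) at_top"
  proof (intro tendsto_intros)
    have "filterlim (\<lambda>T. l * T) at_top at_top"
      by (rule filterlim_tendsto_pos_mult_at_top[OF tendsto_const l filterlim_ident])
    then show "((\<lambda>T. exp (- (l * T))) \<longlongrightarrow> 0) at_top"
      by (intro filterlim_compose[OF exp_at_bot] filterlim_compose[OF filterlim_uminus_at_bot_at_top])
  qed
  then show ?thesis
    by (intro tendsto_lowerbound[where f = "\<lambda>T. exp (- (l * T)) * M + F / l" and F = at_top])
       (auto intro!: eventually_mono[OF eventually_gt_at_top[of 0]] ev)
qed

text \<open>If \<open>y \<le> x\<close> then \<open>x \<ge> z / 2\<close>: the power 3/2 of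
  \<open>x\<close> is converted into decay in \<open>z\<close>, and the remaining 1/2 is passed to
  \<open>y\<close>. The constant 4 covers \<open>2 powr (3/2)\<close>.\<close>

lemma powr_product_le:
  fixes x y z :: real
  assumes "x > 0" "y > 0" "z > 0" "z \<le> x + y"
  shows "x powr -2 * y powr -2 \<le> 4 * z powr (-3/2) * (x powr (-5/2) + y powr (-5/2))"
proof -
  have *: "x powr -2 * y powr -2 \<le> 4 * z powr (-3/2) * y powr (-5/2)"
    if "x > 0" "y > 0" "z \<le> x + y" "y \<le> x" for x y
  proof -
    have "x powr -2 * y powr -2 = x powr (-3/2) * (x powr (-1/2) * y powr -2)"
      by (simp flip: powr_add mult.assoc)
    also have "\<dots> \<le> (z / 2) powr (-3/2) * (y powr (-1/2) * y powr -2)"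
      using that assms(3) by (intro mult_mono powr_mono2') auto
    also have "\<dots> = 2 powr (3/2) * z powr (-3/2) * y powr (-5/2)"
    proof -
      have "(z / 2) powr (-3/2) = z powr (-3/2) * 2 powr (3/2)"
        using assms(3) by (simp add: powr_divide powr_minus_divide)
      moreover have "y powr (-1/2) * y powr -2 = y powr (-5/2)" by (simp flip: powr_add)
      ultimately show ?thesis by simp
    qed
    also have "\<dots> \<le> 4 * z powr (-3/2) * y powr (-5/2)"
    proof (intro mult_right_mono)
      have "2 powr (3/2) \<le> (2::real) powr 2" by (intro powr_mono) auto
      then show "2 powr (3/2) \<le> (4::real)" by simp
    qed auto
    finally show ?thesis .
  qed
  have "0 \<le> 4 * z powr (-3/2) * y powr (-5/2)" "0 \<le> 4 * z powr (-3/2) * x powr (-5/2)" by simp_all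
  then show ?thesis
    using *[of x y] *[of y x] assms unfolding distrib_left mult.commute[of "x powr -2"] add.commute[of x]
    by (cases "y \<le> x") linarith+
qed

section \<open>From the enstrophy bound to pointwise decay\<close>

context nse
begin

definition W5 :: real where "W5 = (\<Sum>\<^sub>\<infinity>k. knorm k powr (-5/2))"
definition \<Gamma> :: real where "\<Gamma> = sqrt (l2sq \<gamma>)"

lemma gam_le: "norm (\<gamma> k) \<le> \<Gamma>"
  unfolding \<Gamma>_def using norm_le_l2sq[OF gam, of k] by (intro real_le_rsqrt)

lemma Gamma_nonneg: "\<Gamma> \<ge> 0" by (simp add: \<Gamma>_def)

lemma lam_pos: "k \<noteq> 0 \<Longrightarrow> lam k > 0"
  using mu knorm_pos[of k] by (simp add: lam_def)

lemma sol_derivative: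
  assumes "sol a"
  shows "((\<lambda>t. a t k) has_vector_derivative ((\<gamma> k - nl (a t) k) - of_real (lam k) * a t k)) (at t)"
  using coefficient_has_vector_derivative[of a "rhs (a t)" t k, OF sol_l2(1)[OF assms] sol_h2(4)[OF assms] sol_h2(5)[OF assms]]
  by (simp add: rhs_def algebra_simps)

lemma sol_coefficient_le:
  assumes a: "sol a" and k: "k \<noteq> 0" and F: "\<And>t. norm (nl (a t) k) \<le> F"
  shows "norm (a t k) \<le> (norm (\<gamma> k) + F) / lam k"
proof (rule bounded_solution_le[OF sol_derivative[OF a] _ _ lam_pos[OF k]])
  show "norm (\<gamma> k - nl (a t) k) \<le> norm (\<gamma> k) + F" for t
    using norm_triangle_ineq4[of "\<gamma> k" "nl (a t) k"] F[of t] by linarith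
  show "norm (a t k) \<le> sqrt M0" for t
    using norm_le_l2sq[OF sol_l2(1)[OF a, of t], of k] energy_bound[OF a, of t] by (intro real_le_rsqrt) linarith
qed

definition c0 :: real where "c0 = (\<Gamma> + \<kappa> * K1) / \<mu>"

lemma c0_nonneg: "c0 \<ge> 0"
  using mu kap M0_nonneg by (simp add: c0_def K1_def Q_def F1_def Gamma_nonneg)

text \<open>Cauchy-Schwarz on the convolution, with energy on one factor and enstrophy on the other,
  bounds the nonlinear term uniformly in \<open>k\<close>; dividing by \<open>lam k\<close> yields
  two powers.\<close>

lemma sol_bound_2:
  assumes a: "sol a"
  shows "norm (a t k) \<le> c0 * knorm k powr -2"
proof (cases "k = 0")
  case True
  then show ?thesis using sol_h2(1)[OF a] by (simp add: zero_prod_def)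
next
  case False
  have "norm (nl (a t) k) \<le> \<kappa> * K1" for t
  proof -
    have s: "(\<lambda>p. (norm (a t p))\<^sup>2) summable_on UNIV" "(\<lambda>p. (knorm (k - p) * norm (a t (k - p)))\<^sup>2) summable_on UNIV"
      using sol_l2(1)[OF a, of t] sol_h1[OF a, of t] summable_on_diff_left_iff[of "\<lambda>p. (knorm p * norm (a t p))\<^sup>2" k]
      by (auto simp: l2_def)
    have "norm (nl (a t) k) \<le> (\<Sum>\<^sub>\<infinity>p. \<kappa> * \<bar>norm (a t p) * (knorm (k - p) * norm (a t (k - p)))\<bar>)"
      unfolding bil_def
    proof (rule norm_summable_on_le(3)[OF summable_on_cmult_right[OF l2_mult_summable[OF s]]])
      fix p
      have "norm (bker \<kappa> p k * a t p * a t (k - p)) \<le> (\<kappa> * knorm (k - p)) * norm (a t p) * norm (a t (k - p))"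
        unfolding norm_mult using norm_bker_le(2)[of \<kappa> p k] kap by (intro mult_right_mono) auto
      then show "norm (bker \<kappa> p k * a t p * a t (k - p)) \<le> \<kappa> * \<bar>norm (a t p) * (knorm (k - p) * norm (a t (k - p)))\<bar>"
        by (simp add: mult_ac)
    qed
    also have "\<dots> = \<kappa> * (\<Sum>\<^sub>\<infinity>p. \<bar>norm (a t p) * (knorm (k - p) * norm (a t (k - p)))\<bar>)"
      by (rule infsum_cmult_right')
    also have "\<dots> \<le> \<kappa> * (sqrt (\<Sum>\<^sub>\<infinity>p. (norm (a t p))\<^sup>2) * sqrt (\<Sum>\<^sub>\<infinity>p. (knorm (k - p) * norm (a t (k - p)))\<^sup>2))"
      using kap by (intro mult_left_mono l2_Cauchy_Schwarz[OF s]) auto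
    also have "(\<Sum>\<^sub>\<infinity>p. (knorm (k - p) * norm (a t (k - p)))\<^sup>2) = b2 (a t)"
      unfolding b2_def by (rule infsum_diff_left)
    also have "(\<Sum>\<^sub>\<infinity>p. (norm (a t p))\<^sup>2) = l2sq (a t)" by (simp add: l2sq_def)
    also have "\<kappa> * (sqrt (l2sq (a t)) * sqrt (b2 (a t))) \<le> \<kappa> * (sqrt K1 * sqrt K1)"
      using kap sol_l2(2)[OF a, of t] enstrophy_bound[OF a, of t] l2sq_nonneg[of "a t"]
      by (intro mult_left_mono mult_mono real_sqrt_le_mono) (auto simp del: l2sq_nonneg)
    also have "sqrt K1 * sqrt K1 = K1"
      using enstrophy_bound[OF a, of t] infsum_nonneg[of UNIV "\<lambda>k. (knorm k * norm (a t k))\<^sup>2"] by (simp add: b2_def)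
    finally show ?thesis .
  qed
  then have "norm (a t k) \<le> (norm (\<gamma> k) + \<kappa> * K1) / lam k" by (rule sol_coefficient_le[OF a False])
  also have "\<dots> \<le> (\<Gamma> + \<kappa> * K1) / lam k"
    using gam_le[of k] lam_pos[OF False] by (intro divide_right_mono) auto
  also have "\<dots> = c0 * knorm k powr -2"
    using knorm_pos[OF False] by (simp add: c0_def lam_def powr_minus_divide)
  finally show ?thesis .
qed

text \<open>The power -2 just fails to be summable on the planar lattice, so the convolution does
  not inherit that rate by this route. Giving up half a power leaves the summable exponent
  -5/2.\<close>

lemma powr_convolution:
  "(\<lambda>p. knorm p powr -2 * knorm (k - p) powr -2) summable_on UNIV"
  "k \<noteq> 0 \<Longrightarrow> (\<Sum>\<^sub>\<infinity>p. knorm p powr -2 * knorm (k - p) powr -2) \<le> 8 * W5 * knorm k powr (-3/2)"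
proof -
  have "(\<lambda>p. (knorm (k - p) powr -2)\<^sup>2) summable_on UNIV"
    using summable_knorm_powr_sq summable_on_diff_left_iff[of "\<lambda>p. (knorm p powr -2)\<^sup>2" k] by simp
  from l2_mult_summable[OF summable_knorm_powr_sq this]
  show s: "(\<lambda>p. knorm p powr -2 * knorm (k - p) powr -2) summable_on UNIV" by simp
  assume k: "k \<noteq> 0"
  let ?c = "4 * knorm k powr (-3/2)"
  have s5: "(\<lambda>p. knorm (k - p) powr (-5/2)) summable_on UNIV"
    using summable_knorm_powr summable_on_diff_left_iff[of "\<lambda>p. knorm p powr (-5/2)" k] by simp
  note s6 = summable_on_add[OF summable_knorm_powr s5]
  have "(\<Sum>\<^sub>\<infinity>p. knorm p powr -2 * knorm (k - p) powr -2) \<le> (\<Sum>\<^sub>\<infinity>p. ?c * (knorm p powr (-5/2) + knorm (k - p) powr (-5/2)))"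
  proof (rule infsum_mono[OF s summable_on_cmult_right[OF s6]])
    fix p
    show "knorm p powr -2 * knorm (k - p) powr -2 \<le> ?c * (knorm p powr (-5/2) + knorm (k - p) powr (-5/2))"
    proof (cases "p = 0 \<or> k - p = 0")
      case False
      then have "knorm p > 0" "knorm (k - p) > 0" using knorm_pos by blast+
      then show ?thesis by (intro powr_product_le knorm_pos[OF k] knorm_triangle_diff)
    qed auto
  qed
  also have "\<dots> = ?c * (W5 + W5)"
    unfolding infsum_cmult_right' infsum_add[OF summable_knorm_powr s5] infsum_diff_left[of "\<lambda>p. knorm p powr (-5/2)"] W5_def ..
  finally show "(\<Sum>\<^sub>\<infinity>p. knorm p powr -2 * knorm (k - p) powr -2) \<le> 8 * W5 * knorm k powr (-3/2)" by (simp add: mult_ac)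
qed

text \<open>The decay that the equation enforces: \<open>norm (\<gamma> k) / |k|^2\<close> from the
  force and \<open>|k|^(-5/2)\<close> from the nonlinear term. In contrast to \<open>|k|^-2\<close>
  it is summable. Since \<open>0 powr x = 0\<close>, it vanishes at 0, which encodes zero
  mean.\<close>

definition w :: "idx \<Rightarrow> real" where
  "w k = (norm (\<gamma> k) + knorm k powr (-1/2)) * knorm k powr -2"

definition Kw :: real where "Kw = (1 + \<kappa> * c0\<^sup>2 * (8 * W5)) / \<mu>"

lemma w_nonneg: "w k \<ge> 0" by (simp add: w_def)

lemma W5_nonneg: "W5 \<ge> 0" by (simp add: W5_def infsum_nonneg)

lemma Kw_nonneg: "Kw \<ge> 0" using mu kap W5_nonneg by (simp add: Kw_def)

text \<open>One more turn of the bootstrap: the convolution of two bounds \<open>|k|^-2\<close>,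
  times the derivative \<open>|k|\<close>, leaves \<open>|k|^(-1/2)\<close>, and
  \<open>lam k\<close> supplies two further powers.\<close>

lemma sol_w_bound:
  assumes a: "sol a"
  shows "norm (a t k) \<le> Kw * w k"
proof (cases "k = 0")
  case True
  then show ?thesis using sol_h2(1)[OF a] by (simp add: zero_prod_def w_def)
next
  case False
  define C where "C = \<kappa> * c0\<^sup>2 * (8 * W5)"
  have "norm (nl (a t) k) \<le> C * knorm k powr (-1/2)" for t
  proof -
    have "norm (nl (a t) k) \<le> (\<Sum>\<^sub>\<infinity>p. (\<kappa> * knorm k * c0\<^sup>2) * (knorm p powr -2 * knorm (k - p) powr -2))"
      unfolding bil_def
    proof (rule norm_summable_on_le(3)[OF summable_on_cmult_right[OF powr_convolution(1)]])
      fix p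
      have "norm (bker \<kappa> p k * a t p * a t (k - p)) \<le> (\<kappa> * knorm k) * (c0 * knorm p powr -2) * (c0 * knorm (k - p) powr -2)"
        unfolding norm_mult using norm_bker_le(1)[of \<kappa> p k] kap c0_nonneg
        by (intro mult_mono sol_bound_2[OF a] mult_nonneg_nonneg) auto
      then show "norm (bker \<kappa> p k * a t p * a t (k - p)) \<le> (\<kappa> * knorm k * c0\<^sup>2) * (knorm p powr -2 * knorm (k - p) powr -2)"
        by (simp add: mult_ac power2_eq_square)
    qed
    also have "\<dots> = (\<kappa> * knorm k * c0\<^sup>2) * (\<Sum>\<^sub>\<infinity>p. knorm p powr -2 * knorm (k - p) powr -2)"
      by (rule infsum_cmult_right')
    also have "\<dots> \<le> (\<kappa> * knorm k * c0\<^sup>2) * (8 * W5 * knorm k powr (-3/2))"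
      using kap by (intro mult_left_mono powr_convolution(2)[OF False]) auto
    also have "\<dots> = C * (knorm k powr 1 * knorm k powr (-3/2))"
      using knorm_pos[OF False] by (simp add: C_def)
    also have "knorm k powr 1 * knorm k powr (-3/2) = knorm k powr (-1/2)"
      by (subst powr_add[symmetric]) simp
    finally show ?thesis .
  qed
  then have "norm (a t k) \<le> (norm (\<gamma> k) + C * knorm k powr (-1/2)) / lam k" by (rule sol_coefficient_le[OF a False])
  also have "\<dots> \<le> ((1 + C) * (norm (\<gamma> k) + knorm k powr (-1/2))) / lam k"
    using lam_pos[OF False] kap W5_nonneg by (intro divide_right_mono) (auto simp: C_def algebra_simps)
  also have "\<dots> = Kw * w k"
    using knorm_pos[OF False] by (simp add: Kw_def C_def w_def lam_def powr_minus_divide)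
  finally show ?thesis .
qed

end

section \<open>The weighted space\<close>

lemma holomorphic_uniform_limit_open:
  fixes f :: "'a \<Rightarrow> complex \<Rightarrow> complex"
  assumes D: "open D" and hol: "\<forall>\<^sub>F n in F. f n holomorphic_on D"
    and lim: "uniform_limit D f g F" and F: "F \<noteq> bot"
  shows "g holomorphic_on D"
proof -
  have "g field_differentiable at z" if z: "z \<in> D" for z
  proof -
    obtain r where r: "r > 0" "cball z r \<subseteq> D" using D z open_contains_cball by blast
    have 1: "\<forall>\<^sub>F n in F. continuous_on (cball z r) (f n) \<and> f n holomorphic_on ball z r"
      using hol by eventually_elim
        (meson r(2) ball_subset_cball holomorphic_on_imp_continuous_on holomorphic_on_subset order_trans)
    have "g holomorphic_on ball z r"
      using holomorphic_uniform_limit[OF 1 uniform_limit_on_subset[OF lim r(2)] F] by blast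
    then show ?thesis using r(1) by (simp add: holomorphic_on_imp_differentiable_at)
  qed
  then show ?thesis by (auto simp: holomorphic_on_def intro: field_differentiable_at_within)
qed

text \<open>For \<open>x\<close> beyond \<open>X\<close> the second entry of the minimum leaves
  \<open>2 / (\<mu> * sqrt x)\<close>, which is at most \<open>e\<close>. On the bounded range below
  \<open>X\<close> a small \<open>T\<close> suffices.\<close>

lemma small_time:
  fixes \<mu> e :: real
  assumes "\<mu> > 0" "e > 0"
  shows "\<exists>T>0. \<forall>x\<ge>1. min (2 * T) (2 / (\<mu> * x\<^sup>2)) * x powr (3/2) \<le> e"
proof -
  define X where "X = 1 + (2 / (\<mu> * e))\<^sup>2"
  have X: "X \<ge> 1" by (simp add: X_def)
  define T where "T = e / (2 * X powr (3/2))"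
  have T: "T > 0" using assms X by (simp add: T_def)
  have "min (2 * T) (2 / (\<mu> * x\<^sup>2)) * x powr (3/2) \<le> e" if x: "x \<ge> 1" for x
  proof (cases "x \<le> X")
    case True
    have "min (2 * T) (2 / (\<mu> * x\<^sup>2)) * x powr (3/2) \<le> (2 * T) * X powr (3/2)"
      using True x T by (intro mult_mono powr_mono2) auto
    also have "\<dots> = e" using X by (simp add: T_def)
    finally show ?thesis .
  next
    case False
    then have "(2 / (\<mu> * e))\<^sup>2 \<le> x" by (simp add: X_def)
    then have sq: "2 / (\<mu> * e) \<le> sqrt x" by (rule real_le_rsqrt)
    have "min (2 * T) (2 / (\<mu> * x\<^sup>2)) * x powr (3/2) \<le> (2 / (\<mu> * x\<^sup>2)) * x powr (3/2)"
      by (intro mult_right_mono) auto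
    also have "\<dots> = 2 / \<mu> / sqrt x"
    proof -
      have "x powr (3/2) = x powr (2 - 1/2)" by simp
      also have "\<dots> = x\<^sup>2 / sqrt x" using x by (subst powr_diff) (simp add: powr_half_sqrt)
      finally show ?thesis using x by simp
    qed
    also have "\<dots> \<le> e"
    proof -
      have "2 / \<mu> \<le> e * sqrt x" using sq assms by (simp add: field_simps)
      then show ?thesis using x by (subst pos_divide_le_eq) auto
    qed
    finally show ?thesis .
  qed
  then show ?thesis using T by blast
qed

section \<open>Convolution estimates in the weight and the time of existence\<close>

context nse
begin

lemma w_eq: "w k = norm (\<gamma> k) * knorm k powr -2 + knorm k powr (-5/2)"
  by (simp add: w_def distrib_right flip: powr_add)

lemma w_summable: "w summable_on UNIV"
proof -
  have "(\<lambda>k. \<bar>norm (\<gamma> k) * knorm k powr -2\<bar>) summable_on UNIV"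
    by (rule l2_mult_summable[OF _ summable_knorm_powr_sq]) (use gam in \<open>simp add: l2_def\<close>)
  then have "(\<lambda>k. norm (\<gamma> k) * knorm k powr -2 + knorm k powr (-5/2)) summable_on UNIV"
    by (intro summable_on_add summable_knorm_powr) simp
  then show ?thesis by (simp add: w_eq[abs_def])
qed

definition W :: real where "W = infsum w UNIV"

lemma W_nonneg: "W \<ge> 0" by (simp add: W_def infsum_nonneg w_nonneg)

lemma w_zero [simp]: "w 0 = 0" by (simp add: w_def)

lemma w_ge: "knorm k powr (-5/2) \<le> w k" "norm (\<gamma> k) * knorm k powr -2 \<le> w k"
  by (simp_all add: w_eq)

lemma w_le: "w k \<le> (\<Gamma> + 1) * knorm k powr -2"
proof (cases "k = 0")
  case False
  have "knorm k powr (-1/2) \<le> knorm k powr 0" using knorm_ge_1[OF False] by (intro powr_mono) auto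
  then show ?thesis unfolding w_def using gam_le[of k] False by (intro mult_right_mono add_mono) auto
qed simp

text \<open>One of \<open>p\<close> and \<open>k - p\<close> has norm at least
  \<open>knorm k / 2\<close>; that factor takes the pointwise decay and the other is summed. As
  \<open>v\<close> is summable, the rate \<open>s\<close> is kept without loss. It serves with
  \<open>s = 2\<close> for \<open>w\<close> and with growing \<open>s\<close> in
  \<open>decay\<close>.\<close>

lemma weight_convolution:
  assumes v: "v summable_on UNIV" "\<And>k. 0 \<le> v k" and s: "s \<ge> 0" and v2: "\<And>k. v k \<le> B * knorm k powr -s"
    and B: "B \<ge> 0" and k: "k \<noteq> 0"
  shows "(\<lambda>p. v p * v (k - p)) summable_on UNIV"
    "(\<Sum>\<^sub>\<infinity>p. v p * v (k - p)) \<le> 2 powr s * 2 * B * infsum v UNIV * knorm k powr -s"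
proof -
  let ?c = "2 powr s * B * knorm k powr -s"
  have v': "(\<lambda>p. v (k - p)) summable_on UNIV" using v(1) by (simp add: summable_on_diff_left_iff)
  have pt: "v p * v (k - p) \<le> ?c * (v p + v (k - p))" for p
  proof -
    have *: "v p \<le> ?c" if "knorm k \<le> 2 * knorm p" for p
    proof -
      have "v p \<le> B * knorm p powr -s" by (rule v2)
      also have "\<dots> \<le> B * (knorm k / 2) powr -s"
        using that s B knorm_pos[OF k] by (intro mult_left_mono powr_mono2') auto
      also have "\<dots> = ?c" using knorm_pos[OF k] by (simp add: powr_divide powr_minus_divide)
      finally show ?thesis .
    qed
    have c: "?c \<ge> 0" using B by simp
    have "knorm k \<le> 2 * knorm p \<or> knorm k \<le> 2 * knorm (k - p)"
      using knorm_triangle_diff[of k p] by linarith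
    then show ?thesis
    proof
      assume "knorm k \<le> 2 * knorm p"
      then have "v p * v (k - p) \<le> ?c * v (k - p)" using v(2) by (intro mult_right_mono *) auto
      also have "\<dots> \<le> ?c * (v p + v (k - p))" using v(2)[of p] c by (intro mult_left_mono) auto
      finally show ?thesis .
    next
      assume "knorm k \<le> 2 * knorm (k - p)"
      then have "v p * v (k - p) \<le> v p * ?c" using v(2) by (intro mult_left_mono *) auto
      also have "\<dots> = ?c * v p" by (rule mult.commute)
      also have "\<dots> \<le> ?c * (v p + v (k - p))" using v(2)[of "k - p"] c by (intro mult_left_mono) auto
      finally show ?thesis .
    qed
  qed
  note s2 = summable_on_cmult_right[OF summable_on_add[OF v(1) v'], of ?c]
  show s1: "(\<lambda>p. v p * v (k - p)) summable_on UNIV"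
    by (rule summable_on_le[OF s2 _ pt]) (use v(2) in auto)
  have "(\<Sum>\<^sub>\<infinity>p. v p * v (k - p)) \<le> (\<Sum>\<^sub>\<infinity>p. ?c * (v p + v (k - p)))"
    by (rule infsum_mono[OF s1 s2 pt])
  also have "\<dots> = ?c * (infsum v UNIV + infsum v UNIV)"
    unfolding infsum_cmult_right' infsum_add[OF v(1) v'] infsum_diff_left ..
  finally show "(\<Sum>\<^sub>\<infinity>p. v p * v (k - p)) \<le> 2 powr s * 2 * B * infsum v UNIV * knorm k powr -s"
    by (simp add: mult_ac)
qed

definition Cb :: real where "Cb = \<kappa> * (8 * (\<Gamma> + 1) * W)"

lemma Cb_nonneg: "Cb \<ge> 0" using kap W_nonneg Gamma_nonneg by (simp add: Cb_def)

lemma w_convolution: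
  assumes "k \<noteq> 0"
  shows "(\<lambda>p. w p * w (k - p)) summable_on UNIV"
    "\<kappa> * knorm k * (\<Sum>\<^sub>\<infinity>p. w p * w (k - p)) \<le> Cb * knorm k powr -1"
proof -
  note C = weight_convolution[OF w_summable w_nonneg _ w_le _ assms]
  show "(\<lambda>p. w p * w (k - p)) summable_on UNIV" by (rule C(1)) (use Gamma_nonneg in auto)
  have "(\<Sum>\<^sub>\<infinity>p. w p * w (k - p)) \<le> 2 powr 2 * 2 * (\<Gamma> + 1) * infsum w UNIV * knorm k powr -2"
    by (rule C(2)) (use Gamma_nonneg in auto)
  then have "\<kappa> * knorm k * (\<Sum>\<^sub>\<infinity>p. w p * w (k - p)) \<le> \<kappa> * knorm k * (8 * (\<Gamma> + 1) * W * knorm k powr -2)"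
    using kap by (intro mult_left_mono) (auto simp: W_def)
  also have "\<dots> = Cb * (knorm k powr 1 * knorm k powr -2)" using knorm_pos[OF assms] by (simp add: Cb_def)
  also have "knorm k powr 1 * knorm k powr -2 = knorm k powr -1" by (subst powr_add[symmetric]) simp
  finally show "\<kappa> * knorm k * (\<Sum>\<^sub>\<infinity>p. w p * w (k - p)) \<le> Cb * knorm k powr -1" .
qed

lemma bil_term_le:
  assumes "\<And>k. norm (a k) \<le> A * w k" "\<And>k. norm (c k) \<le> B * w k" "A \<ge> 0" "B \<ge> 0"
  shows "norm (bker \<kappa> p k * a p * c (k - p)) \<le> (\<kappa> * knorm k * A * B) * (w p * w (k - p))"
proof -
  have "norm (bker \<kappa> p k * a p * c (k - p)) \<le> (\<kappa> * knorm k) * (A * w p) * (B * w (k - p))"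
    unfolding norm_mult using norm_bker_le(1)[of \<kappa> p k] kap assms(3,4) w_nonneg
    by (intro mult_mono assms mult_nonneg_nonneg) auto
  then show ?thesis by (simp add: mult_ac)
qed

lemma bil_w:
  assumes "\<And>k. norm (a k) \<le> A * w k" "\<And>k. norm (c k) \<le> B * w k" "A \<ge> 0" "B \<ge> 0" and k: "k \<noteq> 0"
  shows "(\<lambda>p. bker \<kappa> p k * a p * c (k - p)) summable_on UNIV"
    "norm (bil \<kappa> a c k) \<le> A * B * (Cb * knorm k powr -1)"
proof -
  note N = norm_summable_on_le[OF summable_on_cmult_right[OF w_convolution(1)[OF k]] bil_term_le[OF assms(1-4)]]
  show "(\<lambda>p. bker \<kappa> p k * a p * c (k - p)) summable_on UNIV" by (rule N(1))
  have "norm (bil \<kappa> a c k) \<le> (\<kappa> * knorm k * A * B) * (\<Sum>\<^sub>\<infinity>p. w p * w (k - p))"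
    unfolding bil_def using N(3) by (simp only: infsum_cmult_right')
  also have "\<dots> = A * B * (\<kappa> * knorm k * (\<Sum>\<^sub>\<infinity>p. w p * w (k - p)))" by (simp add: mult_ac)
  also have "\<dots> \<le> A * B * (Cb * knorm k powr -1)"
    using assms(3,4) by (intro mult_left_mono w_convolution(2)[OF k]) auto
  finally show "norm (bil \<kappa> a c k) \<le> A * B * (Cb * knorm k powr -1)" .
qed

lemma bil_diff_le:
  assumes a: "\<And>k. norm (a k) \<le> A * w k" and c: "\<And>k. norm (c k) \<le> A * w k"
    and d: "\<And>k. norm (a k - c k) \<le> d * w k" and "A \<ge> 0" "d \<ge> 0" and k: "k \<noteq> 0"
  shows "norm (nl a k - nl c k) \<le> 2 * A * d * (Cb * knorm k powr -1)"
proof -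
  let ?e = "\<lambda>k. a k - c k"
  note 1 = bil_w[OF a d \<open>A \<ge> 0\<close> \<open>d \<ge> 0\<close> k] and 2 = bil_w[OF d c \<open>d \<ge> 0\<close> \<open>A \<ge> 0\<close> k]
  note 3 = bil_w(1)[OF a a \<open>A \<ge> 0\<close> \<open>A \<ge> 0\<close> k] and 4 = bil_w(1)[OF c c \<open>A \<ge> 0\<close> \<open>A \<ge> 0\<close> k]
  have "nl a k = (\<Sum>\<^sub>\<infinity>p. bker \<kappa> p k * c p * c (k - p) + (bker \<kappa> p k * a p * ?e (k - p) + bker \<kappa> p k * ?e p * c (k - p)))"
    unfolding bil_def by (rule infsum_cong) (simp add: algebra_simps)
  also have "\<dots> = nl c k + (bil \<kappa> a ?e k + bil \<kappa> ?e c k)"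
    unfolding bil_def infsum_add[OF 4 summable_on_add[OF 1(1) 2(1)]] infsum_add[OF 1(1) 2(1)] ..
  finally have "norm (nl a k - nl c k) \<le> norm (bil \<kappa> a ?e k) + norm (bil \<kappa> ?e c k)"
    by (simp add: norm_triangle_ineq)
  also have "\<dots> \<le> A * d * (Cb * knorm k powr -1) + d * A * (Cb * knorm k powr -1)"
    by (intro add_mono 1(2) 2(2))
  finally show ?thesis by (simp only: mult.commute[of d A] mult_2 distrib_right)
qed

text \<open>The Weierstrass test with a majorant independent of \<open>z\<close>; continuity and
  holomorphy of the nonlinear term are then inherited from single coefficients.\<close>

lemma bil_uniform_limit:
  assumes U: "\<And>z k. z \<in> S \<Longrightarrow> norm (U z k) \<le> A * w k" and "A \<ge> 0" and k: "k \<noteq> 0"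
  shows "uniform_limit S (\<lambda>X z. \<Sum>p\<in>X. bker \<kappa> p k * U z p * U z (k - p)) (\<lambda>z. nl (U z) k) (finite_subsets_at_top UNIV)"
  unfolding bil_def
proof (rule Weierstrass_m_test_general[OF _ summable_on_cmult_right[OF w_convolution(1)[OF k], of "\<kappa> * knorm k * A * A"]])
  fix p z assume "z \<in> S"
  then show "norm (bker \<kappa> p k * U z p * U z (k - p)) \<le> \<kappa> * knorm k * A * A * (w p * w (k - p))"
    by (intro bil_term_le U \<open>A \<ge> 0\<close>)
qed

lemma bil_continuous:
  assumes U: "\<And>z k. z \<in> S \<Longrightarrow> norm (U z k) \<le> A * w k" and "A \<ge> 0" and k: "k \<noteq> 0"
    and "\<And>k. continuous_on S (\<lambda>z. U z k)"
  shows "continuous_on S (\<lambda>z. nl (U z) k)"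
  by (rule uniform_limit_theorem[OF _ bil_uniform_limit[where U = U and A = A, OF U \<open>A \<ge> 0\<close> k]])
     (auto intro!: always_eventually continuous_intros assms)

lemma bil_holomorphic:
  assumes U: "\<And>z k. z \<in> S \<Longrightarrow> norm (U z k) \<le> A * w k" and "A \<ge> 0" and k: "k \<noteq> 0"
    and "\<And>k. (\<lambda>z. U z k) holomorphic_on S" and S: "open S"
  shows "(\<lambda>z. nl (U z) k) holomorphic_on S"
  by (rule holomorphic_uniform_limit_open[OF S _ bil_uniform_limit[where U = U and A = A, OF U \<open>A \<ge> 0\<close> k]])
     (auto intro!: always_eventually holomorphic_intros assms)

text \<open>Radius of the ball for the iteration: \<open>Kw\<close> for the initial value,
  \<open>2 / \<mu>\<close> for the force, 1 for the nonlinear term.\<close>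

definition K' :: real where "K' = Kw + 2 / \<mu> + 1"

lemma K'_pos: "K' > 0" using Kw_nonneg mu by (simp add: K'_def add_nonneg_pos)

lemma Kw_le_K': "Kw \<le> K'" using mu by (simp add: K'_def)

text \<open>One condition with two uses: the summand \<open>K'^2\<close> keeps the iterates in the
  ball, and \<open>2 * K'\<close> makes the step a contraction with factor 1/2. Only
  \<open>\<kappa>\<close>, \<open>\<nu>\<close> and \<open>\<gamma>\<close> enter, no particular
  solution.\<close>

definition time_ok :: "real \<Rightarrow> bool" where
  "time_ok T \<longleftrightarrow> T > 0 \<and> (\<forall>k. k \<noteq> 0 \<longrightarrow>
     min (2 * T) (2 / lam k) * ((2 * K' + K'\<^sup>2) * (Cb * knorm k powr -1)) \<le> (1/2) * w k)"

lemma time_ok_exists: "\<exists>T. time_ok T"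
proof -
  define P where "P = (2 * K' + K'\<^sup>2) * Cb + 1"
  have P: "P > 0" using K'_pos Cb_nonneg by (auto simp: P_def intro!: add_nonneg_pos)
  obtain T where T: "T > 0" "\<And>x. x \<ge> 1 \<Longrightarrow> min (2 * T) (2 / (\<mu> * x\<^sup>2)) * x powr (3/2) \<le> 1 / (2 * P)"
    using small_time[OF mu, of "1 / (2 * P)"] P by auto
  have "min (2 * T) (2 / lam k) * ((2 * K' + K'\<^sup>2) * (Cb * knorm k powr -1)) \<le> (1/2) * w k" if k: "k \<noteq> 0" for k
  proof -
    let ?m = "min (2 * T) (2 / lam k)"
    have m: "?m \<ge> 0" using T(1) lam_pos[OF k] by simp
    have "?m * ((2 * K' + K'\<^sup>2) * (Cb * knorm k powr -1)) \<le> ?m * (P * knorm k powr -1)"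
      using m by (intro mult_left_mono) (auto simp: P_def algebra_simps)
    also have "\<dots> = ?m * (P * (knorm k powr (3/2) * knorm k powr (-5/2)))" by (simp flip: powr_add)
    also have "\<dots> = (?m * knorm k powr (3/2)) * (P * knorm k powr (-5/2))"
      by (simp add: mult_ac)
    also have "\<dots> \<le> 1 / (2 * P) * (P * knorm k powr (-5/2))"
      using T(2)[OF knorm_ge_1[OF k]] P by (intro mult_right_mono) (auto simp: lam_def)
    also have "\<dots> = (1/2) * knorm k powr (-5/2)" using P by simp
    also have "\<dots> \<le> (1/2) * w k" using w_ge(1)[of k] by simp
    finally show ?thesis .
  qed
  then show ?thesis using T(1) unfolding time_ok_def by blast
qed

end

section \<open>Local solutions in complex time\<close>

text \<open>A triangle with apex 0 and half-angle 45 degrees about the real axis, so that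
  \<open>norm z \<le> 2 * Re z\<close>. Convexity provides primitives and the rays from the
  apex.\<close>

definition sector :: "real \<Rightarrow> complex set" where
  "sector T = {z. \<bar>Im z\<bar> \<le> Re z \<and> Re z \<le> T}"

lemma convex_sector: "convex (sector T)"
proof (rule convexI)
  fix x y :: complex and u v :: real
  assume xy: "x \<in> sector T" "y \<in> sector T" and uv: "0 \<le> u" "0 \<le> v" "u + v = 1"
  have "\<bar>u * Im x + v * Im y\<bar> \<le> u * \<bar>Im x\<bar> + v * \<bar>Im y\<bar>"
    using uv abs_triangle_ineq[of "u * Im x" "v * Im y"] by (simp add: abs_mult)
  also have "\<dots> \<le> u * Re x + v * Re y"
    using xy uv by (intro add_mono mult_left_mono) (auto simp: sector_def)
  finally have 1: "\<bar>u * Im x + v * Im y\<bar> \<le> u * Re x + v * Re y" .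
  have "u * Re x + v * Re y \<le> u * T + v * T"
    using xy uv by (intro add_mono mult_left_mono) (auto simp: sector_def)
  also have "\<dots> = T" using uv by (simp flip: distrib_right)
  finally show "u *\<^sub>R x + v *\<^sub>R y \<in> sector T" using 1 by (simp add: sector_def)
qed

lemma sector_ray:
  assumes "z \<in> sector T" "s \<in> {0..1}"
  shows "of_real s * z \<in> sector T"
proof -
  have "0 \<in> sector T" using assms(1) by (auto simp: sector_def)
  from convexD[OF convex_sector assms(1) this, of s "1 - s"] assms(2)
  show ?thesis by (simp add: scaleR_conv_of_real)
qed

lemma sector_norm:
  assumes "z \<in> sector T"
  shows "norm z \<le> 2 * Re z" "norm z \<le> 2 * T"
  using assms cmod_le[of z] by (auto simp: sector_def)

lemma sector_interior: "{z. \<bar>Im z\<bar> < Re z \<and> Re z < T} \<subseteq> interior (sector T)"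
proof (rule interior_maximal)
  have "{z. \<bar>Im z\<bar> < Re z \<and> Re z < T} = {z. \<bar>Im z\<bar> < Re z} \<inter> {z. Re z < T}" by auto
  then show "open {z. \<bar>Im z\<bar> < Re z \<and> Re z < T}"
    by (auto intro!: open_Int open_Collect_less continuous_intros)
qed (auto simp: sector_def)

section \<open>Picard iteration on a sector\<close>

context nse
begin

text \<open>The apex is a boundary point and carries the initial value, hence the continuity up to
  the boundary.\<close>

definition good :: "real \<Rightarrow> (complex \<Rightarrow> idx \<Rightarrow> complex) \<Rightarrow> bool" where
  "good T U \<longleftrightarrow> (\<forall>z\<in>sector T. \<forall>k. norm (U z k) \<le> K' * w k) \<and>
     (\<forall>k. continuous_on (sector T) (\<lambda>z. U z k)) \<and> (\<forall>k. (\<lambda>z. U z k) holomorphic_on interior (sector T))"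

lemma goodD:
  assumes "good T U"
  shows "z \<in> sector T \<Longrightarrow> norm (U z k) \<le> K' * w k" "continuous_on (sector T) (\<lambda>z. U z k)"
    "(\<lambda>z. U z k) holomorphic_on interior (sector T)"
  using assms unfolding good_def by blast+

lemma time_okD:
  assumes "time_ok T"
  shows "T > 0" "k \<noteq> 0 \<Longrightarrow> min (2 * T) (2 / lam k) * ((2 * K' + K'\<^sup>2) * (Cb * knorm k powr -1)) \<le> (1/2) * w k"
  using assms unfolding time_ok_def by blast+

text \<open>One Picard step: the linear part is solved exactly while the nonlinear term is frozen at
  \<open>U\<close>. Derivatives are taken within the closed sector so that rays can start at the
  apex.\<close>

definition step_rel :: "real \<Rightarrow> (idx \<Rightarrow> complex) \<Rightarrow> (complex \<Rightarrow> idx \<Rightarrow> complex) \<Rightarrow> (complex \<Rightarrow> idx \<Rightarrow> complex) \<Rightarrow> bool" where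
  "step_rel T a0 U V \<longleftrightarrow> good T V \<and> V 0 = a0 \<and>
     (\<forall>k. k \<noteq> 0 \<longrightarrow> (\<forall>z\<in>sector T. ((\<lambda>z. V z k) has_field_derivative
        (\<gamma> k - nl (U z) k) - of_real (lam k) * V z k) (at z within sector T)))"

lemma ray_derivative:
  assumes "\<And>z. z \<in> sector T \<Longrightarrow> (f has_field_derivative h z - of_real l * f z) (at z within sector T)"
    and z: "z \<in> sector T" and s: "s \<in> {0..1}"
  shows "((\<lambda>s. f (of_real s * z)) has_vector_derivative z * (h (of_real s * z) - of_real l * f (of_real s * z))) (at s within {0..1})"
proof -
  let ?g = "\<lambda>s::real. of_real s * z"
  have "(?g has_vector_derivative z) (at s within {0..1})"
    by (rule has_vector_derivative_real_field) (auto intro!: derivative_eq_intros)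
  moreover have "?g ` {0..1} \<subseteq> sector T" using sector_ray[OF z] by auto
  then have "(f has_field_derivative h (?g s) - of_real l * f (?g s)) (at (?g s) within ?g ` {0..1})"
    using has_field_derivative_subset[OF assms(1)[OF sector_ray[OF z s]]] by blast
  ultimately have "((f \<circ> ?g) has_vector_derivative z * (h (?g s) - of_real l * f (?g s))) (at s within {0..1})"
    by (rule field_vector_diff_chain_within)
  then show ?thesis by (simp add: o_def)
qed

lemma increment_le:
  fixes f h :: "real \<Rightarrow> complex"
  assumes T: "T > 0" and k: "k \<noteq> 0" and z: "z \<in> sector T"
    and der: "\<And>s. s \<in> {0..1} \<Longrightarrow> (f has_vector_derivative z * (h s - of_real (lam k) * f s)) (at s within {0..1})"
    and h: "\<And>s. s \<in> {0..1} \<Longrightarrow> norm (h s) \<le> F"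
  shows "norm (f 1) \<le> norm (f 0) + min (2 * T) (2 / lam k) * F"
proof (cases "z = 0")
  case True
  have "F \<ge> 0" using h[of 0] norm_ge_zero[of "h 0"] by (simp del: norm_ge_zero)
  have "f 1 = f 0"
    using has_vector_derivative_zero_constant[of "{0..1}" f] der True by force
  then show ?thesis using T lam_pos[OF k] \<open>F \<ge> 0\<close> by (simp add: min_def)
next
  case False
  have F: "F \<ge> 0" using h[of 0] norm_ge_zero[of "h 0"] by (simp del: norm_ge_zero)
  have "norm (f 1) \<le> norm (f 0) + min (norm z) (2 / lam k) * F"
    by (rule duhamel_bound_min[OF der h lam_pos[OF k] sector_norm(1)[OF z] False])
  also have "\<dots> \<le> norm (f 0) + min (2 * T) (2 / lam k) * F"
    using sector_norm(2)[OF z] F by (intro add_left_mono mult_right_mono) auto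
  finally show ?thesis .
qed

text \<open>Duhamel for the difference of two solutions with a common initial value, in which the
  force cancels; \<open>time_ok\<close> turns the Lipschitz constant into 1/2.\<close>

lemma difference_le:
  fixes f1 f2 B1 B2 :: "real \<Rightarrow> complex"
  assumes T: "time_ok T" and k: "k \<noteq> 0" and z: "z \<in> sector T"
    and f1: "\<And>s. s \<in> {0..1} \<Longrightarrow> (f1 has_vector_derivative z * ((\<gamma> k - B1 s) - of_real (lam k) * f1 s)) (at s within {0..1})"
    and f2: "\<And>s. s \<in> {0..1} \<Longrightarrow> (f2 has_vector_derivative z * ((\<gamma> k - B2 s) - of_real (lam k) * f2 s)) (at s within {0..1})"
    and eq: "f1 0 = f2 0"
    and B: "\<And>s. s \<in> {0..1} \<Longrightarrow> norm (B1 s - B2 s) \<le> 2 * K' * d * (Cb * knorm k powr -1)" and d: "d \<ge> 0"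
  shows "norm (f1 1 - f2 1) \<le> d / 2 * w k"
proof -
  have T0: "T > 0" using T by (simp add: time_ok_def)
  let ?m = "min (2 * T) (2 / lam k)"
  let ?c = "Cb * knorm k powr -1"
  have m: "?m \<ge> 0" using T0 lam_pos[OF k] by simp
  have "norm (f1 1 - f2 1) \<le> norm (f1 0 - f2 0) + ?m * (2 * K' * d * ?c)"
  proof (rule increment_le[where f = "\<lambda>s. f1 s - f2 s" and h = "\<lambda>s. B2 s - B1 s", OF T0 k z])
    fix s :: real assume t: "s \<in> {0..1}"
    show "((\<lambda>s. f1 s - f2 s) has_vector_derivative z * (B2 s - B1 s - of_real (lam k) * (f1 s - f2 s))) (at s within {0..1})"
      using has_vector_derivative_diff[OF f1[OF t] f2[OF t]] by (simp add: algebra_simps)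
    show "norm (B2 s - B1 s) \<le> 2 * K' * d * ?c" using B[OF t] by (simp add: norm_minus_commute)
  qed
  also have "\<dots> = d * (?m * ((2 * K') * ?c))" using eq by (simp only: diff_self norm_zero) (simp add: mult_ac)
  also have "\<dots> \<le> d * (?m * ((2 * K' + K'\<^sup>2) * ?c))"
    using d m Cb_nonneg by (intro mult_left_mono mult_right_mono) auto
  also have "\<dots> \<le> d * ((1/2) * w k)" using d by (intro mult_left_mono time_okD(2)[OF T k])
  finally show ?thesis by simp
qed

text \<open>After multiplication by \<open>exp (lam k * z)\<close> the step asks for a primitive of
  a function continuous on the sector and holomorphic inside; convexity provides one up to the
  boundary. The ball is preserved by Duhamel's bound along rays.\<close>

lemma step_exists:
  assumes T: "time_ok T" and a0: "\<And>k. norm (a0 k) \<le> Kw * w k" and U: "good T U"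
  shows "\<exists>V. step_rel T a0 U V"
proof -
  have T0: "T > 0" using T by (simp add: time_ok_def)
  let ?S = "sector T"
  define f where "f k z = exp (of_real (lam k) * z) * (\<gamma> k - nl (U z) k)" for k z
  have Ub: "norm (U z k) \<le> K' * w k" if "z \<in> ?S" for z k using goodD(1)[OF U that] .
  have "\<exists>g. \<forall>z\<in>?S. (g has_field_derivative f k z) (at z within ?S)" if k: "k \<noteq> 0" for k
  proof -
    have "continuous_on ?S (\<lambda>z. nl (U z) k)"
      by (rule bil_continuous[where A = K']) (use K'_pos k Ub goodD(2)[OF U] in auto)
    then have c: "continuous_on ?S (f k)" unfolding f_def by (intro continuous_intros)
    have "(\<lambda>z. nl (U z) k) holomorphic_on interior ?S"
      by (rule bil_holomorphic[where A = K']) (use K'_pos k Ub interior_subset[of ?S] goodD(3)[OF U] in auto)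
    then have "f k holomorphic_on interior ?S" unfolding f_def by (intro holomorphic_intros)
    then have "f k field_differentiable at z" if "z \<in> interior ?S" for z
      using that by (auto intro: holomorphic_on_imp_differentiable_at)
    then obtain g where "\<And>z. z \<in> ?S \<Longrightarrow> (g has_field_derivative f k z) (at z within ?S)"
      using holomorphic_convex_primitive[OF convex_sector finite.emptyI c] by auto
    then show ?thesis by blast
  qed
  then obtain g where g: "\<And>k z. k \<noteq> 0 \<Longrightarrow> z \<in> ?S \<Longrightarrow> (g k has_field_derivative f k z) (at z within ?S)"
    by metis
  define V where "V z k = (if k = 0 then 0 else exp (- (of_real (lam k) * z)) * (a0 k + g k z - g k 0))" for z k
  have V0: "V 0 = a0" using a0[of 0] by (auto simp: V_def fun_eq_iff)
  have der: "((\<lambda>z. V z k) has_field_derivative (\<gamma> k - nl (U z) k) - of_real (lam k) * V z k) (at z within ?S)"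
    if k: "k \<noteq> 0" and z: "z \<in> ?S" for k z
  proof -
    have "((\<lambda>z. exp (- (of_real (lam k) * z)) * (a0 k + g k z - g k 0)) has_field_derivative
        exp (- (of_real (lam k) * z)) * f k z - of_real (lam k) * (exp (- (of_real (lam k) * z)) * (a0 k + g k z - g k 0))) (at z within ?S)"
      by (auto intro!: derivative_eq_intros g k z simp: algebra_simps)
    moreover have "exp (- (of_real (lam k) * z)) * f k z = \<gamma> k - nl (U z) k"
      by (simp add: f_def exp_minus flip: mult.assoc)
    ultimately show ?thesis using k by (simp add: V_def)
  qed
  have bound: "norm (V z k) \<le> K' * w k" if z: "z \<in> ?S" for z k
  proof (cases "k = 0")
    case False
    let ?m = "min (2 * T) (2 / lam k)"
    let ?c = "Cb * knorm k powr -1"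
    have m: "?m \<ge> 0" using T0 lam_pos[OF False] by simp
    have "norm (V (of_real 1 * z) k) \<le> norm (V (of_real 0 * z) k) + ?m * (norm (\<gamma> k) + K'\<^sup>2 * ?c)"
    proof (rule increment_le[where f = "\<lambda>s. V (of_real s * z) k" and h = "\<lambda>s. \<gamma> k - nl (U (of_real s * z)) k", OF T0 False z])
      fix s :: real assume t: "s \<in> {0..1}"
      show "((\<lambda>s. V (of_real s * z) k) has_vector_derivative z * (\<gamma> k - nl (U (of_real s * z)) k - of_real (lam k) * V (of_real s * z) k)) (at s within {0..1})"
        by (rule ray_derivative[where f = "\<lambda>z. V z k" and h = "\<lambda>z. \<gamma> k - nl (U z) k", OF der[OF False] z t])
      have "norm (nl (U (of_real s * z)) k) \<le> K' * K' * ?c"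
        by (rule bil_w(2)) (use Ub[OF sector_ray[OF z t]] K'_pos False in auto)
      then show "norm (\<gamma> k - nl (U (of_real s * z)) k) \<le> norm (\<gamma> k) + K'\<^sup>2 * ?c"
        using norm_triangle_ineq4[of "\<gamma> k" "nl (U (of_real s * z)) k"] unfolding power2_eq_square by linarith
    qed
    also have "norm (V (of_real 0 * z) k) \<le> Kw * w k" using V0 a0 by simp
    also have "?m * (norm (\<gamma> k) + K'\<^sup>2 * ?c) \<le> (2 / \<mu>) * w k + 1 * w k"
      unfolding distrib_left
    proof (rule add_mono)
      have "?m * norm (\<gamma> k) \<le> (2 / lam k) * norm (\<gamma> k)" by (intro mult_right_mono) auto
      also have "\<dots> = (2 / \<mu>) * (norm (\<gamma> k) * knorm k powr -2)"
        using knorm_pos[OF False] by (simp add: lam_def powr_minus_divide)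
      also have "\<dots> \<le> (2 / \<mu>) * w k" using mu w_ge(2) by (intro mult_left_mono) auto
      finally show "?m * norm (\<gamma> k) \<le> (2 / \<mu>) * w k" .
      have "?m * (K'\<^sup>2 * ?c) \<le> ?m * ((2 * K' + K'\<^sup>2) * ?c)"
        using m K'_pos Cb_nonneg by (intro mult_left_mono mult_right_mono) auto
      also have "\<dots> \<le> (1/2) * w k" by (rule time_okD(2)[OF T False])
      also have "\<dots> \<le> 1 * w k" using w_nonneg[of k] by simp
      finally show "?m * (K'\<^sup>2 * ?c) \<le> 1 * w k" .
    qed
    finally show ?thesis by (simp add: K'_def algebra_simps)
  qed (simp add: V_def)
  have cont: "continuous_on ?S (\<lambda>z. V z k)" for k
  proof (cases "k = 0")
    case False
    show ?thesis by (rule DERIV_continuous_on) (use der[OF False] in blast)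
  qed (simp add: V_def)
  have hol: "(\<lambda>z. V z k) holomorphic_on interior ?S" for k
  proof (cases "k = 0")
    case False
    have "(\<lambda>z. V z k) holomorphic_on ?S"
      using der[OF False] by (auto simp: holomorphic_on_def field_differentiable_def)
    then show ?thesis using holomorphic_on_subset interior_subset by blast
  qed (simp add: V_def)
  have "step_rel T a0 U V"
    unfolding step_rel_def good_def using bound cont hol V0 der by blast
  then show ?thesis by blast
qed

text \<open>The zero start lies in the ball for every \<open>a0\<close>; from index 1 on, the
  iterates take the value \<open>a0\<close> at the apex. \<open>picard_good\<close> resolves the
  choice operator.\<close>

primrec picard :: "real \<Rightarrow> (idx \<Rightarrow> complex) \<Rightarrow> nat \<Rightarrow> complex \<Rightarrow> idx \<Rightarrow> complex" where
  "picard T a0 0 = (\<lambda>z k. 0)"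
| "picard T a0 (Suc n) = (SOME V. step_rel T a0 (picard T a0 n) V)"

lemma picard_good:
  assumes T: "time_ok T" and a0: "\<And>k. norm (a0 k) \<le> Kw * w k"
  shows "good T (picard T a0 n)" "step_rel T a0 (picard T a0 n) (picard T a0 (Suc n))"
proof -
  have "good T (picard T a0 n) \<and> step_rel T a0 (picard T a0 n) (picard T a0 (Suc n))" for n
  proof (induction n)
    case 0
    have g: "good T (picard T a0 0)" using K'_pos w_nonneg by (simp add: good_def)
    show ?case using g someI_ex[OF step_exists[OF T a0 g]] by simp
  next
    case (Suc n)
    then have g: "good T (picard T a0 (Suc n))" by (simp add: step_rel_def)
    show ?case using g someI_ex[OF step_exists[OF T a0 g]] by simp
  qed
  then show "good T (picard T a0 n)" "step_rel T a0 (picard T a0 n) (picard T a0 (Suc n))" by blast+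
qed

lemma picardD:
  assumes T: "time_ok T" and a0: "\<And>k. norm (a0 k) \<le> Kw * w k"
  shows "z \<in> sector T \<Longrightarrow> norm (picard T a0 n z k) \<le> K' * w k" "picard T a0 (Suc n) 0 = a0"
    "\<lbrakk>k \<noteq> 0; z \<in> sector T\<rbrakk> \<Longrightarrow> ((\<lambda>z. picard T a0 (Suc n) z k) has_field_derivative
      (\<gamma> k - nl (picard T a0 n z) k) - of_real (lam k) * picard T a0 (Suc n) z k) (at z within sector T)"
proof -
  show "norm (picard T a0 n z k) \<le> K' * w k" if "z \<in> sector T"
    by (rule goodD(1)[OF picard_good(1)[OF T a0] that])
qed (use picard_good(2)[OF T a0, of n] in \<open>unfold step_rel_def, blast+\<close>)

lemma picard_difference:
  assumes T: "time_ok T" and a0: "\<And>k. norm (a0 k) \<le> Kw * w k" and z: "z \<in> sector T"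
  shows "norm (picard T a0 (Suc n) z k - picard T a0 n z k) \<le> 2 * K' * (1/2)^n * w k"
  using z
proof (induction n arbitrary: z k)
  case 0
  have "norm (picard T a0 (Suc 0) z k) \<le> K' * w k"
    using picard_good(1)[OF T a0, of "Suc 0"] 0 unfolding good_def by blast
  moreover have "0 \<le> K' * w k" using K'_pos w_nonneg[of k] by simp
  ultimately show ?case by simp
next
  case (Suc n)
  let ?u = "picard T a0"
  note b = picardD(1)[OF T a0] and d = picardD(3)[OF T a0] and init = picardD(2)[OF T a0]
  show ?case
  proof (cases "k = 0")
    case True
    then show ?thesis using b[OF Suc.prems, of "Suc n" 0] b[OF Suc.prems, of "Suc (Suc n)" 0] by (simp del: picard.simps)
  next
    case False
    let ?B = "\<lambda>m s. nl (?u m (of_real s * z)) k"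
    have "norm (?u (Suc (Suc n)) (of_real 1 * z) k - ?u (Suc n) (of_real 1 * z) k) \<le> (2 * K' * (1/2)^n) / 2 * w k"
    proof (rule difference_le[where ?f1.0 = "\<lambda>s. ?u (Suc (Suc n)) (of_real s * z) k" and ?f2.0 = "\<lambda>s. ?u (Suc n) (of_real s * z) k"
          and ?B1.0 = "?B (Suc n)" and ?B2.0 = "?B n", OF T False Suc.prems])
      fix s :: real assume t: "s \<in> {0..1}"
      note zt = sector_ray[OF Suc.prems t]
      show "((\<lambda>s. ?u (Suc (Suc n)) (of_real s * z) k) has_vector_derivative z * (\<gamma> k - ?B (Suc n) s - of_real (lam k) * ?u (Suc (Suc n)) (of_real s * z) k)) (at s within {0..1})"
        by (rule ray_derivative[where f = "\<lambda>z. ?u (Suc (Suc n)) z k" and h = "\<lambda>z. \<gamma> k - nl (?u (Suc n) z) k", OF d[OF False] Suc.prems t])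
      show "((\<lambda>s. ?u (Suc n) (of_real s * z) k) has_vector_derivative z * (\<gamma> k - ?B n s - of_real (lam k) * ?u (Suc n) (of_real s * z) k)) (at s within {0..1})"
        by (rule ray_derivative[where f = "\<lambda>z. ?u (Suc n) z k" and h = "\<lambda>z. \<gamma> k - nl (?u n z) k", OF d[OF False] Suc.prems t])
      show "norm (?B (Suc n) s - ?B n s) \<le> 2 * K' * (2 * K' * (1/2)^n) * (Cb * knorm k powr -1)"
        by (rule bil_diff_le[OF b[OF zt] b[OF zt] Suc.IH[OF zt]]) (use K'_pos False in auto)
    qed (use init K'_pos in \<open>auto simp del: picard.simps\<close>)
    then show ?thesis by (simp del: picard.simps)
  qed
qed

text \<open>The given solution is a fixed point of the step on the real segment, so the same
  contraction applies to its distance from the iterates. This identifies the limit with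
  \<open>a\<close> and takes the place of a uniqueness theorem.\<close>

lemma picard_real:
  assumes T: "time_ok T" and a: "sol a" and t: "t \<in> {0..T}"
  shows "norm (picard T (a t0) n (of_real t) k - a (t0 + t) k) \<le> 2 * K' * (1/2)^n * w k"
  using t
proof (induction n arbitrary: t k)
  case 0
  have "norm (a (t0 + t) k) \<le> K' * w k"
    using sol_w_bound[OF a, of "t0 + t" k] mult_right_mono[OF Kw_le_K' w_nonneg[of k]] by linarith
  moreover have "0 \<le> K' * w k" using K'_pos w_nonneg[of k] by simp
  ultimately show ?case by simp
next
  case (Suc n)
  let ?a0 = "a t0"
  let ?u = "picard T ?a0"
  have a0: "norm (?a0 k) \<le> Kw * w k" for k by (rule sol_w_bound[OF a])
  note b = picardD(1)[OF T a0] and d = picardD(3)[OF T a0] and init = picardD(2)[OF T a0]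
  have ba: "norm (a s k) \<le> K' * w k" for s k
    using sol_w_bound[OF a, of s k] mult_right_mono[OF Kw_le_K' w_nonneg[of k]] by linarith
  define z where "z = complex_of_real t"
  have z: "z \<in> sector T" using Suc.prems by (simp add: z_def sector_def)
  show ?case
  proof (cases "k = 0")
    case True
    then show ?thesis using b[OF z, of "Suc n" 0] ba[of "t0 + t" 0] by (simp add: z_def del: picard.simps)
  next
    case False
    let ?B1 = "\<lambda>s. nl (?u n (of_real s * z)) k"
    let ?B2 = "\<lambda>s. nl (a (t0 + s * t)) k"
    have "norm (?u (Suc n) (of_real 1 * z) k - a (t0 + 1 * t) k) \<le> (2 * K' * (1/2)^n) / 2 * w k"
    proof (rule difference_le[where ?f1.0 = "\<lambda>s. ?u (Suc n) (of_real s * z) k" and ?f2.0 = "\<lambda>s. a (t0 + s * t) k"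
          and ?B1.0 = ?B1 and ?B2.0 = ?B2, OF T False z])
      fix s :: real assume s: "s \<in> {0..1}"
      note zt = sector_ray[OF z s]
      have st: "s * t \<in> {0..T}" using s Suc.prems by (auto intro: mult_left_le_one_le order_trans[OF mult_left_le_one_le])
      show "((\<lambda>s. ?u (Suc n) (of_real s * z) k) has_vector_derivative z * (\<gamma> k - ?B1 s - of_real (lam k) * ?u (Suc n) (of_real s * z) k)) (at s within {0..1})"
        by (rule ray_derivative[where f = "\<lambda>z. ?u (Suc n) z k" and h = "\<lambda>z. \<gamma> k - nl (?u n z) k", OF d[OF False] z s])
      have "((\<lambda>s. t0 + s * t) has_vector_derivative t) (at s within {0..1})"
        unfolding has_real_derivative_iff_has_vector_derivative[symmetric] by (auto intro!: derivative_eq_intros)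
      from vector_diff_chain_within[OF this has_vector_derivative_at_within[OF sol_derivative[OF a, of k]]]
      show "((\<lambda>s. a (t0 + s * t) k) has_vector_derivative z * (\<gamma> k - ?B2 s - of_real (lam k) * a (t0 + s * t) k)) (at s within {0..1})"
        by (simp add: o_def scaleR_conv_of_real z_def)
      have ih: "norm (?u n (of_real s * z) j - a (t0 + s * t) j) \<le> 2 * K' * (1/2)^n * w j" for j
        using Suc.IH[OF st, of j] by (simp add: z_def)
      show "norm (?B1 s - ?B2 s) \<le> 2 * K' * (2 * K' * (1/2)^n) * (Cb * knorm k powr -1)"
        by (rule bil_diff_le[OF b[OF zt] ba ih]) (use K'_pos False in auto)
    qed (use init K'_pos in \<open>auto simp del: picard.simps\<close>)
    then show ?thesis by (simp add: z_def del: picard.simps)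
  qed
qed

lemma local_extension:
  assumes T: "time_ok T" and a: "sol a"
  shows "\<exists>U. (\<forall>k. (\<lambda>z. U z k) holomorphic_on interior (sector T)) \<and>
    (\<forall>z\<in>sector T. \<forall>k. norm (U z k) \<le> K' * w k) \<and> (\<forall>t\<in>{0..T}. \<forall>k. U (of_real t) k = a (t0 + t) k)"
proof -
  let ?a0 = "a t0"
  let ?u = "picard T ?a0"
  let ?S = "sector T"
  have a0: "norm (?a0 k) \<le> Kw * w k" for k by (rule sol_w_bound[OF a])
  have g: "good T (?u m)" for m using picard_good(1)[OF T a0] by blast
  \<comment> \<open>The limit is written as a telescoping series, for which the M-test applies with
    a geometric majorant.\<close>
  define U where "U z k = (\<Sum>n. ?u (Suc n) z k - ?u n z k)" for z k
  have lim: "uniform_limit ?S (\<lambda>n z. ?u n z k) (\<lambda>z. U z k) sequentially" for k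
  proof -
    have "uniform_limit ?S (\<lambda>n z. \<Sum>i<n. ?u (Suc i) z k - ?u i z k) (\<lambda>z. U z k) sequentially"
      unfolding U_def
    proof (rule Weierstrass_m_test)
      show "norm (?u (Suc n) z k - ?u n z k) \<le> 2 * K' * (1/2)^n * w k" if "z \<in> ?S" for n z
        by (rule picard_difference[OF T a0 that])
      show "summable (\<lambda>n. 2 * K' * (1/2)^n * w k)"
        by (intro summable_mult summable_mult2 summable_geometric) simp
    qed
    moreover have "(\<Sum>i<n. ?u (Suc i) z k - ?u i z k) = ?u n z k" for n z
      by (subst sum_lessThan_telescope) simp
    ultimately show ?thesis by (simp only:)
  qed
  have pt: "(\<lambda>n. ?u n z k) \<longlonglongrightarrow> U z k" if "z \<in> ?S" for z k
    using tendsto_uniform_limitI[OF lim that] .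
  have "(\<lambda>z. U z k) holomorphic_on interior ?S" for k
    by (rule holomorphic_uniform_limit_open[OF open_interior _ uniform_limit_on_subset[OF lim interior_subset]])
       (use goodD(3)[OF g] in auto)
  moreover have "norm (U z k) \<le> K' * w k" if "z \<in> ?S" for z k
    by (rule tendsto_upperbound[OF tendsto_norm[OF pt[OF that]]]) (use goodD(1)[OF g that] in auto)
  moreover have "U (of_real t) k = a (t0 + t) k" if t: "t \<in> {0..T}" for t k
  proof -
    have tS: "of_real t \<in> ?S" using t by (simp add: sector_def)
    have "(\<lambda>n. 2 * K' * (1/2)^n * w k) \<longlonglongrightarrow> 2 * K' * 0 * w k"
      by (intro tendsto_intros LIMSEQ_realpow_zero) auto
    then have "(\<lambda>n. 2 * K' * (1/2)^n * w k) \<longlonglongrightarrow> 0" by simp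
    then have "(\<lambda>n. ?u n (of_real t) k - a (t0 + t) k) \<longlonglongrightarrow> 0"
      by (rule Lim_null_comparison[rotated]) (use picard_real[OF T a t] in auto)
    then have "(\<lambda>n. ?u n (of_real t) k) \<longlonglongrightarrow> a (t0 + t) k" by (simp add: LIM_zero_iff)
    then show ?thesis using pt[OF tS] LIMSEQ_unique by blast
  qed
  ultimately show ?thesis by blast
qed

end

section \<open>Analytic extension to a strip\<close>

lemma open_strip: "open (strip d)"
  unfolding strip_def by (intro open_Collect_less continuous_intros)

lemma convex_strip: "convex (strip d)"
proof -
  have "strip d = {z. Im z < d} \<inter> {z. Im z > - d}" by (auto simp: strip_def)
  then show ?thesis by (simp add: convex_Int convex_halfspace_Im_lt convex_halfspace_Im_gt)
qed

lemma strip_mono: "d \<le> e \<Longrightarrow> strip d \<subseteq> strip e"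
  by (auto simp: strip_def)

lemma cball_subset_strip:
  assumes "z \<in> strip d" "d + r \<le> e"
  shows "cball z r \<subseteq> strip e"
proof
  fix y assume "y \<in> cball z r"
  then have "\<bar>Im (z - y)\<bar> \<le> r" using abs_Im_le_cmod[of "z - y"] by (simp add: dist_norm)
  then show "y \<in> strip e" using assms by (auto simp: strip_def)
qed

text \<open>Real points accumulate at each real point of an open set, and a convex set is connected,
  so the identity theorem applies.\<close>

lemma holomorphic_eq_from_reals:
  fixes f g :: "complex \<Rightarrow> complex"
  assumes D: "open D" "convex D" and hol: "f holomorphic_on D" "g holomorphic_on D"
    and eq: "\<And>x::real. of_real x \<in> D \<Longrightarrow> f (of_real x) = g (of_real x)"
    and x: "of_real x \<in> D" and z: "z \<in> D"
  shows "f z = g z"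
proof -
  let ?R = "{y \<in> D. y \<in> \<real>}"
  have lim: "(of_real x :: complex) islimpt ?R"
    unfolding islimpt_approachable
  proof (intro allI impI)
    fix e :: real assume e: "e > 0"
    obtain r where r: "r > 0" "ball (of_real x) r \<subseteq> D" using D(1) x openE by blast
    define y where "y = complex_of_real (x + min (e/2) (r/2))"
    have d: "dist y (of_real x) = min (e/2) (r/2)"
      using e r by (simp add: y_def dist_norm)
    then have "dist (of_real x) y < r" using r e by (simp add: dist_commute)
    then have "y \<in> ?R" using r(2) by (auto simp: y_def)
    moreover have "dist y (of_real x) < e" "y \<noteq> of_real x"
      using d e r by (auto simp: y_def)
    ultimately show "\<exists>y\<in>?R. y \<noteq> of_real x \<and> dist y (of_real x) < e" by blast
  qed
  have "f z - g z = 0"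
    by (rule analytic_continuation[where U = ?R and S = D and \<xi> = "of_real x"])
       (use D hol eq x z lim convex_connected in \<open>auto intro!: holomorphic_intros elim!: Reals_cases\<close>)
  then show ?thesis by simp
qed

lemma deriv_le_of_bound:
  fixes f :: "complex \<Rightarrow> complex"
  assumes hol: "f holomorphic_on D" and sub: "cball z r \<subseteq> D" and r: "r > 0" and B: "\<And>y. y \<in> D \<Longrightarrow> norm (f y) \<le> B"
  shows "norm (deriv f z) \<le> B / r"
proof -
  have hol: "f holomorphic_on cball z r" by (rule holomorphic_on_subset[OF hol sub])
  have "norm ((deriv ^^ 1) f z) \<le> fact 1 * B / r ^ 1"
  proof (rule Cauchy_inequality)
    show "f holomorphic_on ball z r" using hol ball_subset_cball holomorphic_on_subset by blast
    show "continuous_on (cball z r) f" by (rule holomorphic_on_imp_continuous_on[OF hol])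
    show "norm (f x) \<le> B" if "norm (z - x) = r" for x
      using sub that by (intro B) (auto simp: dist_norm)
  qed (use r in auto)
  then show ?thesis by simp
qed

text \<open>Taylor's remainder with Cauchy's estimate on discs of radius \<open>r / 4\<close>,
  whence the constant \<open>2 * 4^2 = 32\<close>. Linearity in \<open>c\<close> is what permits
  square summation over the modes.\<close>

lemma holomorphic_second_order:
  assumes hol: "f holomorphic_on ball z r" and r: "r > 0" and c: "\<And>y. y \<in> ball z r \<Longrightarrow> norm (f y) \<le> c"
    and h: "norm h < r / 2" "h \<noteq> 0"
  shows "norm ((f (z + h) - f z) / h - deriv f z) \<le> 32 * c / r\<^sup>2 * norm h"
proof -
  let ?S = "ball z (r/2)"
  have c0: "c \<ge> 0" using c[of z] r norm_ge_zero[of "f z"] by (simp del: norm_ge_zero)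
  have d: "((deriv ^^ i) f has_field_derivative (deriv ^^ Suc i) f y) (at y within ?S)" if "y \<in> ?S" for i y
  proof -
    have "(deriv ^^ i) f holomorphic_on ball z r" by (rule holomorphic_higher_deriv[OF hol open_ball])
    then have "(deriv ^^ i) f field_differentiable at y"
      using that r by (intro holomorphic_on_imp_differentiable_at[OF _ open_ball]) auto
    then show ?thesis by (auto simp: DERIV_deriv_iff_field_differentiable[symmetric] intro: has_field_derivative_at_within)
  qed
  have b: "norm ((deriv ^^ Suc 1) f y) \<le> 32 * c / r\<^sup>2" if y: "y \<in> ?S" for y
  proof -
    have sub: "cball y (r/4) \<subseteq> ball z r"
    proof
      fix x assume "x \<in> cball y (r/4)"
      then show "x \<in> ball z r" using y dist_triangle[of z x y] r by (simp add: dist_commute)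
    qed
    have "norm ((deriv ^^ 2) f y) \<le> fact 2 * c / (r/4)^2"
    proof (rule Cauchy_inequality)
      show "f holomorphic_on ball y (r/4)"
        using hol sub ball_subset_cball holomorphic_on_subset by blast
      show "continuous_on (cball y (r/4)) f"
        using hol sub holomorphic_on_imp_continuous_on holomorphic_on_subset by blast
      show "norm (f x) \<le> c" if "norm (y - x) = r/4" for x
        using sub that by (intro c) (auto simp: dist_norm)
    qed (use r in auto)
    then show ?thesis by (simp add: power_divide numeral_2_eq_2 fact_numeral)
  qed
  have "norm ((deriv ^^ 0) f (z + h) - (\<Sum>i\<le>1. (deriv ^^ i) f z * (z + h - z) ^ i / fact i)) \<le> (32 * c / r\<^sup>2) * norm (z + h - z) ^ Suc 1 / fact 1"
    by (rule complex_Taylor[where S = ?S, OF convex_ball d b]) (use h r in \<open>auto simp: dist_norm\<close>)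
  then have 1: "norm (f (z + h) - f z - deriv f z * h) \<le> (32 * c / r\<^sup>2) * (norm h)\<^sup>2"
    by (simp add: power2_eq_square algebra_simps)
  have "(f (z + h) - f z) / h - deriv f z = (f (z + h) - f z - deriv f z * h) / h"
    using h by (simp add: field_simps)
  then have "norm ((f (z + h) - f z) / h - deriv f z) = norm (f (z + h) - f z - deriv f z * h) / norm h"
    by (simp add: norm_divide)
  also have "\<dots> \<le> (32 * c / r\<^sup>2) * (norm h)\<^sup>2 / norm h" using 1 by (intro divide_right_mono) auto
  also have "\<dots> = 32 * c / r\<^sup>2 * norm h" using h by (simp add: power2_eq_square)
  finally show ?thesis .
qed

text \<open>A majorant in l2, uniform on a disc, upgrades holomorphy of each coefficient to
  differentiability in norm.\<close>

lemma l2_analytic: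
  fixes V :: "complex \<Rightarrow> idx \<Rightarrow> complex"
  assumes hol: "\<And>k. (\<lambda>y. V y k) holomorphic_on ball z r" and r: "r > 0"
    and c: "\<And>y k. y \<in> ball z r \<Longrightarrow> norm (V y k) \<le> c k" and c2: "(\<lambda>k. (c k)\<^sup>2) summable_on UNIV"
  shows "((\<lambda>h. l2sq (\<lambda>k. (V (z + h) k - V z k) / h - deriv (\<lambda>y. V y k) z)) \<longlongrightarrow> 0) (at 0)"
    "l2 (\<lambda>k. deriv (\<lambda>y. V y k) z)"
proof -
  define C where "C = 32 / r\<^sup>2"
  have le: "(norm ((V (z + h) k - V z k) / h - deriv (\<lambda>y. V y k) z))\<^sup>2 \<le> (C * norm h)\<^sup>2 * (c k)\<^sup>2"
    if h: "norm h < r / 2" "h \<noteq> 0" for h k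
  proof -
    have "norm ((V (z + h) k - V z k) / h - deriv (\<lambda>y. V y k) z) \<le> 32 * c k / r\<^sup>2 * norm h"
      by (rule holomorphic_second_order[OF hol r c h])
    also have "\<dots> = (C * norm h) * c k" by (simp add: C_def)
    finally show ?thesis unfolding power_mult_distrib[symmetric] by (rule power_mono) simp
  qed
  have b: "l2sq (\<lambda>k. (V (z + h) k - V z k) / h - deriv (\<lambda>y. V y k) z) \<le> (C * norm h)\<^sup>2 * (\<Sum>\<^sub>\<infinity>k. (c k)\<^sup>2)"
    if h: "norm h < r / 2" "h \<noteq> 0" for h
  proof -
    have s: "(\<lambda>k. (C * norm h)\<^sup>2 * (c k)\<^sup>2) summable_on UNIV" by (rule summable_on_cmult_right[OF c2])
    show ?thesis unfolding l2sq_def infsum_cmult_right'[symmetric]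
      by (rule infsum_mono[OF summable_on_le[OF s _ le[OF h]] s le[OF h]]) simp
  qed
  show "((\<lambda>h. l2sq (\<lambda>k. (V (z + h) k - V z k) / h - deriv (\<lambda>y. V y k) z)) \<longlongrightarrow> 0) (at 0)"
  proof (rule Lim_null_comparison)
    show "\<forall>\<^sub>F h in at 0. norm (l2sq (\<lambda>k. (V (z + h) k - V z k) / h - deriv (\<lambda>y. V y k) z)) \<le> (C * norm h)\<^sup>2 * (\<Sum>\<^sub>\<infinity>k. (c k)\<^sup>2)"
      unfolding eventually_at using b r by (intro exI[of _ "r/2"]) (auto simp: dist_norm)
    have "((\<lambda>h::complex. (C * norm h)\<^sup>2 * (\<Sum>\<^sub>\<infinity>k. (c k)\<^sup>2)) \<longlongrightarrow> (C * norm (0::complex))\<^sup>2 * (\<Sum>\<^sub>\<infinity>k. (c k)\<^sup>2)) (at 0)"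
      by (intro tendsto_intros)
    then show "((\<lambda>h::complex. (C * norm h)\<^sup>2 * (\<Sum>\<^sub>\<infinity>k. (c k)\<^sup>2)) \<longlongrightarrow> 0) (at 0)" by simp
  qed
  show "l2 (\<lambda>k. deriv (\<lambda>y. V y k) z)" unfolding l2_def
  proof (rule summable_on_le[OF summable_on_cmult_right[OF c2, of "(2 / r)\<^sup>2"]])
    fix k
    have "norm (deriv (\<lambda>y. V y k) z) \<le> c k / (r/2)"
      by (rule deriv_le_of_bound[OF hol _ _ c]) (use r in auto)
    then have "norm (deriv (\<lambda>y. V y k) z) \<le> (2 / r) * c k" by (simp add: mult.commute)
    then show "(norm (deriv (\<lambda>y. V y k) z))\<^sup>2 \<le> (2 / r)\<^sup>2 * (c k)\<^sup>2"
      unfolding power_mult_distrib[symmetric] by (rule power_mono) simp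
  qed simp
qed

section \<open>Gluing sectors into a strip\<close>

context nse
begin

text \<open>The equation is required for \<open>k \<noteq> 0\<close>; at the zero mode the bound and
  \<open>w 0 = 0\<close> already force \<open>U z 0 = 0\<close>.\<close>

definition ext :: "real \<Rightarrow> (real \<Rightarrow> idx \<Rightarrow> complex) \<Rightarrow> (complex \<Rightarrow> idx \<Rightarrow> complex) \<Rightarrow> bool" where
  "ext \<delta> a U \<longleftrightarrow> (\<forall>t. U (of_real t) = a t) \<and> (\<forall>k. (\<lambda>z. U z k) holomorphic_on strip \<delta>) \<and>
     (\<forall>z\<in>strip \<delta>. \<forall>k. norm (U z k) \<le> K' * w k) \<and>
     (\<forall>k. k \<noteq> 0 \<longrightarrow> (\<forall>z\<in>strip \<delta>. deriv (\<lambda>z. U z k) z = rhs (U z) k))"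

lemma extD:
  assumes "ext \<delta> a U"
  shows "U (of_real t) = a t" "(\<lambda>z. U z k) holomorphic_on strip \<delta>"
    "z \<in> strip \<delta> \<Longrightarrow> norm (U z k) \<le> K' * w k"
    "k \<noteq> 0 \<Longrightarrow> z \<in> strip \<delta> \<Longrightarrow> deriv (\<lambda>z. U z k) z = rhs (U z) k"
proof -
  note e = assms[unfolded ext_def]
  show "U (of_real t) = a t" using e by simp
  show "(\<lambda>z. U z k) holomorphic_on strip \<delta>" using conjunct1[OF conjunct2[OF e]] by (rule spec)
  show "norm (U z k) \<le> K' * w k" if "z \<in> strip \<delta>"
    using bspec[OF conjunct1[OF conjunct2[OF conjunct2[OF e]]] that] by (rule spec)
  show "deriv (\<lambda>z. U z k) z = rhs (U z) k" if "k \<noteq> 0" "z \<in> strip \<delta>"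
    using bspec[OF mp[OF spec[OF conjunct2[OF conjunct2[OF conjunct2[OF e]]]] that(1)] that(2)] .
qed

text \<open>Sectors started at all real times cover the strip: the rectangle \<open>D t0\<close>
  lies inside the sector with apex \<open>t0\<close>. When two rectangles meet, their intersection
  is convex and contains real points, where both extensions equal \<open>a\<close>, so they agree on
  it.\<close>

lemma strip_extension:
  assumes T: "time_ok T" and a: "sol a"
  shows "\<exists>U. (\<forall>t. U (of_real t) = a t) \<and> (\<forall>k. (\<lambda>z. U z k) holomorphic_on strip (T/4)) \<and>
     (\<forall>z\<in>strip (T/4). \<forall>k. norm (U z k) \<le> K' * w k)"
proof -
  have T0: "T > 0" using time_okD[OF T] by simp
  obtain E where E: "\<And>t0 k. (\<lambda>z. E t0 z k) holomorphic_on interior (sector T)"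
    "\<And>t0 z k. z \<in> sector T \<Longrightarrow> norm (E t0 z k) \<le> K' * w k"
    "\<And>t0 t k. t \<in> {0..T} \<Longrightarrow> E t0 (of_real t) k = a (t0 + t) k"
    using local_extension[OF T a] by metis
  define D where "D t0 = {z. \<bar>Im z\<bar> < T/4 \<and> t0 + T/4 < Re z \<and> Re z < t0 + T}" for t0
  have Deq: "D t0 = strip (T/4) \<inter> {z. t0 + T/4 < Re z} \<inter> {z. Re z < t0 + T}" for t0
    by (auto simp: D_def strip_def)
  have oD: "open (D t0)" for t0
    unfolding Deq by (intro open_Int open_strip open_Collect_less continuous_intros)
  have cD: "convex (D t0)" for t0
    unfolding Deq by (intro convex_Int convex_strip) (simp_all add: convex_halfspace_Re_lt convex_halfspace_Re_gt)
  have Ds: "z - of_real t0 \<in> interior (sector T)" if "z \<in> D t0" for z t0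
    using that sector_interior[of T] by (auto simp: D_def)
  have Eh: "(\<lambda>z. E t0 (z - of_real t0) k) holomorphic_on D t0" for t0 k
  proof -
    have "((\<lambda>z. E t0 z k) \<circ> (\<lambda>z. z - of_real t0)) holomorphic_on D t0"
      by (rule holomorphic_on_compose_gen[OF _ E(1)]) (use Ds in \<open>auto intro!: holomorphic_intros\<close>)
    then show ?thesis by (simp add: o_def)
  qed
  have Er: "E t0 (of_real x - of_real t0) k = a x k" if "of_real x \<in> D t0" for t0 x k
    using E(3)[of "x - t0" t0 k] that T0 by (simp add: D_def)
  have overlap: "E t0 (z - of_real t0) k = E t1 (z - of_real t1) k" if z: "z \<in> D t0" "z \<in> D t1" for z t0 t1 k
  proof (rule holomorphic_eq_from_reals[where D = "D t0 \<inter> D t1" and x = "Re z" and f = "\<lambda>z. E t0 (z - of_real t0) k"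
        and g = "\<lambda>z. E t1 (z - of_real t1) k"])
    show "(\<lambda>z. E t0 (z - of_real t0) k) holomorphic_on D t0 \<inter> D t1"
      "(\<lambda>z. E t1 (z - of_real t1) k) holomorphic_on D t0 \<inter> D t1"
      by (rule holomorphic_on_subset[OF Eh], simp)+
    show "of_real (Re z) \<in> D t0 \<inter> D t1" using z T0 by (auto simp: D_def)
    show "E t0 (of_real x - of_real t0) k = E t1 (of_real x - of_real t1) k" if "of_real x \<in> D t0 \<inter> D t1" for x
      using Er[of x t0 k] Er[of x t1 k] that by simp
  qed (use z in \<open>auto intro: oD cD convex_Int open_Int\<close>)
  \<comment> \<open>The base time \<open>Re z - T/2\<close> places \<open>z\<close> in the interior
    of its rectangle. Although the base time varies with \<open>z\<close>, \<open>overlap\<close>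
    shows that \<open>U\<close> coincides locally with one fixed extension.\<close>
  define U where "U z k = E (Re z - T/2) (z - of_real (Re z - T/2)) k" for z k
  have self: "z \<in> D (Re z - T/2)" if "z \<in> strip (T/4)" for z
    using that T0 by (simp add: D_def strip_def)
  have UE: "U z k = E t0 (z - of_real t0) k" if "z \<in> D t0" for z t0 k
    unfolding U_def by (rule overlap) (use that self in \<open>auto simp: Deq\<close>)
  have "U (of_real t) = a t" for t
  proof
    fix k
    have "complex_of_real t \<in> D (t - T/2)" using T0 by (simp add: D_def)
    from UE[OF this, of k] Er[OF this, of k] show "U (of_real t) k = a t k" by simp
  qed
  moreover have "(\<lambda>z. U z k) holomorphic_on strip (T/4)" for k
    unfolding holomorphic_on_def
  proof
    fix z assume z: "z \<in> strip (T/4)"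
    define t0 where "t0 = Re z - T/2"
    have "(\<lambda>z. U z k) holomorphic_on D t0"
      by (rule holomorphic_transform[OF Eh]) (simp add: UE)
    then have "(\<lambda>z. U z k) field_differentiable at z"
      using oD self[OF z] by (auto simp: t0_def intro: holomorphic_on_imp_differentiable_at)
    then show "(\<lambda>z. U z k) field_differentiable at z within strip (T/4)"
      by (rule field_differentiable_at_within)
  qed
  moreover have "norm (U z k) \<le> K' * w k" if "z \<in> strip (T/4)" for z k
    unfolding U_def using Ds[OF self[OF that]] interior_subset by (intro E(2)) blast
  ultimately show ?thesis by blast
qed

text \<open>Both sides of the differential equation are holomorphic on the strip and agree at real
  times. The width comes from \<open>time_ok\<close> and is therefore chosen before the
  solution.\<close>

lemma ext_exists: "\<exists>\<delta>>0. \<forall>a. sol a \<longrightarrow> (\<exists>U. ext \<delta> a U)"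
proof -
  obtain T where T: "time_ok T" using time_ok_exists by blast
  define \<delta> where "\<delta> = T/4"
  have \<delta>: "\<delta> > 0" using time_okD[OF T] by (simp add: \<delta>_def)
  have "\<exists>U. ext \<delta> a U" if a: "sol a" for a
  proof -
    obtain U where U: "\<And>t. U (of_real t) = a t" "\<And>k. (\<lambda>z. U z k) holomorphic_on strip \<delta>"
      "\<And>z k. z \<in> strip \<delta> \<Longrightarrow> norm (U z k) \<le> K' * w k"
      using strip_extension[OF T a] unfolding \<delta>_def by blast
    have ode: "deriv (\<lambda>z. U z k) z = rhs (U z) k" if k: "k \<noteq> 0" and z: "z \<in> strip \<delta>" for k z
    proof (rule holomorphic_eq_from_reals[OF open_strip convex_strip _ _ _ _ z])
      show "deriv (\<lambda>z. U z k) holomorphic_on strip \<delta>"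
        by (rule holomorphic_deriv[OF U(2) open_strip])
      have "(\<lambda>z. nl (U z) k) holomorphic_on strip \<delta>"
        by (rule bil_holomorphic[where A = K', OF U(3) _ k U(2) open_strip]) (use K'_pos in auto)
      then show "(\<lambda>z. rhs (U z) k) holomorphic_on strip \<delta>"
        unfolding rhs_def by (intro holomorphic_intros U(2))
      fix x :: real assume x: "of_real x \<in> strip \<delta>"
      have "((\<lambda>z. U z k) has_field_derivative deriv (\<lambda>z. U z k) (of_real x)) (at (of_real x))"
        using holomorphic_derivI[OF U(2) open_strip x] .
      then have "((\<lambda>t. U (of_real t) k) has_vector_derivative deriv (\<lambda>z. U z k) (of_real x)) (at x)"
        by (rule has_vector_derivative_real_field)
      then have 1: "((\<lambda>t. a t k) has_vector_derivative deriv (\<lambda>z. U z k) (of_real x)) (at x)"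
        by (simp add: U(1))
      have "deriv (\<lambda>z. U z k) (of_real x) = (\<gamma> k - nl (a x) k) - of_real (lam k) * a x k"
        by (rule vector_derivative_unique_at[OF 1 sol_derivative[OF a]])
      then show "deriv (\<lambda>z. U z k) (of_real x) = rhs (U (of_real x)) k" by (simp add: rhs_def U(1))
    next
      show "of_real 0 \<in> strip \<delta>" using \<delta> by (simp add: strip_def)
    qed
    have "ext \<delta> a U" unfolding ext_def by (intro conjI allI ballI impI U ode)
    then show ?thesis by blast
  qed
  then show ?thesis using \<delta> by blast
qed

section \<open>Spatial decay on smaller strips\<close>

lemma bil_zero: "bil \<kappa> (\<lambda>_. 0) c k = 0"
  by (simp add: bil_def)

lemma derivative_decay:
  assumes U: "ext \<delta> a U" and z: "z \<in> strip d" and r: "r > 0" "d + r \<le> e" "e \<le> \<delta>"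
    and C: "\<And>y. y \<in> strip e \<Longrightarrow> norm (U y k) \<le> B"
  shows "norm (deriv (\<lambda>z. U z k) z) \<le> B / r"
proof (rule deriv_le_of_bound[OF _ cball_subset_strip[OF z r(2)] r(1) C])
  show "(\<lambda>z. U z k) holomorphic_on strip e"
    by (rule holomorphic_on_subset[OF extD(2)[OF U] strip_mono[OF r(3)]])
qed

text \<open>The constant is common to all extensions and so covers \<open>U0\<close> as well; this
  is how the induction hypothesis also yields decay of the force. The exponent starts at 2 because
  \<open>w_le\<close> holds for the original strip.\<close>

lemma decay:
  assumes \<delta>: "\<delta> > 0" and U0: "ext \<delta> a0 U0" and z0: "a0 0 = (\<lambda>k. 0)"
  shows "\<exists>C\<ge>0. \<forall>a U. ext \<delta> a U \<longrightarrow> (\<forall>z\<in>strip (\<delta> * (1/2 + 1 / 2 ^ (n + 2))). \<forall>k. norm (U z k) \<le> C * knorm k powr - real (n + 2))"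
proof (induction n)
  case 0
  show ?case
  proof (intro exI[of _ "K' * (\<Gamma> + 1)"] conjI allI impI ballI)
    show "K' * (\<Gamma> + 1) \<ge> 0" using K'_pos Gamma_nonneg by simp
    fix a U z k assume U: "ext \<delta> a U" and z: "z \<in> strip (\<delta> * (1/2 + 1 / 2 ^ (0 + 2)))"
    have "z \<in> strip \<delta>" using z strip_mono[of "\<delta> * (1/2 + 1 / 2 ^ (0 + 2))" \<delta>] \<delta> by auto
    then have "norm (U z k) \<le> K' * w k" by (rule extD(3)[OF U])
    also have "\<dots> \<le> K' * ((\<Gamma> + 1) * knorm k powr -2)" using K'_pos w_le by (intro mult_left_mono) auto
    finally show "norm (U z k) \<le> K' * (\<Gamma> + 1) * knorm k powr - real (0 + 2)" by simp
  qed
next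
  case (Suc n)
  define m where "m = n + 2"
  define e where "e = \<delta> * (1/2 + 1 / 2 ^ m)"
  define d where "d = \<delta> * (1/2 + 1 / 2 ^ Suc m)"
  \<comment> \<open>Exactly the width \<open>e - d\<close> given up in this step, hence the radius
    available to Cauchy's estimate.\<close>
  define r where "r = \<delta> / 2 ^ Suc m"
  have r: "r > 0" "d + r \<le> e" using \<delta> by (auto simp: r_def d_def e_def algebra_simps)
  have "(2::real) ^ 1 \<le> 2 ^ m" by (rule power_increasing) (simp_all add: m_def)
  then have "(1::real) / 2 ^ m \<le> 1 / 2" by (intro divide_left_mono) auto
  then have "(1/2 + 1 / 2 ^ m :: real) \<le> 1" by linarith
  then have "\<delta> * (1/2 + 1 / 2 ^ m) \<le> \<delta> * 1" using \<delta> by (intro mult_left_mono) auto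
  then have e: "e \<le> \<delta>" by (simp only: e_def mult_1_right)
  have dp: "d > 0" using \<delta> by (simp add: d_def add_pos_pos)
  have de: "d \<le> e" using r by linarith
  from Suc obtain C where C: "C \<ge> 0"
    "\<And>a U z k. ext \<delta> a U \<Longrightarrow> z \<in> strip e \<Longrightarrow> norm (U z k) \<le> C * knorm k powr - real m"
    unfolding m_def e_def by blast
  \<comment> \<open>Where \<open>U0\<close> vanishes, so do the linear and the nonlinear term, and
    the time derivative equals \<open>\<gamma>\<close>.\<close>
  have gam_dec: "norm (\<gamma> k) \<le> C / r * knorm k powr - real m" if k: "k \<noteq> 0" for k
  proof -
    have zs: "0 \<in> strip d" "0 \<in> strip \<delta>" using dp \<delta> by (auto simp: strip_def)
    have U00: "U0 0 = (\<lambda>k. 0)" using extD(1)[OF U0, of 0] z0 by simp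
    have "deriv (\<lambda>z. U0 z k) 0 = \<gamma> k"
      using extD(4)[OF U0 k zs(2)] by (simp add: U00 rhs_def bil_zero)
    moreover have "norm (deriv (\<lambda>z. U0 z k) 0) \<le> (C * knorm k powr - real m) / r"
      by (rule derivative_decay[OF U0 zs(1) r e]) (rule C(2)[OF U0])
    ultimately show ?thesis by simp
  qed
  define B where "B = \<kappa> * (2 powr m * 2 * C * (K' * W))"
  define C2 where "C2 = (2 * C / r + B) / \<mu>"
  show ?case
  proof (intro exI[of _ C2] conjI allI impI ballI)
    show "C2 \<ge> 0" using C(1) r(1) kap K'_pos W_nonneg mu by (simp add: C2_def B_def)
    fix a U z k assume U: "ext \<delta> a U" and "z \<in> strip (\<delta> * (1/2 + 1 / 2 ^ (Suc n + 2)))"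
    then have z: "z \<in> strip d" by (simp add: d_def m_def)
    then have ze: "z \<in> strip e" and z\<delta>: "z \<in> strip \<delta>" using strip_mono[OF de] strip_mono[OF e] by blast+
    show "norm (U z k) \<le> C2 * knorm k powr - real (Suc n + 2)"
    proof (cases "k = 0")
      case True
      then show ?thesis using extD(3)[OF U z\<delta>, of 0] by simp
    next
      case False
      have k0: "knorm k > 0" by (rule knorm_pos[OF False])
      let ?x = "knorm k powr - real m"
      define v where "v p = norm (U z p)" for p
      have v: "v summable_on UNIV" "infsum v UNIV \<le> K' * W"
      proof -
        note s = summable_on_cmult_right[OF w_summable, of K']
        show v: "v summable_on UNIV"
          by (rule summable_on_le[OF s]) (use extD(3)[OF U z\<delta>] in \<open>auto simp: v_def\<close>)
        show "infsum v UNIV \<le> K' * W" unfolding W_def infsum_cmult_right'[symmetric]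
          by (rule infsum_mono[OF v s]) (use extD(3)[OF U z\<delta>] in \<open>auto simp: v_def\<close>)
      qed
      have v2: "v p \<le> C * knorm p powr - real m" for p unfolding v_def by (rule C(2)[OF U ze])
      have v0: "0 \<le> v p" for p by (simp add: v_def)
      note conv = weight_convolution[OF v(1) v0 _ v2 C(1) False]
      have "norm (nl (U z) k) \<le> (\<Sum>\<^sub>\<infinity>p. (\<kappa> * knorm k) * (v p * v (k - p)))"
        unfolding bil_def
      proof (rule norm_summable_on_le(3)[OF summable_on_cmult_right[OF conv(1)]])
        fix p
        have "norm (bker \<kappa> p k * U z p * U z (k - p)) \<le> (\<kappa> * knorm k) * v p * v (k - p)"
          unfolding norm_mult v_def using norm_bker_le(1)[of \<kappa> p k] kap by (intro mult_right_mono) auto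
        then show "norm (bker \<kappa> p k * U z p * U z (k - p)) \<le> (\<kappa> * knorm k) * (v p * v (k - p))"
          by (simp add: mult.assoc)
      qed simp
      also have "\<dots> = (\<kappa> * knorm k) * (\<Sum>\<^sub>\<infinity>p. v p * v (k - p))" by (rule infsum_cmult_right')
      also have "\<dots> \<le> (\<kappa> * knorm k) * (2 powr m * 2 * C * infsum v UNIV * ?x)"
        using kap by (intro mult_left_mono conv(2)) auto
      also have "\<dots> \<le> (\<kappa> * knorm k) * (2 powr m * 2 * C * (K' * W) * ?x)"
        using kap C(1) v(2) by (intro mult_left_mono mult_right_mono) auto
      finally have b: "norm (nl (U z) k) \<le> \<kappa> * (2 powr m * 2 * C * (K' * W)) * (knorm k * ?x)"
        by (simp add: mult_ac)
      have dv: "norm (deriv (\<lambda>z. U z k) z) \<le> (C * ?x) / r"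
        by (rule derivative_decay[OF U z r e]) (rule C(2)[OF U])
      \<comment> \<open>The force and the time derivative decay like the hypothesis, while the
        nonlinear term loses one power. Division by \<open>lam k\<close> regains two, so the net
        gain is one.\<close>
      have eq: "of_real (lam k) * U z k = \<gamma> k - nl (U z) k - deriv (\<lambda>z. U z k) z"
        using extD(4)[OF U False z\<delta>] by (simp add: rhs_def)
      have "lam k * norm (U z k) = norm (of_real (lam k) * U z k)"
        using lam_pos[OF False] by (simp add: norm_mult)
      also have "\<dots> \<le> norm (\<gamma> k) + norm (nl (U z) k) + norm (deriv (\<lambda>z. U z k) z)"
        unfolding eq by (meson norm_triangle_ineq4 add_right_mono order_trans)
      also have "\<dots> \<le> C / r * ?x + B * (knorm k * ?x) + C / r * ?x"
        by (intro add_mono gam_dec[OF False] b[folded B_def]) (use dv in simp)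
      also have "\<dots> = 2 * C / r * ?x + B * (knorm k * ?x)" by simp
      also have "\<dots> \<le> 2 * C / r * (knorm k * ?x) + B * (knorm k * ?x)"
      proof (intro add_right_mono mult_left_mono)
        show "?x \<le> knorm k * ?x" using mult_right_mono[OF knorm_ge_1[OF False], of ?x] by simp
      qed (use C(1) r(1) in simp)
      also have "\<dots> = (C2 * \<mu>) * (knorm k * ?x)"
        using mu by (simp only: C2_def distrib_right[symmetric]) simp
      finally have "lam k * norm (U z k) \<le> (C2 * \<mu>) * (knorm k * ?x)" .
      then have "norm (U z k) \<le> (C2 * \<mu>) * (knorm k * ?x) / lam k"
        using lam_pos[OF False] by (simp add: pos_le_divide_eq mult.commute)
      also have "\<dots> = C2 * (?x * knorm k powr -1)"
        using mu k0 by (simp add: lam_def powr_minus_divide power2_eq_square)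
      also have "?x * knorm k powr -1 = knorm k powr - real (Suc n + 2)"
        by (subst powr_add[symmetric]) (simp add: m_def)
      finally show ?thesis .
    qed
  qed
qed

end

section \<open>Vector fields and scalar coefficients\<close>

definition perpv :: "idx \<Rightarrow> complex \<times> complex" where
  "perpv k = (of_int (- snd k), of_int (fst k))"

text \<open>Division by \<open>knorm k\<close> makes the correspondence norm preserving on nonzero
  modes. At \<open>k = 0\<close> the result is 0 whatever \<open>a 0\<close> is.\<close>

definition vfield :: "(idx \<Rightarrow> complex) \<Rightarrow> vf" where
  "vfield a = (\<lambda>k. csc (a k / of_real (knorm k)) (perpv k))"

definition scal :: "vf \<Rightarrow> idx \<Rightarrow> complex" where
  "scal u = (\<lambda>k. dotc (perpv k) (u k) / of_real (knorm k))"

lemma complex_knorm_sq: "(of_real (knorm k))\<^sup>2 = (of_int (fst k))\<^sup>2 + (of_int (snd k) :: complex)\<^sup>2"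
proof -
  have "(complex_of_real (knorm k))\<^sup>2 = of_real ((knorm k)\<^sup>2)" by simp
  also have "\<dots> = (of_int (fst k))\<^sup>2 + (of_int (snd k))\<^sup>2" unfolding knorm_sq by simp
  finally show ?thesis .
qed

lemma vfield_zero [simp]: "vfield a 0 = 0"
  by (simp add: vfield_def csc_def zero_prod_def)

lemma scal_zero [simp]: "scal u 0 = 0"
  by (simp add: scal_def)

lemma norm_csc: "norm (csc c v) = norm c * norm v"
proof -
  have "(norm (csc c v))\<^sup>2 = (norm c * norm v)\<^sup>2"
    by (cases v) (simp add: csc_def norm_Pair norm_mult power_mult_distrib distrib_left)
  then show ?thesis by (simp add: power2_eq_iff_nonneg)
qed

lemma norm_perpv: "norm (perpv k) = knorm k"
  by (simp add: perpv_def norm_Pair knorm_def add.commute)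

lemma norm_vfield: "k \<noteq> 0 \<Longrightarrow> norm (vfield a k) = norm (a k)"
  by (simp add: vfield_def norm_csc norm_perpv norm_divide)

lemma norm_vfield_le: "norm (vfield a k) \<le> norm (a k)"
  using norm_vfield[of k a] by (cases "k = 0") auto

lemma norm_vfield_eq: "a 0 = 0 \<Longrightarrow> norm (vfield a k) = norm (a k)"
  using norm_vfield[of k a] by (cases "k = 0") auto

lemma vfield_HC:
  assumes "l2 a"
  shows "vfield a \<in> HC"
proof -
  have "(\<lambda>k. (norm (vfield a k))\<^sup>2) summable_on UNIV"
    by (rule summable_on_le[OF assms[unfolded l2_def]]) (auto intro!: power_mono norm_vfield_le)
  moreover have "dotc (kvec k) (vfield a k) = 0" for k
    by (simp add: dotc_def kvec_def vfield_def csc_def perpv_def)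
  ultimately show ?thesis using vfield_zero[of a] by (simp add: HC_def zero_prod_def)
qed

lemma hnorm_vfield:
  assumes "L > 0" "a 0 = 0"
  shows "hnorm L (vfield a) = L * sqrt (l2sq a)"
  using assms by (simp add: hnorm_def l2sq_def norm_vfield_eq real_sqrt_mult)

text \<open>In the plane the complement of \<open>k\<close> is spanned by \<open>perpv k\<close>, so
  removing the component along \<open>k\<close>, as the Leray projection does, is projection onto
  \<open>perpv k\<close>.\<close>

lemma perp_decomposition:
  assumes "k \<noteq> 0"
  shows "v - csc (dotc (kvec k) v / of_real ((knorm k)\<^sup>2)) (kvec k) = csc (dotc (perpv k) v / of_real ((knorm k)\<^sup>2)) (perpv k)"
proof -
  define n where "n = complex_of_real ((knorm k)\<^sup>2)"
  define x y p q where "x = fst v" and "y = snd v" and "p = complex_of_int (fst k)" and "q = complex_of_int (snd k)"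
  have n: "n \<noteq> 0" using assms by (simp add: n_def)
  have n2: "n = p * p + q * q"
    using complex_knorm_sq[of k] by (simp add: n_def p_def q_def power2_eq_square)
  have "x * n - (p * x + q * y) * p = (p * y - q * x) * - q" "y * n - (p * x + q * y) * q = (p * y - q * x) * p"
    unfolding n2 by (simp_all add: algebra_simps)
  then have "x - (p * x + q * y) / n * p = (p * y - q * x) / n * - q" "y - (p * x + q * y) / n * q = (p * y - q * x) / n * p"
    using n by (simp_all add: field_simps)
  then show ?thesis
    unfolding n_def[symmetric] by (simp add: prod_eq_iff csc_def dotc_def perpv_def kvec_def p_def q_def x_def y_def)
qed

lemma vfield_scal:
  assumes "u \<in> HC"
  shows "vfield (scal u) = u"
proof
  fix k
  show "vfield (scal u) k = u k"
  proof (cases "k = 0")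
    case True
    then show ?thesis using assms vfield_zero[of "scal u"] by (simp add: HC_def zero_prod_def)
  next
    case False
    have "dotc (kvec k) (u k) = 0" using assms unfolding HC_def by blast
    then show ?thesis using perp_decomposition[OF False, of "u k"]
      by (simp add: vfield_def scal_def csc_def power2_eq_square flip: zero_prod_def)
  qed
qed

lemma scal_vfield: "k \<noteq> 0 \<Longrightarrow> scal (vfield a) k = a k"
proof -
  assume k: "k \<noteq> 0"
  define n where "n = complex_of_real (knorm k)"
  have n: "n \<noteq> 0" using k by (simp add: n_def)
  have "scal (vfield a) k = a k / (n * n) * ((of_int (fst k))\<^sup>2 + (of_int (snd k))\<^sup>2)"
    by (simp add: scal_def vfield_def csc_def dotc_def perpv_def n_def power2_eq_square algebra_simps add_divide_distrib)
  also have "\<dots> = a k" using n unfolding complex_knorm_sq[symmetric] n_def[symmetric] by (simp add: power2_eq_square)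
  finally show ?thesis .
qed

lemma norm_scal:
  assumes "u \<in> HC"
  shows "norm (scal u k) = norm (u k)"
  using norm_vfield_eq[of "scal u" k] vfield_scal[OF assms] by simp

lemma l2_scal: "u \<in> HC \<Longrightarrow> l2 (scal u)"
  by (simp add: l2_def norm_scal) (simp add: HC_def)

lemma vfield_add: "vfield a k + vfield b k = vfield (\<lambda>k. a k + b k) k"
  by (simp add: vfield_def csc_def algebra_simps add_divide_distrib)

lemma vfield_diff: "vfield a k - vfield b k = vfield (\<lambda>k. a k - b k) k"
  by (simp add: vfield_def csc_def algebra_simps diff_divide_distrib)

lemma csc_vfield: "csc c (vfield a k) = vfield (\<lambda>k. c * a k) k"
  by (simp add: vfield_def csc_def mult.assoc)

lemma scaleR_vfield: "r *\<^sub>R vfield a k = vfield (\<lambda>k. of_real r * a k) k"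
  by (simp add: csc_vfield[symmetric]) (simp add: csc_def scaleR_prod_def scaleR_conv_of_real)

lemma vfield_cong: "(k \<noteq> 0 \<Longrightarrow> a k = b k) \<Longrightarrow> vfield a k = vfield b k"
  by (cases "k = 0") (auto simp: vfield_def)

lemma Ahalf_vfield: "Ahalf L \<alpha> (vfield a) = vfield (\<lambda>k. of_real ((kap L * knorm k) ^ \<alpha>) * a k)"
proof
  fix k
  show "Ahalf L \<alpha> (vfield a) k = vfield (\<lambda>k. of_real ((kap L * knorm k) ^ \<alpha>) * a k) k"
    unfolding Ahalf_def csc_vfield by (simp add: vfield_def)
qed

lemma bil_at_zero: "\<kappa> \<ge> 0 \<Longrightarrow> bil \<kappa> a c 0 = 0"
proof -
  assume "\<kappa> \<ge> 0"
  then have "bker \<kappa> p 0 = 0" for p using norm_bker_le(1)[of \<kappa> p 0] by simp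
  then show ?thesis by (simp add: bil_def)
qed

text \<open>At mode \<open>k\<close> the Leray projection amounts to the linear functional
  \<open>f\<close>, which is continuous and passes under the convolution sum. That sum converges
  absolutely: the derivative is charged to \<open>k\<close>, which leaves a product of two l2
  sequences.\<close>

lemma Bop_vfield:
  assumes a: "l2 a" and \<kappa>: "kap L > 0"
  shows "Bop L (vfield a) (vfield a) k = vfield (bil (kap L) a a) k"
proof (cases "k = 0")
  case True
  then show ?thesis by (simp add: Bop_def leray_def zero_prod_def vfield_zero[unfolded zero_prod_def])
next
  case False
  define \<kappa> where "\<kappa> = kap L"
  define t where "t p = csc (dotc (vfield a p) (csc (\<i> * of_real \<kappa>) (kvec (k - p)))) (vfield a (k - p))" for p
  define w where "w = (\<Sum>\<^sub>\<infinity>p. t p)"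
  have c: "dotc (vfield a p) (csc (\<i> * of_real \<kappa>) (kvec (k - p))) = \<i> * of_real (\<kappa> * crs p (k - p) / knorm p) * a p" for p
    by (simp add: dotc_def vfield_def csc_def perpv_def kvec_def crs_def algebra_simps add_divide_distrib diff_divide_distrib)
  have nt: "norm (t p) \<le> \<kappa> * knorm k * \<bar>norm (a p) * norm (a (k - p))\<bar>" for p
  proof -
    have "norm (t p) = \<kappa> * \<bar>crs p k / knorm p\<bar> * norm (a p) * norm (vfield a (k - p))"
      unfolding t_def c norm_csc using \<kappa> by (simp add: norm_mult norm_divide \<kappa>_def abs_mult)
    also have "\<dots> \<le> \<kappa> * knorm k * norm (a p) * norm (a (k - p))"
      using \<kappa> by (intro mult_mono abs_crs_div_le norm_vfield_le mult_nonneg_nonneg) (auto simp: \<kappa>_def)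
    finally show ?thesis by (simp add: mult.assoc)
  qed
  have a2: "(\<lambda>p. (norm (a p))\<^sup>2) summable_on UNIV" "(\<lambda>p. (norm (a (k - p)))\<^sup>2) summable_on UNIV"
    using a summable_on_diff_left_iff[of "\<lambda>p. (norm (a p))\<^sup>2" k] by (auto simp: l2_def)
  have st: "t summable_on UNIV"
    by (rule norm_summable_on_le(1)[OF summable_on_cmult_right[OF l2_mult_summable[OF a2]] nt])
  define f where "f v = dotc (perpv k) v / of_real (knorm k)" for v
  have "linear f"
    by (rule linearI) (auto simp: f_def dotc_def algebra_simps add_divide_distrib scaleR_conv_of_real)
  then have f: "bounded_linear f" by (simp add: linear_conv_bounded_linear)
  have ft: "f (t p) = bker \<kappa> p k * a p * a (k - p)" for p
  proof -
    have "f (t p) = (\<i> * of_real (\<kappa> * crs p (k - p) / knorm p) * a p) * (a (k - p) * of_real (dt (k - p) k / (knorm (k - p) * knorm k)))"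
      unfolding t_def c
      by (simp add: f_def csc_def dotc_def vfield_def perpv_def dt_def algebra_simps add_divide_distrib diff_divide_distrib)
    then show ?thesis by (simp add: bker_def mult_ac)
  qed
  have "f w = (\<Sum>\<^sub>\<infinity>p. f (t p))"
    unfolding w_def by (rule infsumI[OF has_sum_bounded_linear[OF f has_sum_infsum[OF st]], symmetric])
  then have fw: "f w = bil \<kappa> a a k" by (simp add: ft bil_def)
  have "Bop L (vfield a) (vfield a) k = w - csc (dotc (kvec k) w / of_real ((knorm k)\<^sup>2)) (kvec k)"
    using False by (simp add: Bop_def leray_def w_def t_def \<kappa>_def minus_prod_def zero_prod_def)
  also have "\<dots> = csc (f w / of_real (knorm k)) (perpv k)"
    unfolding perp_decomposition[OF False] by (simp add: f_def power2_eq_square)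
  also have "\<dots> = vfield (bil (kap L) a a) k" by (simp add: fw vfield_def \<kappa>_def)
  finally show ?thesis .
qed

section \<open>Translation of solutions to scalar coefficients\<close>

lemma scal_reality:
  assumes "u \<in> H"
  shows "scal u (- k) = - cnj (scal u k)"
proof -
  have "u (- k) = conjv (u k)"
    using assms by (cases k) (auto simp: H_def)
  then show ?thesis by (simp add: scal_def perpv_def dotc_def conjv_def diff_divide_distrib add_divide_distrib)
qed

text \<open>The derivative \<open>u'\<close> is recovered as \<open>rhs\<close> because
  \<open>vfield\<close> determines every nonzero mode, and at the zero mode both sides
  vanish.\<close>

lemma solution_scalar:
  assumes L: "L > 0" and \<nu>: "\<nu> > 0" and g: "g \<in> H" and u: "solution_in_attractor L \<nu> g u"
  shows "nse.sol (kap L) \<nu> (scal g) (\<lambda>t. scal (u t))" "u t = vfield (scal (u t))"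
proof -
  have kap: "kap L > 0" using L by (simp add: kap_def)
  have gHC: "g \<in> HC" using g by (simp add: H_def)
  interpret nse "kap L" \<nu> "scal g" by unfold_locales (use kap \<nu> l2_scal[OF gHC] in auto)
  have uH: "u t \<in> H" "u t \<in> HC" "Aop L (u t) \<in> HC" for t
    using u by (auto simp: solution_in_attractor_def nse_solution_def H_def)
  have uv: "vfield (scal (u t)) = u t" for t by (rule vfield_scal[OF uH(2)])
  then show "u t = vfield (scal (u t))" by simp
  have l2u: "l2 (scal (u t))" for t by (rule l2_scal[OF uH(2)])
  have sum4: "(\<lambda>k. ((knorm k)\<^sup>2 * norm (scal (u t) k))\<^sup>2) summable_on UNIV" for t
  proof -
    have A: "Aop L (u t) = vfield (\<lambda>k. of_real ((kap L * knorm k)\<^sup>2) * scal (u t) k)"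
      by (subst uv[symmetric]) (simp only: Aop_def Ahalf_vfield)
    have "(\<lambda>k. (norm (Aop L (u t) k))\<^sup>2) summable_on UNIV" using uH(3)[of t] by (simp add: HC_def)
    then have "(\<lambda>k. (1 / (kap L)\<^sup>2)\<^sup>2 * (norm (Aop L (u t) k))\<^sup>2) summable_on UNIV" by (rule summable_on_cmult_right)
    moreover have "(1 / (kap L)\<^sup>2)\<^sup>2 * (norm (Aop L (u t) k))\<^sup>2 = ((knorm k)\<^sup>2 * norm (scal (u t) k))\<^sup>2" for k
      unfolding A using kap
      by (subst norm_vfield_eq) (auto simp: norm_mult norm_power power_mult_distrib power_divide)
    ultimately show ?thesis by (simp only:)
  qed
  have der: "l2 (rhs (scal (u t)))"
    "((\<lambda>h. l2sq (\<lambda>k. (scal (u (t + h)) k - scal (u t) k) / of_real h - rhs (scal (u t)) k)) \<longlongrightarrow> 0) (at 0)" for t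
  proof -
    obtain u' where u': "has_tderiv L u u' t" "\<And>k. u' k + scaleR \<nu> (Aop L (u t) k) + Bop L (u t) (u t) k = g k"
      using u unfolding solution_in_attractor_def nse_solution_def by blast
    define b where "b = scal u'"
    have u'HC: "u' \<in> HC" using u'(1) by (simp add: has_tderiv_def)
    have b: "u' = vfield b" unfolding b_def by (rule vfield_scal[OF u'HC, symmetric])
    have b_eq: "b = rhs (scal (u t))"
    proof
      fix k
      show "b k = rhs (scal (u t)) k"
      proof (cases "k = 0")
        case True
        then show ?thesis using kap by (simp add: b_def rhs_def bil_at_zero)
      next
        case False
        let ?a = "scal (u t)"
        have "vfield (\<lambda>k. b k + of_real \<nu> * (of_real ((kap L * knorm k)\<^sup>2) * ?a k) + bil (kap L) ?a ?a k) k
            = u' k + scaleR \<nu> (Aop L (u t) k) + Bop L (u t) (u t) k"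
          by (subst (2 3 4) uv[symmetric])
             (simp only: b Aop_def Ahalf_vfield Bop_vfield[OF l2u kap] scaleR_vfield vfield_add)
        also have "\<dots> = vfield (scal g) k" using u'(2) vfield_scal[OF gHC] by simp
        finally have "scal (vfield (\<lambda>k. b k + of_real \<nu> * (of_real ((kap L * knorm k)\<^sup>2) * ?a k) + bil (kap L) ?a ?a k)) k = scal (vfield (scal g)) k"
          by (simp add: scal_def)
        then have "b k + of_real \<nu> * (of_real ((kap L * knorm k)\<^sup>2) * ?a k) + bil (kap L) ?a ?a k = scal g k"
          unfolding scal_vfield[OF False] .
        then show ?thesis by (simp add: rhs_def lam_def \<mu>_def power_mult_distrib algebra_simps)
      qed
    qed
    show "l2 (rhs (scal (u t)))" using l2_scal[OF u'HC] b_eq b_def by simp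
    let ?d = "\<lambda>h k. (scal (u (t + h)) k - scal (u t) k) / of_real h - rhs (scal (u t)) k"
    have "hnorm L (\<lambda>k. scaleR (1 / h) (u (t + h) k - u t k) - u' k) = L * sqrt (l2sq (?d h))" for h
    proof -
      have "(\<lambda>k. scaleR (1 / h) (u (t + h) k - u t k) - u' k) = vfield (?d h)"
      proof
        fix k
        have "scaleR (1 / h) (u (t + h) k - u t k) - u' k = vfield (\<lambda>k. of_real (1 / h) * (scal (u (t + h)) k - scal (u t) k) - b k) k"
          by (subst (1 2) uv[symmetric]) (simp only: b vfield_diff scaleR_vfield)
        then show "scaleR (1 / h) (u (t + h) k - u t k) - u' k = vfield (?d h) k"
          by (simp add: b_eq divide_inverse mult.commute)
      qed
      moreover have "?d h 0 = 0" using kap by (simp add: rhs_def bil_at_zero lam_def)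
      ultimately show ?thesis by (simp add: hnorm_vfield[OF L])
    qed
    then have "((\<lambda>h. L * sqrt (l2sq (?d h))) \<longlongrightarrow> 0) (at 0)"
      using u'(1) by (simp add: has_tderiv_def)
    then have "((\<lambda>h. ((L * sqrt (l2sq (?d h))) / L)\<^sup>2) \<longlongrightarrow> (0 / L)\<^sup>2) (at 0)"
      by (intro tendsto_intros) (use L in auto)
    then show "((\<lambda>h. l2sq (?d h)) \<longlongrightarrow> 0) (at 0)" using L by simp
  qed
  obtain M where M: "\<And>t. hnorm L (u t) \<le> M" using u by (auto simp: solution_in_attractor_def)
  have "l2sq (scal (u t)) \<le> (M / L)\<^sup>2" for t
  proof -
    have "hnorm L (u t) = L * sqrt (l2sq (scal (u t)))" by (subst uv[symmetric]) (simp add: hnorm_vfield[OF L])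
    then have "sqrt (l2sq (scal (u t))) \<le> M / L" using M[of t] L by (simp add: pos_le_divide_eq mult.commute)
    then have "(sqrt (l2sq (scal (u t))))\<^sup>2 \<le> (M / L)\<^sup>2" by (intro power_mono) auto
    then show ?thesis by simp
  qed
  then show "sol (\<lambda>t. scal (u t))"
    unfolding sol_def using der sum4 scal_reality[OF uH(1)] by (intro conjI allI exI[of _ "(M / L)\<^sup>2"]) auto
qed

theorem theorem2p1:
  fixes L \<nu> :: real and g :: vf
  assumes "L > 0" and "\<nu> > 0" and "g \<in> H"
    and "(\<lambda>k. 0) \<in> attractor L \<nu> g"
  shows "\<exists>\<delta>>0. \<exists>R :: nat \<Rightarrow> real. (\<forall>\<alpha>. R \<alpha> \<ge> 0) \<and>
    (\<forall>u. solution_in_attractor L \<nu> g u \<longrightarrow>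
      (\<exists>U :: complex \<Rightarrow> vf.
         (\<forall>t::real. U (complex_of_real t) = u t) \<and>
         (\<forall>z\<in>strip \<delta>. \<exists>U'. has_cderiv L U U' z \<and>
             (\<forall>k. U' k + csc (complex_of_real \<nu>) (Aop L (U z) k) + Bop L (U z) (U z) k = g k)) \<and>
         (\<forall>\<alpha>::nat. HC_analytic_on L (\<lambda>z. Ahalf L \<alpha> (U z)) (strip \<delta>) \<and>
            (\<forall>z\<in>strip \<delta>. hnorm L (Ahalf L \<alpha> (U z)) \<le> R \<alpha> * \<nu> * kap L ^ \<alpha>))))"
proof -
  have kap: "kap L > 0" using assms(1) by (simp add: kap_def)
  have gHC: "g \<in> HC" using assms(3) by (simp add: H_def)
  interpret nse "kap L" \<nu> "scal g" by unfold_locales (use kap assms(2) l2_scal[OF gHC] in auto)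
  have scalar: "sol (\<lambda>t. scal (u t))" "u t = vfield (scal (u t))" if "solution_in_attractor L \<nu> g u" for u t
    using solution_scalar[OF assms(1-3) that] by auto
  obtain \<delta> where \<delta>: "\<delta> > 0" "\<And>a. sol a \<Longrightarrow> \<exists>U. ext \<delta> a U" using ext_exists by blast
  obtain u0 where u0: "solution_in_attractor L \<nu> g u0" "u0 0 = (\<lambda>k. 0)"
    using assms(4) by (auto simp: attractor_def)
  obtain U0 where U0: "ext \<delta> (\<lambda>t. scal (u0 t)) U0" using \<delta>(2)[OF scalar(1)[OF u0(1)]] by blast
  have z0: "scal (u0 0) = (\<lambda>k. 0)" by (simp add: u0(2) scal_def dotc_def)
  obtain C where C0: "\<And>n. C n \<ge> 0" and C': "\<And>n a U. ext \<delta> a U \<Longrightarrow>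
      (\<forall>z\<in>strip (\<delta> * (1/2 + 1 / 2 ^ (n + 2))). \<forall>k. norm (U z k) \<le> C n * knorm k powr - real (n + 2))"
    using decay[OF \<delta>(1) U0 z0] by metis
  \<comment> \<open>The widths in \<open>decay\<close> all exceed \<open>\<delta> / 2\<close>, so
    one strip serves every order.\<close>
  have C: "norm (U z k) \<le> C n * knorm k powr - real (n + 2)" if "ext \<delta> a U" "z \<in> strip (\<delta> / 2)" for n a U z k
  proof -
    have "\<delta> / 2 \<le> \<delta> * (1/2 + 1 / 2 ^ (n + 2))" using \<delta>(1) by (simp add: algebra_simps)
    then have "z \<in> strip (\<delta> * (1/2 + 1 / 2 ^ (n + 2)))" using that(2) strip_mono by blast
    then show ?thesis using C'[OF that(1), of n] by blast
  qed
  define W4 where "W4 = (\<Sum>\<^sub>\<infinity>k. (knorm k powr -2)\<^sup>2)"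
  have W4: "W4 \<ge> 0" by (simp add: W4_def infsum_nonneg)
  \<comment> \<open>\<open>L\<close> comes from \<open>hnorm\<close>, and the division by
    \<open>\<nu>\<close> matches the normalisation of the claim.\<close>
  define R where "R \<alpha> = L * C \<alpha> * sqrt W4 / \<nu>" for \<alpha>
  \<comment> \<open>Discs of radius \<open>\<delta> / 4\<close> about points of this strip stay in
    \<open>strip (\<delta> / 2)\<close>, where the coefficient bounds hold.\<close>
  define d where "d = \<delta> / 4"
  have d: "d > 0" using \<delta>(1) by (simp add: d_def)
  have R0: "R \<alpha> \<ge> 0" for \<alpha> using assms(1,2) C0[of \<alpha>] W4 by (simp add: R_def)
  show ?thesis
  proof (intro exI[of _ d] exI[of _ R] conjI allI impI d R0, goal_cases)
    case (1 u)
    note u = 1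
    obtain U where U: "ext \<delta> (\<lambda>t. scal (u t)) U" using \<delta>(2)[OF scalar(1)[OF u]] by blast
    define V where "V \<alpha> z k = of_real ((kap L * knorm k) ^ \<alpha>) * U z k" for \<alpha> :: nat and z k
    \<comment> \<open>Of the decay of order \<open>\<alpha> + 2\<close>, the multiplier consumes
      \<open>\<alpha>\<close> powers; the remaining \<open>|k|^-2\<close> is square-summable on the
      lattice.\<close>
    define c where "c \<alpha> k = kap L ^ \<alpha> * C \<alpha> * knorm k powr -2" for \<alpha> :: nat and k
    have Vb: "norm (V \<alpha> z k) \<le> c \<alpha> k" if z: "z \<in> strip (\<delta> / 2)" for \<alpha> z k
    proof (cases "k = 0")
      case True
      have "z \<in> strip \<delta>" using z strip_mono[of "\<delta> / 2" \<delta>] \<delta>(1) by auto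
      then have "U z 0 = 0" using extD(3)[OF U, of z 0] by simp
      then show ?thesis using True by (simp add: V_def c_def)
    next
      case False
      have "norm (V \<alpha> z k) = (kap L * knorm k) ^ \<alpha> * norm (U z k)"
        using kap by (simp add: V_def norm_mult norm_power)
      also have "\<dots> \<le> (kap L * knorm k) ^ \<alpha> * (C \<alpha> * knorm k powr - real (\<alpha> + 2))"
        using kap by (intro mult_left_mono C[OF U z]) auto
      also have "\<dots> = kap L ^ \<alpha> * C \<alpha> * (knorm k powr real \<alpha> * knorm k powr - real (\<alpha> + 2))"
        using knorm_pos[OF False] by (simp add: power_mult_distrib powr_realpow)
      also have "knorm k powr real \<alpha> * knorm k powr - real (\<alpha> + 2) = knorm k powr -2"
        by (subst powr_add[symmetric]) simp
      finally show ?thesis by (simp add: c_def)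
    qed
    have c2: "(\<lambda>k. (c \<alpha> k)\<^sup>2) summable_on UNIV" for \<alpha>
      unfolding c_def power_mult_distrib by (rule summable_on_cmult_right) (use summable_knorm_powr_sq in simp)
    have Vh: "(\<lambda>z. V \<alpha> z k) holomorphic_on strip \<delta>" for \<alpha> k
      unfolding V_def by (intro holomorphic_intros extD(2)[OF U])
    have V0: "V \<alpha> z 0 = 0" if "z \<in> strip (\<delta> / 2)" for \<alpha> z
      using Vb[OF that, of \<alpha> 0] by (simp add: c_def)
    have ballz: "ball z (\<delta> / 4) \<subseteq> strip (\<delta> / 2)" if "z \<in> strip d" for z
      using cball_subset_strip[of z d "\<delta> / 4" "\<delta> / 2"] that ball_subset_cball[of z "\<delta> / 4"] by (auto simp: d_def)
    have s2: "strip (\<delta> / 2) \<subseteq> strip \<delta>" "strip d \<subseteq> strip (\<delta> / 2)" using \<delta>(1) by (auto simp: strip_def d_def)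
    have der: "has_cderiv L (\<lambda>z. vfield (V \<alpha> z)) (vfield (\<lambda>k. deriv (\<lambda>y. V \<alpha> y k) z)) z" if z: "z \<in> strip d" for \<alpha> z
    proof -
      note A = l2_analytic[where V = "V \<alpha>" and z = z and r = "\<delta> / 4" and c = "c \<alpha>"]
      have hol: "(\<lambda>y. V \<alpha> y k) holomorphic_on ball z (\<delta> / 4)" for k
        by (rule holomorphic_on_subset[OF Vh]) (use ballz[OF z] s2 in blast)
      have bd: "norm (V \<alpha> y k) \<le> c \<alpha> k" if "y \<in> ball z (\<delta> / 4)" for y k
        using ballz[OF z] that by (intro Vb) blast
      have r: "\<delta> / 4 > 0" using \<delta>(1) by simp
      let ?d = "\<lambda>h k. (V \<alpha> (z + h) k - V \<alpha> z k) / h - deriv (\<lambda>y. V \<alpha> y k) z"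
      let ?q = "\<lambda>h k. csc (1 / h) (vfield (V \<alpha> (z + h)) k - vfield (V \<alpha> z) k) - vfield (\<lambda>k. deriv (\<lambda>y. V \<alpha> y k) z) k"
      have lim: "((\<lambda>h. l2sq (?d h)) \<longlongrightarrow> 0) (at 0)" and l2d: "l2 (\<lambda>k. deriv (\<lambda>y. V \<alpha> y k) z)"
        using A[OF hol r bd c2] by blast+
      \<comment> \<open>\<open>vfield\<close> discards the zero mode while \<open>l2sq\<close>
        counts it, so \<open>hnorm_vfield\<close> needs this coefficient of the error to
        vanish.\<close>
      have dv0: "deriv (\<lambda>y. V \<alpha> y 0) z = 0"
      proof -
        have "deriv (\<lambda>y. V \<alpha> y 0) z = deriv (\<lambda>y. 0) z"
        proof (rule deriv_cong_ev)
          show "\<forall>\<^sub>F y in nhds z. V \<alpha> y 0 = 0"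
            using open_strip[of "\<delta> / 2"] z s2(2) V0 by (intro eventually_nhds_in_open[THEN eventually_mono, of "strip (\<delta> / 2)"]) auto
        qed simp
        then show ?thesis by simp
      qed
      have "((\<lambda>h. L * sqrt (l2sq (?d h))) \<longlongrightarrow> L * sqrt 0) (at 0)" by (intro tendsto_intros lim)
      then have lim': "((\<lambda>h. L * sqrt (l2sq (?d h))) \<longlongrightarrow> 0) (at 0)" by simp
      have "((\<lambda>h. hnorm L (?q h)) \<longlongrightarrow> 0) (at 0)"
      proof (rule Lim_transform_eventually[OF lim'])
        have "hnorm L (?q h) = L * sqrt (l2sq (?d h))"
          if h: "norm h < \<delta> / 4" for h
        proof -
          have "?q h = vfield (?d h)"
            unfolding vfield_diff csc_vfield by (rule ext) (simp add: vfield_def)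
          moreover have "z + h \<in> strip (\<delta> / 2)" using ballz[OF z] h by (auto simp: dist_norm)
          then have "?d h 0 = 0" using V0 z s2(2) by (simp add: dv0 subset_iff)
          ultimately show ?thesis by (simp add: hnorm_vfield[OF assms(1)])
        qed
        then show "\<forall>\<^sub>F h in at 0. L * sqrt (l2sq (?d h)) =
            hnorm L (?q h)"
          unfolding eventually_at using r by (intro exI[of _ "\<delta> / 4"]) (auto simp: dist_norm)
      qed
      then show ?thesis unfolding has_cderiv_def using vfield_HC[OF l2d] by blast
    qed
    have l2V: "l2 (V \<alpha> z)" if "z \<in> strip (\<delta> / 2)" for \<alpha> z
      unfolding l2_def by (rule summable_on_le[OF c2[of \<alpha>]]) (auto intro!: power_mono Vb that)
    have AV: "Ahalf L \<alpha> (vfield (U z)) = vfield (V \<alpha> z)" for \<alpha> z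
      unfolding Ahalf_vfield V_def ..
    have UV: "U = V 0" by (simp add: V_def fun_eq_iff)
    have ode: "vfield (\<lambda>k. deriv (\<lambda>y. U y k) z) k + csc (of_real \<nu>) (Aop L (vfield (U z)) k) + Bop L (vfield (U z)) (vfield (U z)) k = g k"
      if z: "z \<in> strip d" for z k
    proof -
      have l2U: "l2 (U z)" using l2V[of z 0] z s2(2) UV by auto
      have "vfield (\<lambda>k. deriv (\<lambda>y. U y k) z) k + csc (of_real \<nu>) (Aop L (vfield (U z)) k) + Bop L (vfield (U z)) (vfield (U z)) k
          = vfield (\<lambda>k. deriv (\<lambda>y. U y k) z + of_real \<nu> * (of_real ((kap L * knorm k)\<^sup>2) * U z k) + bil (kap L) (U z) (U z) k) k"
        by (simp only: Aop_def Ahalf_vfield Bop_vfield[OF l2U kap] csc_vfield vfield_add)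
      also have "\<dots> = vfield (scal g) k"
      proof (rule vfield_cong)
        assume k: "k \<noteq> 0"
        have "deriv (\<lambda>z. U z k) z = rhs (U z) k" by (rule extD(4)[OF U k]) (use z s2 in auto)
        then show "deriv (\<lambda>y. U y k) z + of_real \<nu> * (of_real ((kap L * knorm k)\<^sup>2) * U z k) + bil (kap L) (U z) (U z) k = scal g k"
          by (simp add: rhs_def lam_def \<mu>_def power_mult_distrib algebra_simps)
      qed
      finally show ?thesis by (simp add: vfield_scal[OF gHC])
    qed
    have bound: "hnorm L (vfield (V \<alpha> z)) \<le> R \<alpha> * \<nu> * kap L ^ \<alpha>" if z: "z \<in> strip d" for \<alpha> z
    proof -
      have z2: "z \<in> strip (\<delta> / 2)" using z s2 by blast
      have "l2sq (V \<alpha> z) \<le> (\<Sum>\<^sub>\<infinity>k. (c \<alpha> k)\<^sup>2)"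
        unfolding l2sq_def by (rule infsum_mono[OF l2V[OF z2, unfolded l2_def] c2]) (auto intro!: power_mono Vb z2)
      also have "\<dots> = (kap L ^ \<alpha> * C \<alpha>)\<^sup>2 * W4"
        unfolding c_def power_mult_distrib W4_def by (rule infsum_cmult_right')
      finally have "sqrt (l2sq (V \<alpha> z)) \<le> sqrt ((kap L ^ \<alpha> * C \<alpha>)\<^sup>2 * W4)" by (rule real_sqrt_le_mono)
      also have "\<dots> = kap L ^ \<alpha> * C \<alpha> * sqrt W4" using kap C0[of \<alpha>] by (simp add: real_sqrt_mult)
      finally have "L * sqrt (l2sq (V \<alpha> z)) \<le> L * (kap L ^ \<alpha> * C \<alpha> * sqrt W4)"
        using assms(1) by (intro mult_left_mono) auto
      also have "\<dots> = R \<alpha> * \<nu> * kap L ^ \<alpha>" using assms(2) by (simp add: R_def)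
      finally show ?thesis by (simp add: hnorm_vfield[OF assms(1)] V0[OF z2])
    qed
    show ?case
    proof (intro exI[of _ "\<lambda>z. vfield (U z)"] conjI allI ballI)
      show "vfield (U (complex_of_real t)) = u t" for t
        using extD(1)[OF U, of t] scalar(2)[OF u, of t] by simp
      show "\<exists>U'. has_cderiv L (\<lambda>z. vfield (U z)) U' z \<and>
          (\<forall>k. U' k + csc (complex_of_real \<nu>) (Aop L (vfield (U z)) k) + Bop L (vfield (U z)) (vfield (U z)) k = g k)" if "z \<in> strip d" for z
        using der[OF that, of 0] ode[OF that] unfolding UV[symmetric] by blast
      show "HC_analytic_on L (\<lambda>z. Ahalf L \<alpha> (vfield (U z))) (strip d)" for \<alpha>
        unfolding HC_analytic_on_def AV using der l2V vfield_HC s2(2) by blast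
      show "hnorm L (Ahalf L \<alpha> (vfield (U z))) \<le> R \<alpha> * \<nu> * kap L ^ \<alpha>" if "z \<in> strip d" for \<alpha> z
        unfolding AV by (rule bound[OF that])
    qed
  qed
qed

end
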